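(* Let $K\in\{K_0,K_1\}$ be one of the two standard maximal compact open subgroups of $G=U(2,1)(E/F)$ and let $\sigma$ be an irreducible smooth representation of $K$ over $\overline{\mathbf{F}}_p$. Then the compactly induced representation $\mathrm{ind}^G_K\sigma$, viewed as a left module over the spherical Hecke algebra $\mathcal{H}(K,\sigma)=\mathrm{End}_G(\mathrm{ind}^G_K\sigma)$, is a free $\mathcal{H}(K,\sigma)$-module of infinite rank.
   Context: Let $F$ be a non-archimedean local field of odd residue characteristic $p$, with residue field of cardinality $q$. Let $E/F$ be the unramified quadratic extension, with ring of integers $\mathfrak{o}_E$ and maximal ideal $\mathfrak{p}_E$, and let $x\mapsto\bar x$ be the nontrivial element of $\mathrm{Gal}(E/F)$. Let $\beta$ be the $3\times 3$ antidiagonal matrix with entries $1$ on the antidiagonal, and let $G=\{g\in GL_3(E): g^{T}\beta\bar g=\beta\}$ be the unitary group of the Hermitian form $h(v_1,v_2)=v_1^T\beta\bar v_2$ on $E^3$. Let $K_0=M_3(\mathfrak{o}_E)\cap G$ and let $K_1$ be the set of elements of $G$ whose entries $(a_{ij})$ satisfy $a_{11},a_{12},a_{22},a_{23},a_{33}\in\mathfrak{o}_E$, $a_{13}\in\mathfrak{p}_E^{-1}$, $a_{21},a_{31},a_{32}\in\mathfrak{p}_E$. The group $\mathrm{ind}^G_K\sigma$ is the space of locally constant functions $f:G\to W$ ($W$ the space of $\sigma$) with compact support such that $f(kg)=\sigma(k)f(g)$ for $k\in K$, $g\in G$, with $G$ acting by right translation. All representations are smooth over $\overline{\mathbf{F}}_p$.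 *)

theory Defs
  imports "HOL-Analysis.Analysis" "HOL-Computational_Algebra.Polynomial" "HOL-Library.Function_Algebras"
begin

text \<open>A discrete valuation on a field is modelled by a function w :: 'e => int whose
value at 0 is irrelevant; the predicate vge w x n means "x lies in p^n", i.e.
x = 0 or w x >= n.\<close>

definition vge :: "('e::field \<Rightarrow> int) \<Rightarrow> 'e \<Rightarrow> int \<Rightarrow> bool" where
  "vge w x n \<longleftrightarrow> x = 0 \<or> n \<le> w x"

definition discrete_valuation :: "('e::field \<Rightarrow> int) \<Rightarrow> bool" where
  "discrete_valuation w \<longleftrightarrow>
     (\<forall>x y. x \<noteq> 0 \<longrightarrow> y \<noteq> 0 \<longrightarrow> w (x * y) = w x + w y) \<and>
     (\<forall>x y. x \<noteq> 0 \<longrightarrow> y \<noteq> 0 \<longrightarrow> x + y \<noteq> 0 \<longrightarrow> min (w x) (w y) \<le> w (x + y)) \<and>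
     (\<forall>n. \<exists>x. x \<noteq> 0 \<and> w x = n)"

definition val_ring :: "('e::field \<Rightarrow> int) \<Rightarrow> 'e set" where
  "val_ring w = {x. vge w x 0}"

definition val_complete :: "('e::field \<Rightarrow> int) \<Rightarrow> bool" where
  "val_complete w \<longleftrightarrow>
     (\<forall>X :: nat \<Rightarrow> 'e.
        (\<forall>n. \<exists>N. \<forall>i\<ge>N. \<forall>j\<ge>N. vge w (X i - X j) n) \<longrightarrow>
        (\<exists>L. \<forall>n. \<exists>N. \<forall>i\<ge>N. vge w (X i - L) n))"

definition residue_classes :: "('e::field \<Rightarrow> int) \<Rightarrow> 'e set set" where
  "residue_classes w = (\<lambda>x. {y \<in> val_ring w. vge w (x - y) 1}) ` val_ring w"

definition nonarch_local_field :: "('e::field \<Rightarrow> int) \<Rightarrow> nat \<Rightarrow> bool" where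
  "nonarch_local_field w p \<longleftrightarrow>
     discrete_valuation w \<and> val_complete w \<and> finite (residue_classes w) \<and>
     prime p \<and> vge w (of_nat p) 1"

text \<open>E is a non-archimedean local field with residue characteristic p, c is a
valuation-preserving field automorphism of order exactly 2 (so F = Fix c is a
non-archimedean local field and E/F is quadratic with Gal(E/F) = {id, c}), and
E/F is unramified: F contains a uniformizer of E.\<close>
definition unramified_quadratic :: "('e::field \<Rightarrow> int) \<Rightarrow> ('e \<Rightarrow> 'e) \<Rightarrow> nat \<Rightarrow> bool" where
  "unramified_quadratic w c p \<longleftrightarrow>
     nonarch_local_field w p \<and>
     (\<forall>x y. c (x + y) = c x + c y) \<and> (\<forall>x y. c (x * y) = c x * c y) \<and> c 1 = 1 \<and>
     (\<forall>x. c (c x) = x) \<and> (\<exists>x. c x \<noteq> x) \<and>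
     (\<forall>x. x \<noteq> 0 \<longrightarrow> w (c x) = w x) \<and>
     (\<exists>\<pi>. c \<pi> = \<pi> \<and> \<pi> \<noteq> 0 \<and> w \<pi> = 1)"

type_synonym 'e mat3 = "'e^3^3"

definition beta :: "'e::field mat3" where
  "beta = (\<chi> i j. if (i, j) \<in> {(1, 3), (2, 2), (3, 1)} then 1 else 0)"

definition conjm :: "('e \<Rightarrow> 'e) \<Rightarrow> 'e mat3 \<Rightarrow> 'e mat3" where
  "conjm c A = (\<chi> i j. c (A $ i $ j))"

definition GL3 :: "'e::field mat3 set" where
  "GL3 = {g. \<exists>h. g ** h = mat 1 \<and> h ** g = mat 1}"

definition U21 :: "('e::field \<Rightarrow> 'e) \<Rightarrow> 'e mat3 set" where
  "U21 c = {g \<in> GL3. transpose g ** beta ** conjm c g = beta}"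

definition K0 :: "('e::field \<Rightarrow> int) \<Rightarrow> ('e \<Rightarrow> 'e) \<Rightarrow> 'e mat3 set" where
  "K0 w c = {g \<in> U21 c. \<forall>i j. vge w (g $ i $ j) 0}"

definition K1 :: "('e::field \<Rightarrow> int) \<Rightarrow> ('e \<Rightarrow> 'e) \<Rightarrow> 'e mat3 set" where
  "K1 w c = {g \<in> U21 c.
     vge w (g$1$1) 0 \<and> vge w (g$1$2) 0 \<and> vge w (g$2$2) 0 \<and> vge w (g$2$3) 0 \<and>
     vge w (g$3$3) 0 \<and> vge w (g$1$3) (-1) \<and>
     vge w (g$2$1) 1 \<and> vge w (g$3$1) 1 \<and> vge w (g$3$2) 1}"

text \<open>Principal congruence condition g = 1 mod p^n (these sets for n >= 1,
intersected with G, form a neighbourhood basis of 1 in G).\<close>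
definition congr :: "('e::field \<Rightarrow> int) \<Rightarrow> 'e mat3 \<Rightarrow> int \<Rightarrow> bool" where
  "congr w g n \<longleftrightarrow> (\<forall>i j. vge w (g $ i $ j - mat 1 $ i $ j) n)"

text \<open>'k is an algebraic closure of F_p: algebraically closed, characteristic p,
and every element lies in a finite subfield.\<close>
definition is_Fp_bar :: "'k::field itself \<Rightarrow> nat \<Rightarrow> bool" where
  "is_Fp_bar _ p \<longleftrightarrow> CHAR('k) = p \<and>
     (\<forall>P :: 'k poly. 0 < degree P \<longrightarrow> (\<exists>x. poly P x = 0)) \<and>
     (\<forall>x :: 'k. \<exists>n>0. x ^ (p ^ n) = x)"

definition smooth_irred_rep ::
  "('e::field \<Rightarrow> int) \<Rightarrow> 'e mat3 set \<Rightarrow> ('k::field \<Rightarrow> 'w::ab_group_add \<Rightarrow> 'w)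
     \<Rightarrow> ('e mat3 \<Rightarrow> 'w \<Rightarrow> 'w) \<Rightarrow> bool" where
  "smooth_irred_rep w K sc \<sigma> \<longleftrightarrow>
     module sc \<and>
     (\<forall>k\<in>K. \<forall>u v. \<sigma> k (u + v) = \<sigma> k u + \<sigma> k v) \<and>
     (\<forall>k\<in>K. \<forall>a v. \<sigma> k (sc a v) = sc a (\<sigma> k v)) \<and>
     (\<forall>v. \<sigma> (mat 1) v = v) \<and>
     (\<forall>k1\<in>K. \<forall>k2\<in>K. \<forall>v. \<sigma> (k1 ** k2) v = \<sigma> k1 (\<sigma> k2 v)) \<and>
     (\<forall>v. \<exists>n. \<forall>k\<in>K. congr w k n \<longrightarrow> \<sigma> k v = v) \<and>
     (\<exists>v. v \<noteq> (0::'w)) \<and>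
     (\<forall>S. module.subspace sc S \<longrightarrow> (\<forall>k\<in>K. \<sigma> k ` S \<subseteq> S) \<longrightarrow>
          S = {0} \<or> S = UNIV)"

definition cind ::
  "('e::field \<Rightarrow> int) \<Rightarrow> 'e mat3 set \<Rightarrow> 'e mat3 set \<Rightarrow> ('e mat3 \<Rightarrow> 'w \<Rightarrow> 'w::zero)
     \<Rightarrow> ('e mat3 \<Rightarrow> 'w) set" where
  "cind w G K \<sigma> = {f.
     (\<forall>g. g \<notin> G \<longrightarrow> f g = 0) \<and>
     (\<forall>k\<in>K. \<forall>g\<in>G. f (k ** g) = \<sigma> k (f g)) \<and>
     (\<forall>g\<in>G. \<exists>n. \<forall>h\<in>G. congr w h n \<longrightarrow> f (g ** h) = f g) \<and>
     (\<exists>S. finite S \<and> S \<subseteq> G \<and> (\<forall>g\<in>G. f g \<noteq> 0 \<longrightarrow> (\<exists>k\<in>K. \<exists>s\<in>S. g = k ** s)))}"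

definition rtrans :: "'e::semiring_1 mat3 \<Rightarrow> ('e mat3 \<Rightarrow> 'w) \<Rightarrow> ('e mat3 \<Rightarrow> 'w)" where
  "rtrans g f = (\<lambda>x. f (x ** g))"

text \<open>End_G(ind sigma): 'k-linear G-equivariant endomorphisms of the space V,
taken as functions on V (their values outside V are irrelevant).\<close>
definition hecke ::
  "'e::field mat3 set \<Rightarrow> ('k::field \<Rightarrow> 'w::ab_group_add \<Rightarrow> 'w) \<Rightarrow> ('e mat3 \<Rightarrow> 'w) set
     \<Rightarrow> (('e mat3 \<Rightarrow> 'w) \<Rightarrow> ('e mat3 \<Rightarrow> 'w)) set" where
  "hecke G sc V = {T.
     (\<forall>f\<in>V. T f \<in> V) \<and>
     (\<forall>f\<in>V. \<forall>f'\<in>V. T (f + f') = T f + T f') \<and>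
     (\<forall>f\<in>V. \<forall>a. T (\<lambda>x. sc a (f x)) = (\<lambda>x. sc a (T f x))) \<and>
     (\<forall>f\<in>V. \<forall>g\<in>G. T (rtrans g f) = rtrans g (T f))}"

definition free_basis ::
  "('v::ab_group_add \<Rightarrow> 'v) set \<Rightarrow> 'v set \<Rightarrow> 'v set \<Rightarrow> bool" where
  "free_basis H V B \<longleftrightarrow> B \<subseteq> V \<and>
     (\<forall>f\<in>V. \<exists>B0 T. finite B0 \<and> B0 \<subseteq> B \<and> (\<forall>b\<in>B0. T b \<in> H) \<and>
                     f = (\<Sum>b\<in>B0. T b b)) \<and>
     (\<forall>B0 T. finite B0 \<longrightarrow> B0 \<subseteq> B \<longrightarrow> (\<forall>b\<in>B0. T b \<in> H) \<longrightarrow>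
                     (\<Sum>b\<in>B0. T b b) = 0 \<longrightarrow> (\<forall>b\<in>B0. \<forall>f\<in>V. T b f = 0))"

end

theory Submission
  imports Defs
begin

text \<open>The group G acts on its tree, and K is the stabilizer of a vertex. A function in the
  compactly induced representation V is a finitely supported section over the orbit K\G of that
  vertex; filter V by the distance from the base vertex. In characteristic p the vectors of \<sigma>
  fixed by the pro-p radical of an Iwahori subgroup form a line, and dually for functionals.
  Hence the functions in the Hecke algebra supported on a given double coset
  K \<alpha>^n K form a line as well. The Hecke operator of the first nontrivial double coset raises
  the filtration by one. It is injective on the associated graded space, because each vertex on a
  sphere has exactly one neighbour on the preceding sphere and because the translates of the
  invariant functional under the radical separate points. So the Hecke algebra is the polynomial
  ring in this operator, and lifting bases of the cokernels on the graded pieces gives a free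
  basis. Every cokernel is nonzero, whence the rank is infinite.

  The two maximal compact subgroups are treated simultaneously by a parameter m in {0, 1}.\<close>

text \<open>The obstacle is that one-dimensionality of the invariants has to come from the group
  structure alone: \<open>\<sigma>\<close> is only known to be irreducible and smooth. It is
  extracted from one operator, \<open>swap_sum\<close>, the action of the double coset of the
  reflection on \<open>U\<close>-invariant functionals. Its square is a scalar multiple of itself,
  because the constant term of its quadratic relation is the index of \<open>U \<inter> Q\<close> in
  \<open>U\<close>, which is divisible by \<open>p\<close>. So it either kills a given invariant
  functional or maps it to an eigenfunctional, and an eigenfunctional \<open>\<phi>\<close> always
  exists. Whether its eigenvalue is zero or not, a vector on which all
  \<open>\<phi> (\<sigma> (s \<otimes> u) _)\<close> vanish is zero. This one fact gives the line of
  fixed vectors, its dual for functionals, and the injectivity of the Hecke operator, whose kernel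
  is the rank one map sending \<open>w\<close> to
  \<open>sc (\<phi> w) (\<sigma> s v0)\<close>.\<close>

section \<open>Free generation by a filtration-raising operator\<close>

text \<open>In degree 0 the predecessor of the filtration is {0}; so the hypothesis on T x says
  that T is injective on the associated graded space.\<close>

definition prev :: "(nat \<Rightarrow> 'v::zero set) \<Rightarrow> nat \<Rightarrow> 'v set" where
  "prev F n = (case n of 0 \<Rightarrow> {0} | Suc m \<Rightarrow> F m)"

lemma prev_simps [simp]: "prev F 0 = {0}" "prev F (Suc n) = F n"
  by (simp_all add: prev_def)

text \<open>\<open>T_inj\<close> makes the associated graded space torsion-free over the polynomials
  in \<open>T\<close>, and a torsion-free space graded in degrees bounded below is free over them.
  \<open>grow\<close> keeps the cokernel of \<open>T\<close> nonzero in every positive degree, which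
  forces infinite rank.\<close>

locale raising_operator = vector_space scl
  for scl :: "'k::field \<Rightarrow> 'v::ab_group_add \<Rightarrow> 'v" +
  fixes F :: "nat \<Rightarrow> 'v set" and T :: "'v \<Rightarrow> 'v"
  assumes F_sub: "subspace (F n)"
    and F_mono: "F n \<subseteq> F (Suc n)"
    and T_add: "T (x + y) = T x + T y"
    and T_scl: "T (scl a x) = scl a (T x)"
    and T_F: "x \<in> F n \<Longrightarrow> T x \<in> F (Suc n)"
    and T_inj: "x \<in> F n \<Longrightarrow> T x \<in> F n \<Longrightarrow> x \<in> prev F n"
    and grow: "\<exists>x\<in>F (Suc n). \<forall>a\<in>F n. \<forall>b\<in>F n. x \<noteq> a + T b"
begin

lemma T_0 [simp]: "T 0 = 0"
  using T_add[of 0 0] by simp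

lemma T_sum: "T (\<Sum>b\<in>B. f b) = (\<Sum>b\<in>B. T (f b))"
  by (induction B rule: infinite_finite_induct) (simp_all add: T_add)

lemma prev_sub: "subspace (prev F n)"
  by (cases n) (simp_all add: F_sub)

lemma prev_le: "prev F n \<subseteq> F n"
  using F_sub[of n] by (cases n) (auto simp: F_mono[THEN subsetD] subspace_0)

lemma F_mono_le: "m \<le> n \<Longrightarrow> F m \<subseteq> F n"
  using lift_Suc_mono_le[of F m n] F_mono by auto

lemma pow_F: "x \<in> F n \<Longrightarrow> (T ^^ j) x \<in> F (n + j)"
  by (induction j) (auto simp: T_F)

text \<open>The part of \<open>F n\<close> reached from lower degrees: modulo
  \<open>prev F n\<close> it is the image of \<open>T\<close> on the preceding graded piece. A basis
  of the quotient of \<open>F n\<close> by it is what gets lifted.\<close>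

definition S :: "nat \<Rightarrow> 'v set" where
  "S n = {a + T b | a b. a \<in> prev F n \<and> b \<in> prev F n}"

lemma S_sub: "subspace (S n)"
proof (rule subspaceI)
  show "0 \<in> S n"
    unfolding S_def using subspace_0[OF prev_sub[of n]] T_0 by force
next
  fix x y assume "x \<in> S n" "y \<in> S n"
  then obtain a b a' b' where h: "x = a + T b" "y = a' + T b'"
    "a \<in> prev F n" "b \<in> prev F n" "a' \<in> prev F n" "b' \<in> prev F n"
    unfolding S_def by auto
  have "x + y = (a + a') + T (b + b')"
    using h by (simp add: T_add algebra_simps)
  then show "x + y \<in> S n"
    unfolding S_def using h subspace_add[OF prev_sub[of n]] by blast
next
  fix c x assume "x \<in> S n"
  then obtain a b where h: "x = a + T b" "a \<in> prev F n" "b \<in> prev F n"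
    unfolding S_def by auto
  have "scl c x = scl c a + T (scl c b)"
    using h by (simp add: T_scl scale_right_distrib)
  then show "scl c x \<in> S n"
    unfolding S_def using h subspace_scale[OF prev_sub[of n]] by blast
qed

lemma prev_S: "prev F n \<subseteq> S n"
  unfolding S_def using subspace_0[OF prev_sub[of n]] T_0 by force

lemma S_le: "S n \<subseteq> F n"
proof
  fix x assume "x \<in> S n"
  then obtain a b where h: "x = a + T b" "a \<in> prev F n" "b \<in> prev F n"
    unfolding S_def by auto
  have "T b \<in> F n"
    using h(3) T_F subspace_0[OF F_sub] by (cases n) auto
  then show "x \<in> F n"
    unfolding h(1) using h(2) prev_le[of n] by (intro subspace_add[OF F_sub]) auto
qed

text \<open>A basis of \<open>X\<close> extends to one of \<open>Y\<close>, and the new members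
  represent a basis of the quotient. Both halves are phrased by finite sums, the form in which the
  filtration arguments use them.\<close>

lemma relative_basis:
  assumes "subspace X" "subspace Y" "X \<subseteq> Y"
  shows "\<exists>D\<subseteq>Y. (\<forall>B0 c. finite B0 \<longrightarrow> B0 \<subseteq> D \<longrightarrow> (\<Sum>b\<in>B0. scl (c b) b) \<in> X \<longrightarrow> (\<forall>b\<in>B0. c b = 0))
     \<and> (\<forall>f\<in>Y. \<exists>B0 c x. finite B0 \<and> B0 \<subseteq> D \<and> x \<in> X \<and> f = x + (\<Sum>b\<in>B0. scl (c b) b))"
proof -
  obtain A where A: "A \<subseteq> X" "independent A" "X \<subseteq> span A"
    using basis_exists[of X] by metis
  obtain C where C: "A \<subseteq> C" "C \<subseteq> Y" "independent C" "Y \<subseteq> span C"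
    using maximal_independent_subset_extend[of A Y] A assms(3) by blast
  have spA: "span A = X"
    using A assms(1) by (simp add: span_subspace)
  define D where "D = C - A"
  have ind: "\<forall>b\<in>B0. c b = 0"
    if B0: "finite B0" "B0 \<subseteq> D" and s: "(\<Sum>b\<in>B0. scl (c b) b) \<in> X" for B0 c
  proof -
    have "(\<Sum>b\<in>B0. scl (c b) b) \<in> span A"
      using s spA by simp
    then obtain t r where t: "finite t" "t \<subseteq> A" "(\<Sum>b\<in>B0. scl (c b) b) = (\<Sum>a\<in>t. scl (r a) a)"
      unfolding span_explicit by auto
    have dis: "B0 \<inter> t = {}"
      using B0 t D_def by auto
    \<comment> \<open>Subtracting the two expansions gives a relation inside the basis
      \<open>C\<close>, with these coefficients on the disjoint union of \<open>B0\<close> and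
      \<open>t\<close>.\<close>
    define u where "u b = (if b \<in> B0 then c b else - r b)" for b
    have "(\<Sum>b\<in>B0 \<union> t. scl (u b) b) = (\<Sum>b\<in>B0. scl (u b) b) + (\<Sum>b\<in>t. scl (u b) b)"
      using dis B0 t by (simp add: sum.union_disjoint)
    also have "(\<Sum>b\<in>B0. scl (u b) b) = (\<Sum>b\<in>B0. scl (c b) b)"
      by (simp add: u_def)
    also have "(\<Sum>b\<in>t. scl (u b) b) = (\<Sum>b\<in>t. - scl (r b) b)"
      by (rule sum.cong) (use dis in \<open>auto simp: u_def\<close>)
    finally have "(\<Sum>b\<in>B0 \<union> t. scl (u b) b) = 0"
      using t(3) by (simp add: sum_negf)
    moreover have "B0 \<union> t \<subseteq> C"
      using B0 t C D_def by auto
    ultimately have "\<forall>b\<in>B0 \<union> t. u b = 0"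
      using C(3) B0 t unfolding dependent_explicit by blast
    then show ?thesis
      unfolding u_def by (metis UnCI)
  qed
  have spn: "\<exists>B0 c x. finite B0 \<and> B0 \<subseteq> D \<and> x \<in> X \<and> f = x + (\<Sum>b\<in>B0. scl (c b) b)"
    if f: "f \<in> Y" for f
  proof -
    have "f \<in> span C"
      using f C by auto
    then obtain t r where t: "finite t" "t \<subseteq> C" "f = (\<Sum>a\<in>t. scl (r a) a)"
      unfolding span_explicit by auto
    have "f = (\<Sum>a\<in>t \<inter> A. scl (r a) a) + (\<Sum>a\<in>t - A. scl (r a) a)"
      using t by (metis add.commute sum.Int_Diff)
    moreover have "(\<Sum>a\<in>t \<inter> A. scl (r a) a) \<in> X"
      unfolding spA[symmetric] by (intro span_sum span_scale span_base) auto
    moreover have "finite (t - A)" "t - A \<subseteq> D"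
      using t D_def by auto
    ultimately show ?thesis
      by blast
  qed
  show ?thesis
    using ind spn C(2) D_def by (intro exI[of _ D]) auto
qed

section \<open>Lifted bases of the cokernels\<close>

definition D :: "nat \<Rightarrow> 'v set" where
  "D n = (SOME D. D \<subseteq> F n \<and>
     (\<forall>B0 c. finite B0 \<longrightarrow> B0 \<subseteq> D \<longrightarrow> (\<Sum>b\<in>B0. scl (c b) b) \<in> S n \<longrightarrow> (\<forall>b\<in>B0. c b = 0)) \<and>
     (\<forall>f\<in>F n. \<exists>B0 c x. finite B0 \<and> B0 \<subseteq> D \<and> x \<in> S n \<and> f = x + (\<Sum>b\<in>B0. scl (c b) b)))"

lemma D_props:
  "D n \<subseteq> F n \<and>
     (\<forall>B0 c. finite B0 \<longrightarrow> B0 \<subseteq> D n \<longrightarrow> (\<Sum>b\<in>B0. scl (c b) b) \<in> S n \<longrightarrow> (\<forall>b\<in>B0. c b = 0)) \<and>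
     (\<forall>f\<in>F n. \<exists>B0 c x. finite B0 \<and> B0 \<subseteq> D n \<and> x \<in> S n \<and> f = x + (\<Sum>b\<in>B0. scl (c b) b))"
  unfolding D_def by (rule someI_ex) (use relative_basis[OF S_sub F_sub S_le, of n] in blast)

lemma D_F: "D n \<subseteq> F n"
  using D_props[of n] by blast

lemma D_ind: "finite B0 \<Longrightarrow> B0 \<subseteq> D n \<Longrightarrow> (\<Sum>b\<in>B0. scl (c b) b) \<in> S n \<Longrightarrow> b \<in> B0 \<Longrightarrow> c b = 0"
  using D_props[of n] by blast

lemma D_span: "f \<in> F n \<Longrightarrow> \<exists>B0 c x. finite B0 \<and> B0 \<subseteq> D n \<and> x \<in> S n \<and> f = x + (\<Sum>b\<in>B0. scl (c b) b)"
  using D_props[of n] by blast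

lemma D_S: "b \<in> D n \<Longrightarrow> b \<notin> S n"
  using D_ind[of "{b}" n "\<lambda>_. 1" b] by auto

text \<open>\<open>D m\<close> lies in \<open>F m\<close>, hence in \<open>S n\<close> for larger
  \<open>n\<close>, whereas members of \<open>D n\<close> avoid \<open>S n\<close>. Disjointness
  makes the degree \<open>dg\<close> well defined.\<close>

lemma D_disj: "m < n \<Longrightarrow> D m \<inter> D n = {}"
proof -
  assume "m < n"
  then obtain n' where n: "n = Suc n'" "m \<le> n'"
    by (cases n) auto
  have "D m \<subseteq> S n"
    using D_F F_mono_le[OF n(2)] prev_S[of n] n by fastforce
  then show ?thesis
    using D_S by blast
qed

definition B :: "'v set" where "B = (\<Union>n. D n)"

definition dg :: "'v \<Rightarrow> nat" where "dg b = (THE n. b \<in> D n)"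

lemma dg_eq: "b \<in> D n \<Longrightarrow> dg b = n"
  unfolding dg_def by (rule the_equality) (use D_disj in \<open>auto dest: neq_iff[THEN iffD1]\<close>)

lemma dg_D: "b \<in> B \<Longrightarrow> b \<in> D (dg b)"
  unfolding B_def using dg_eq by auto

lemma infinite_B: "infinite B"
proof
  assume fin: "finite B"
  have "range (\<lambda>n. Suc n) \<subseteq> dg ` B"
  proof clarsimp
    fix n
    have "D (Suc n) \<noteq> {}"
    proof
      assume "D (Suc n) = {}"
      then have "F (Suc n) \<subseteq> S (Suc n)"
        using D_span[of _ "Suc n"] by fastforce
      then show False
        using grow[of n] unfolding S_def by fastforce
    qed
    then obtain b where "b \<in> D (Suc n)" by auto
    then show "Suc n \<in> dg ` B"
      using dg_eq[of b "Suc n"] unfolding B_def by (metis UN_I UNIV_I image_eqI)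
  qed
  then have "finite (range Suc)"
    using fin finite_surj by blast
  then show False
    using finite_imageD[of Suc UNIV] by auto
qed

text \<open>All the vectors in the sum sit in degree \<open>n\<close>, and the claim is their
  independence in that graded piece. Basis vectors of exact degree \<open>n\<close> are independent
  modulo the image of \<open>T\<close>, so their coefficients vanish; the injectivity of
  \<open>T\<close> on the graded space then pushes the remaining relation down by one
  degree.\<close>

lemma leading_independent:
  assumes "finite B0" "B0 \<subseteq> B"
    and "(\<Sum>b\<in>{b\<in>B0. dg b \<le> n}. scl (c b) ((T ^^ (n - dg b)) b)) \<in> prev F n"
    and "b \<in> B0" "dg b \<le> n"
  shows "c b = 0"
  using assms(3-5)
proof (induction n arbitrary: b)
  case 0
  have e: "(\<Sum>b\<in>{b\<in>B0. dg b \<le> 0}. scl (c b) ((T ^^ (0 - dg b)) b)) = (\<Sum>b\<in>{b\<in>B0. dg b = 0}. scl (c b) b)"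
    by (rule sum.cong) auto
  show ?case
  proof (rule D_ind[of "{b\<in>B0. dg b = 0}" 0])
    show "{b \<in> B0. dg b = 0} \<subseteq> D 0"
      using assms(2) dg_D by fastforce
    show "(\<Sum>b\<in>{b\<in>B0. dg b = 0}. scl (c b) b) \<in> S 0"
      using "0.prems"(1) e prev_S[of 0] by auto
  qed (use 0 assms(1) in auto)
next
  case (Suc n)
  let ?A = "{b\<in>B0. dg b = Suc n}" and ?C = "{b\<in>B0. dg b \<le> n}"
  let ?y = "\<Sum>b\<in>?C. scl (c b) ((T ^^ (n - dg b)) b)"
  have split: "{b\<in>B0. dg b \<le> Suc n} = ?A \<union> ?C"
    by auto
  have "(\<Sum>b\<in>{b\<in>B0. dg b \<le> Suc n}. scl (c b) ((T ^^ (Suc n - dg b)) b))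
      = (\<Sum>b\<in>?A. scl (c b) ((T ^^ (Suc n - dg b)) b)) + (\<Sum>b\<in>?C. scl (c b) ((T ^^ (Suc n - dg b)) b))"
    unfolding split by (rule sum.union_disjoint) (use assms(1) in auto)
  also have "(\<Sum>b\<in>?A. scl (c b) ((T ^^ (Suc n - dg b)) b)) = (\<Sum>b\<in>?A. scl (c b) b)"
    by (rule sum.cong) auto
  also have "(\<Sum>b\<in>?C. scl (c b) ((T ^^ (Suc n - dg b)) b)) = T ?y"
    unfolding T_sum by (rule sum.cong) (auto simp: Suc_diff_le T_scl)
  finally have eq: "(\<Sum>b\<in>{b\<in>B0. dg b \<le> Suc n}. scl (c b) ((T ^^ (Suc n - dg b)) b))
      = (\<Sum>b\<in>?A. scl (c b) b) + T ?y" .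
  have yF: "?y \<in> F n"
  proof (rule subspace_sum[OF F_sub], rule subspace_scale[OF F_sub])
    fix b assume b: "b \<in> ?C"
    then have "b \<in> F (dg b)"
      using dg_D D_F assms(2) by blast
    from pow_F[OF this, of "n - dg b"] show "(T ^^ (n - dg b)) b \<in> F n"
      using b by simp
  qed
  define z where "z = (\<Sum>b\<in>?A. scl (c b) b) + T ?y"
  have zF: "z \<in> F n"
    using Suc.prems(1) eq z_def by simp
  \<comment> \<open>The sum over \<open>?A\<close> is \<open>z - T ?y\<close> with both
    \<open>z\<close> and \<open>?y\<close> in \<open>F n\<close>, so it lies in
    \<open>S (Suc n)\<close>.\<close>
  have mS: "z + T (- ?y) \<in> S (Suc n)"
    unfolding S_def prev_simps using zF subspace_neg[OF F_sub yF] by blast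
  have "T (- ?y) = - T ?y"
    using T_add[of ?y "- ?y"] by (simp add: eq_neg_iff_add_eq_0 add.commute)
  then have "(\<Sum>b\<in>?A. scl (c b) b) \<in> S (Suc n)"
    using mS z_def by simp
  moreover have "?A \<subseteq> D (Suc n)"
    using assms(2) dg_D by fastforce
  ultimately have A0: "\<forall>b\<in>?A. c b = 0"
    using D_ind[of ?A "Suc n" c] assms(1) by simp
  then have "z = T ?y"
    unfolding z_def by simp
  then have "?y \<in> prev F n"
    using T_inj[OF yF] zF by simp
  then show ?case
    using Suc.IH[of b] Suc.prems A0 by (cases "dg b = Suc n") auto
qed

text \<open>Induction on a strict bound \<open>N\<close> for the degrees \<open>dg b + j\<close> of
  the terms that occur. The part of top degree is a relation of the kind
  \<open>leading_independent\<close> excludes, all other terms being lower.\<close>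

theorem powers_independent:
  assumes "finite B0" "B0 \<subseteq> B"
    and "(\<Sum>b\<in>B0. \<Sum>j\<le>m. scl (c b j) ((T ^^ j) b)) = 0"
  shows "\<forall>b\<in>B0. \<forall>j\<le>m. c b j = 0"
proof -
  have *: "\<forall>b\<in>B0. \<forall>j\<le>m. c b j = 0"
    if "\<forall>b\<in>B0. \<forall>j\<le>m. c b j \<noteq> 0 \<longrightarrow> dg b + j < N" for N
    using that
  proof (induction N)
    case (Suc N)
    \<comment> \<open>The coefficient of the one power of \<open>T\<close> that takes
      \<open>b\<close> to degree \<open>N\<close>. The subtraction is truncated, so this has a
      meaning only for \<open>dg b \<le> N\<close>, the range in which it is used.\<close>
    define c' where "c' b = (if N - dg b \<le> m then c b (N - dg b) else 0)" for b
    let ?C = "{b\<in>B0. dg b \<le> N}"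
    have "(\<Sum>j\<le>m. scl (c b j) ((T ^^ j) b))
        - (if dg b \<le> N then scl (c' b) ((T ^^ (N - dg b)) b) else 0) \<in> prev F N"
      if b: "b \<in> B0" for b
    proof -
      have bF: "b \<in> F (dg b)"
        using b dg_D D_F assms(2) by blast
      have low: "scl (c b j) ((T ^^ j) b) \<in> prev F N" if "j \<le> m" "dg b + j \<noteq> N" for j
      proof (cases "c b j = 0")
        case True
        then show ?thesis using subspace_0[OF prev_sub] by simp
      next
        case False
        then have lt: "dg b + j < N"
          using Suc.prems b that by fastforce
        then obtain N' where N': "N = Suc N'" "dg b + j \<le> N'"
          by (cases N) auto
        show ?thesis
          using pow_F[OF bF, of j] F_mono_le[OF N'(2)] subspace_scale[OF F_sub] N'(1) by auto
      qed
      show ?thesis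
      proof (cases "dg b \<le> N \<and> N - dg b \<le> m")
        case True
        have "(\<Sum>j\<le>m. scl (c b j) ((T ^^ j) b)) = scl (c b (N - dg b)) ((T ^^ (N - dg b)) b)
            + (\<Sum>j\<in>{..m} - {N - dg b}. scl (c b j) ((T ^^ j) b))"
          by (rule sum.remove) (use True in auto)
        moreover have "(\<Sum>j\<in>{..m} - {N - dg b}. scl (c b j) ((T ^^ j) b)) \<in> prev F N"
          by (rule subspace_sum[OF prev_sub], rule low) (use True in auto)
        ultimately show ?thesis
          using True by (simp add: c'_def)
      next
        case False
        have "(\<Sum>j\<le>m. scl (c b j) ((T ^^ j) b)) \<in> prev F N"
          by (rule subspace_sum[OF prev_sub], rule low) (use False in auto)
        then show ?thesis
          using False by (auto simp: c'_def)
      qed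
    qed
    then have "(\<Sum>b\<in>B0. (\<Sum>j\<le>m. scl (c b j) ((T ^^ j) b))
        - (if dg b \<le> N then scl (c' b) ((T ^^ (N - dg b)) b) else 0)) \<in> prev F N"
      by (rule subspace_sum[OF prev_sub])
    then have "- (\<Sum>b\<in>B0. if dg b \<le> N then scl (c' b) ((T ^^ (N - dg b)) b) else 0) \<in> prev F N"
      using assms(3) by (simp add: sum_subtractf)
    then have "(\<Sum>b\<in>?C. scl (c' b) ((T ^^ (N - dg b)) b)) \<in> prev F N"
      using subspace_neg[OF prev_sub] assms(1) by (fastforce simp: sum.inter_filter)
    then have c0: "c' b = 0" if "b \<in> B0" "dg b \<le> N" for b
      using leading_independent[OF assms(1,2), of c' N b] that by simp
    have "c b j \<noteq> 0 \<longrightarrow> dg b + j < N" if b: "b \<in> B0" "j \<le> m" for b j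
    proof
      assume nz: "c b j \<noteq> 0"
      have "dg b + j \<noteq> N"
        using c0[of b] b nz unfolding c'_def by auto
      then show "dg b + j < N"
        using Suc.prems b nz by fastforce
    qed
    then show ?case
      using Suc.IH by blast
  qed auto
  have fin: "finite (dg ` B0)"
    using assms(1) by simp
  show ?thesis
    by (rule *[of "Suc (Max (dg ` B0) + m)"])
      (use Max_ge[OF fin] in \<open>auto simp: less_Suc_eq_le intro!: add_mono\<close>)
qed

section \<open>Polynomials in the operator\<close>

definition Tpoly :: "nat \<Rightarrow> (nat \<Rightarrow> 'k) \<Rightarrow> 'v \<Rightarrow> 'v" where
  "Tpoly m c x = (\<Sum>j\<le>m. scl (c j) ((T ^^ j) x))"

definition gen :: "'v set" where
  "gen = {f. \<exists>B0 m c. finite B0 \<and> B0 \<subseteq> B \<and> f = (\<Sum>b\<in>B0. Tpoly m (c b) b)}"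

lemma gen_add:
  assumes "x \<in> gen" "y \<in> gen"
  shows "x + y \<in> gen"
proof -
  obtain B0 m c B1 n d where h: "finite B0" "B0 \<subseteq> B" "x = (\<Sum>b\<in>B0. Tpoly m (c b) b)"
    "finite B1" "B1 \<subseteq> B" "y = (\<Sum>b\<in>B1. Tpoly n (d b) b)"
    using assms unfolding gen_def by blast
  \<comment> \<open>Coefficients beyond the degree bound are arbitrary, not zero, so they must be
    cut off before both sums are raised to the common bound.\<close>
  let ?e = "\<lambda>b j. (if b \<in> B0 \<and> j \<le> m then c b j else 0) + (if b \<in> B1 \<and> j \<le> n then d b j else 0)"
  have t: "Tpoly k c' b = Tpoly (max k l) (\<lambda>j. if j \<le> k then c' j else 0) b" for k l c' b
    unfolding Tpoly_def by (rule sum.mono_neutral_cong_left) auto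
  have "x = (\<Sum>b\<in>B0 \<union> B1. Tpoly (max m n) (\<lambda>j. if b \<in> B0 \<and> j \<le> m then c b j else 0) b)"
    unfolding h(3) by (rule sum.mono_neutral_cong_left) (use h t[of m _ _ n] in \<open>auto simp: Tpoly_def\<close>)
  moreover have "y = (\<Sum>b\<in>B0 \<union> B1. Tpoly (max m n) (\<lambda>j. if b \<in> B1 \<and> j \<le> n then d b j else 0) b)"
    unfolding h(6)
    by (rule sum.mono_neutral_cong_left)
      (use h t[of n _ _ m] in \<open>auto simp: Tpoly_def max.commute\<close>)
  ultimately have "x + y = (\<Sum>b\<in>B0 \<union> B1. Tpoly (max m n) (?e b) b)"
    by (simp add: Tpoly_def scale_left_distrib sum.distrib)
  then show ?thesis
    unfolding gen_def using h by (intro CollectI exI[of _ "B0 \<union> B1"] exI[of _ "max m n"] exI[of _ ?e]) auto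
qed

lemma gen_0: "0 \<in> gen"
  unfolding gen_def by (intro CollectI exI[of _ "{}"]) auto

lemma gen_scl: "b \<in> B \<Longrightarrow> scl a b \<in> gen"
  unfolding gen_def
  by (intro CollectI exI[of _ "{b}"] exI[of _ 0] exI[of _ "\<lambda>_ _. a"]) (auto simp: Tpoly_def)

lemma gen_sum: "(\<And>b. b \<in> A \<Longrightarrow> f b \<in> gen) \<Longrightarrow> (\<Sum>b\<in>A. f b) \<in> gen"
  by (induction A rule: infinite_finite_induct) (auto simp: gen_0 gen_add)

lemma gen_T:
  assumes "x \<in> gen"
  shows "T x \<in> gen"
proof -
  obtain B0 m c where h: "finite B0" "B0 \<subseteq> B" "x = (\<Sum>b\<in>B0. Tpoly m (c b) b)"
    using assms unfolding gen_def by blast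
  have "T (Tpoly m (c b) b) = Tpoly (Suc m) (\<lambda>j. case j of 0 \<Rightarrow> 0 | Suc i \<Rightarrow> c b i) b" for b
    unfolding Tpoly_def T_sum sum.atMost_Suc_shift by (simp add: T_scl)
  then have "T x = (\<Sum>b\<in>B0. Tpoly (Suc m) (\<lambda>j. case j of 0 \<Rightarrow> 0 | Suc i \<Rightarrow> c b i) b)"
    unfolding h(3) T_sum by simp
  then show ?thesis
    unfolding gen_def using h
    by (intro CollectI exI[of _ B0] exI[of _ "Suc m"] exI[of _ "\<lambda>b j. case j of 0 \<Rightarrow> 0 | Suc i \<Rightarrow> c b i"])
      auto
qed

text \<open>Modulo \<open>S n\<close> an element is a combination of \<open>D n\<close>. What
  remains is \<open>a + T b\<close> with \<open>a\<close> and \<open>b\<close> of lower degree, and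
  \<open>gen\<close> is stable under \<open>T\<close>.\<close>

theorem powers_span: "f \<in> F n \<Longrightarrow> f \<in> gen"
proof (induction n arbitrary: f)
  case 0
  then obtain B0 c x where h: "finite B0" "B0 \<subseteq> D 0" "x \<in> S 0" "f = x + (\<Sum>b\<in>B0. scl (c b) b)"
    using D_span[of f 0] by auto
  have "x \<in> gen"
    using h(3) gen_0 by (auto simp: S_def)
  then show ?case
    unfolding h(4) by (intro gen_add gen_sum gen_scl) (use h in \<open>auto simp: B_def\<close>)
next
  case (Suc n)
  then obtain B0 c x where h: "finite B0" "B0 \<subseteq> D (Suc n)" "x \<in> S (Suc n)"
    "f = x + (\<Sum>b\<in>B0. scl (c b) b)"
    using D_span[of f "Suc n"] by auto
  have "x \<in> gen"
    using h(3) Suc.IH gen_add gen_T by (auto simp: S_def)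
  then show ?case
    unfolding h(4) by (intro gen_add gen_sum gen_scl) (use h in \<open>auto simp: B_def\<close>)
qed

lemma B_F: "B \<subseteq> (\<Union>n. F n)"
  unfolding B_def using D_F by blast

end

section \<open>Common eigenvectors\<close>

text \<open>Every orbit of \<open>f\<close> has exactly \<open>p\<close> elements: a coincidence
  among fewer iterates would, by Bezout, produce a fixed point of \<open>f\<close>. It serves to
  show that \<open>p\<close> divides the index of \<open>U \<inter> Q\<close> in
  \<open>U\<close>.\<close>

lemma prime_dvd_card_fixpoint_free:
  fixes f :: "'a \<Rightarrow> 'a"
  assumes fin: "finite A" and im: "f ` A \<subseteq> A" and per: "\<And>a. a \<in> A \<Longrightarrow> (f ^^ p) a = a"
    and nofix: "\<And>a. a \<in> A \<Longrightarrow> f a \<noteq> a" and p: "prime p"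
  shows "p dvd card A"
proof -
  have pA: "(f ^^ j) a \<in> A" if "a \<in> A" for a j
    using that im by (induction j) auto
  have perm: "(f ^^ (p * k)) a = a" if "a \<in> A" for a k
    using per[OF that] by (induction k) (auto simp: funpow_add)
  \<comment> \<open>Since \<open>f ^^ p\<close> is the identity on \<open>A\<close>, the iterate
    \<open>p * j - j\<close> undoes the iterate \<open>j\<close> while remaining a natural
    number.\<close>
  have inv: "(f ^^ (p * j - j)) ((f ^^ j) a) = a" if "a \<in> A" for a j
  proof -
    have "j \<le> p * j"
      using prime_gt_0_nat[OF p] by simp
    then have "(f ^^ (p * j - j)) ((f ^^ j) a) = (f ^^ (p * j)) a"
      by (metis comp_apply funpow_add le_add_diff_inverse2)
    then show ?thesis
      using perm[OF that] by simp
  qed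
  define r where "r = {(a, b). a \<in> A \<and> (\<exists>j. b = (f ^^ j) a)}"
  have "equiv A r"
  proof (rule equivI)
    show "r \<subseteq> A \<times> A"
      unfolding r_def using pA by auto
    show "refl_on A r"
      unfolding r_def refl_on_def by (auto intro: exI[of _ 0])
    show "sym r"
    proof (rule symI)
      fix a b assume "(a, b) \<in> r"
      then obtain j where "a \<in> A" "b = (f ^^ j) a"
        unfolding r_def by blast
      then show "(b, a) \<in> r"
        unfolding r_def using inv[of a j] pA[of a j]
        by (intro CollectI case_prodI conjI exI[of _ "p * j - j"]) auto
    qed
    show "trans r"
      unfolding r_def trans_def by clarsimp (metis comp_apply funpow_add)
  qed
  moreover have "\<forall>X\<in>A // r. p dvd card X"
  proof
    fix X assume "X \<in> A // r"
    then obtain a where a: "a \<in> A" "X = r `` {a}"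
      by (auto elim: quotientE)
    have "X = (\<lambda>j. (f ^^ j) a) ` {..<p}"
    proof
      show "X \<subseteq> (\<lambda>j. (f ^^ j) a) ` {..<p}"
      proof
        fix b assume "b \<in> X"
        then obtain j where j: "b = (f ^^ j) a"
          using a unfolding r_def by auto
        have "(f ^^ j) a = (f ^^ (j mod p)) ((f ^^ (p * (j div p))) a)"
          by (metis comp_apply funpow_add mod_mult_div_eq)
        then have "b = (f ^^ (j mod p)) a"
          using j perm[OF a(1)] by simp
        then show "b \<in> (\<lambda>j. (f ^^ j) a) ` {..<p}"
          using prime_gt_0_nat[OF p] by auto
      qed
    qed (use a in \<open>auto simp: r_def\<close>)
    moreover have "inj_on (\<lambda>j. (f ^^ j) a) {..<p}"
    proof (rule linorder_inj_onI)
      fix i j assume ij: "i < j" "i \<in> {..<p}" "j \<in> {..<p}"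
      show "(f ^^ i) a \<noteq> (f ^^ j) a"
      proof
        assume eq: "(f ^^ i) a = (f ^^ j) a"
        define b where "b = (f ^^ i) a"
        define d where "d = j - i"
        have b: "b \<in> A"
          using pA a b_def by simp
        have "(f ^^ d) b = b"
          unfolding b_def d_def using eq ij(1)
          by (metis comp_apply funpow_add le_add_diff_inverse2 less_imp_le)
        then have db: "(f ^^ (d * x)) b = b" for x
          by (induction x) (auto simp: funpow_add)
        have "\<not> p dvd d"
          using ij d_def by (auto dest: dvd_imp_le)
        then have "coprime d p"
          using p by (metis coprime_commute prime_imp_coprime)
        moreover have "d \<noteq> 0"
          using ij d_def by simp
        ultimately obtain x y where "d * x = p * y + 1"
          using bezout_nat[of d p] by auto
        then have "b = (f ^^ (p * y + 1)) b"
          using db[of x] by simp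
        also have "\<dots> = f b"
          using perm[OF b] by simp
        finally show False
          using nofix[OF b] by simp
      qed
    qed auto
    ultimately show "p dvd card X"
      by (simp add: card_image)
  qed
  ultimately show ?thesis
    using equiv_imp_dvd_card[OF fin] by blast
qed

lemma char_p_root_of_unity:
  fixes z :: "'k::field"
  assumes "CHAR('k) = p" "prime p" "z ^ p = 1"
  shows "z = 1"
proof -
  have "((z - 1) + 1) ^ p = (z - 1) ^ p + 1 ^ p"
    by (rule freshmans_dream) (use assms in auto)
  then have "(z - 1) ^ p + 1 = 1"
    using assms(3) by (simp only: diff_add_cancel power_one)
  then have "(z - 1) ^ p = 0"
    by (simp only: add_cancel_left_left)
  then show ?thesis
    using power_eq_0_iff by fastforce
qed

locale linear_space = vector_space scale for scale :: "'a::field \<Rightarrow> 'b::ab_group_add \<Rightarrow> 'b"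
begin

text \<open>Horner evaluation of the polynomial \<open>q\<close> at the operator \<open>x\<close>,
  applied to the vector \<open>y\<close>.\<close>

definition poly_act :: "('b \<Rightarrow> 'b) \<Rightarrow> 'b \<Rightarrow> 'a poly \<Rightarrow> 'b" where
  "poly_act x y q = fold_coeffs (\<lambda>a z. scale a y + x z) q 0"

lemma poly_act_0 [simp]: "poly_act x y 0 = 0"
  by (simp add: poly_act_def)

lemma poly_act_pCons: "x 0 = 0 \<Longrightarrow> poly_act x y (pCons a q) = scale a y + x (poly_act x y q)"
  by (cases "a = 0 \<and> q = 0") (auto simp: poly_act_def)

text \<open>The finite orbit of \<open>y\<close> takes the place of finite dimension: two equal
  powers give a nonzero polynomial annihilating \<open>y\<close>. One of least degree has a root
  \<open>z\<close>, and the cofactor \<open>r\<close> of the corresponding linear factor sends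
  \<open>y\<close> to an eigenvector, nonzero by minimality.\<close>

lemma eigenvector_exists:
  assumes closed: "\<And>P :: 'a poly. 0 < degree P \<Longrightarrow> \<exists>z. poly P z = 0"
    and Y: "subspace Y" and add: "\<And>u v. x (u + v) = x u + x v"
    and scl: "\<And>a v. x (scale a v) = scale a (x v)" and st: "\<And>y. y \<in> Y \<Longrightarrow> x y \<in> Y"
    and y: "y \<in> Y" "y \<noteq> 0" and fin: "finite (range (\<lambda>j. (x ^^ j) y))"
  shows "\<exists>z. \<exists>u\<in>Y. u \<noteq> 0 \<and> x u = scale z u"
proof -
  have x0: "x 0 = 0"
    using add[of 0 0] by simp
  note act = poly_act_pCons[of x, OF x0]
  have act_add: "poly_act x y (q + r) = poly_act x y q + poly_act x y r" for q r
    by (induction q r rule: poly_induct2) (simp_all add: act add scale_left_distrib algebra_simps)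
  have act_smult: "poly_act x y (smult a q) = scale a (poly_act x y q)" for a q
    by (induction q) (simp_all add: act scl scale_right_distrib)
  have act_Y: "poly_act x y q \<in> Y" for q
    by (induction q)
      (simp_all add: act subspace_0[OF Y] subspace_add[OF Y] subspace_scale[OF Y] y st)
  have act_monom: "poly_act x y (monom 1 j) = (x ^^ j) y" for j
    by (induction j) (simp_all add: monom_0 monom_Suc act x0)
  have "\<not> inj (\<lambda>j. (x ^^ j) y)"
    using fin finite_imageD infinite_UNIV_nat by blast
  then obtain i j where ij: "i \<noteq> j" "(x ^^ i) y = (x ^^ j) y"
    unfolding inj_def by blast
  define q0 where "q0 = monom 1 i + smult (- 1 :: 'a) (monom 1 j)"
  have q0: "q0 \<noteq> 0 \<and> poly_act x y q0 = 0"
  proof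
    show "q0 \<noteq> 0"
    proof
      assume "q0 = 0"
      then have "coeff q0 i = 0" by simp
      then show False using ij unfolding q0_def by simp
    qed
    show "poly_act x y q0 = 0"
      unfolding q0_def act_add act_smult act_monom using ij by simp
  qed
  obtain q where q: "q \<noteq> 0" "poly_act x y q = 0"
    and qmin: "\<And>r. r \<noteq> 0 \<and> poly_act x y r = 0 \<Longrightarrow> degree q \<le> degree r"
    using ex_has_least_nat[of "\<lambda>q. q \<noteq> 0 \<and> poly_act x y q = 0" q0 degree] q0 by blast
  have "degree q \<noteq> 0"
  proof
    assume "degree q = 0"
    then obtain a where a: "q = [:a:]"
      using degree_eq_zeroE by blast
    then show False
      using q y by (auto simp: act x0)
  qed
  then obtain z where z: "poly q z = 0"
    using closed by auto
  then obtain r where r: "q = [:- z, 1:] * r"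
    by (auto simp: poly_eq_0_iff_dvd elim: dvdE)
  have r0: "r \<noteq> 0"
    using q r by auto
  then have "degree r < degree q"
    unfolding r by (subst degree_mult_eq) auto
  then have u: "poly_act x y r \<noteq> 0"
    using qmin[of r] r0 by auto
  have "q = pCons 0 r + smult (- z) r"
    unfolding r by simp
  then have "poly_act x y q = poly_act x y (pCons 0 r) + poly_act x y (smult (- z) r)"
    using act_add by metis
  then have "poly_act x y q = x (poly_act x y r) - scale z (poly_act x y r)"
    unfolding act_smult act by simp
  then have "x (poly_act x y r) = scale z (poly_act x y r)"
    using q by simp
  then show ?thesis
    using u act_Y by blast
qed

text \<open>Commuting operators preserve each other's eigenspaces, so they are treated one at a time
  while \<open>Y\<close> shrinks to an eigenspace.\<close>

lemma common_eigenvector: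
  assumes closed: "\<And>P :: 'a poly. 0 < degree P \<Longrightarrow> \<exists>z. poly P z = 0"
    and "finite S" and "subspace Y" and "\<exists>y\<in>Y. y \<noteq> 0"
    and add: "\<And>i u v. i \<in> S \<Longrightarrow> x i (u + v) = x i u + x i v"
    and scl: "\<And>i a v. i \<in> S \<Longrightarrow> x i (scale a v) = scale a (x i v)"
    and st: "\<And>i y. i \<in> S \<Longrightarrow> y \<in> Y \<Longrightarrow> x i y \<in> Y"
    and comm: "\<And>i j y. i \<in> S \<Longrightarrow> j \<in> S \<Longrightarrow> y \<in> Y \<Longrightarrow> x i (x j y) = x j (x i y)"
    and fin: "\<And>i y. i \<in> S \<Longrightarrow> y \<in> Y \<Longrightarrow> finite (range (\<lambda>n. (x i ^^ n) y))"
  shows "\<exists>y\<in>Y. y \<noteq> 0 \<and> (\<forall>i\<in>S. \<exists>z. x i y = scale z y)"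
  using assms(2-)
proof (induction S arbitrary: Y rule: finite_induct)
  case empty
  then show ?case by auto
next
  case (insert i S)
  obtain y0 where y0: "y0 \<in> Y" "y0 \<noteq> 0"
    using insert.prems(2) by blast
  have "\<exists>z. \<exists>u\<in>Y. u \<noteq> 0 \<and> x i u = scale z u"
    by (rule eigenvector_exists[where x = "x i" and y = y0, OF closed insert.prems(1)])
      (use insert.prems y0 in auto)
  then obtain z u where u: "u \<in> Y" "u \<noteq> 0" "x i u = scale z u"
    by blast
  let ?Y = "{y \<in> Y. x i y = scale z y}"
  have x0: "x i 0 = 0"
    using insert.prems(3)[of i 0 0] by simp
  have "\<exists>y\<in>?Y. y \<noteq> 0 \<and> (\<forall>j\<in>S. \<exists>z. x j y = scale z y)"
  proof (rule insert.IH)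
    show "subspace ?Y"
      by (rule subspaceI)
        (use insert.prems(1,3,4) x0 in
          \<open>auto simp: subspace_0 subspace_add subspace_scale scale_right_distrib scale_left_commute\<close>)
    show "\<exists>y\<in>?Y. y \<noteq> 0"
      using u by blast
    show "x j y \<in> ?Y" if "j \<in> S" "y \<in> ?Y" for j y
      using that insert.prems(4)[of j] insert.prems(5)[of j y] insert.prems(6)[of i j y] by auto
    show "x j (u + v) = x j u + x j v" if "j \<in> S" for j u v
      using that insert.prems(3) by blast
    show "x j (scale a v) = scale a (x j v)" if "j \<in> S" for j a v
      using that insert.prems(4) by blast
    show "x j (x k y) = x k (x j y)" if "j \<in> S" "k \<in> S" "y \<in> ?Y" for j k y
      using that insert.prems(6) by blast
    show "finite (range (\<lambda>n. (x j ^^ n) y))" if "j \<in> S" "y \<in> ?Y" for j y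
      using that insert.prems(7) by blast
  qed
  then show ?case
    by auto
qed

end

section \<open>Fixed vectors of pro-p groups\<close>

text \<open>The operations are total on the carrier type, and G is a set of invertible elements:
  this matches matrix multiplication, which is associative on all matrices.\<close>

locale group_in_monoid =
  fixes mul :: "'g \<Rightarrow> 'g \<Rightarrow> 'g" (infixl "\<otimes>" 70) and one :: 'g ("\<one>")
    and iv :: "'g \<Rightarrow> 'g" and G :: "'g set"
  assumes assoc [simp]: "(x \<otimes> y) \<otimes> z = x \<otimes> (y \<otimes> z)"
    and one_l [simp]: "\<one> \<otimes> x = x" and one_r [simp]: "x \<otimes> \<one> = x"
    and G_one [simp]: "\<one> \<in> G"
    and G_mul [simp]: "x \<in> G \<Longrightarrow> y \<in> G \<Longrightarrow> x \<otimes> y \<in> G"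
    and G_iv [simp]: "x \<in> G \<Longrightarrow> iv x \<in> G"
    and iv_l [simp]: "x \<in> G \<Longrightarrow> iv x \<otimes> x = \<one>"
    and iv_r [simp]: "x \<in> G \<Longrightarrow> x \<otimes> iv x = \<one>"
begin

lemma iv_l' [simp]: "x \<in> G \<Longrightarrow> iv x \<otimes> (x \<otimes> y) = y"
  by (metis assoc iv_l one_l)

lemma iv_r' [simp]: "x \<in> G \<Longrightarrow> x \<otimes> (iv x \<otimes> y) = y"
  by (metis assoc iv_r one_l)

lemma iv_unique: "x \<in> G \<Longrightarrow> x \<otimes> y = \<one> \<Longrightarrow> iv x = y"
  by (metis iv_l' one_r)

lemma iv_iv [simp]: "x \<in> G \<Longrightarrow> iv (iv x) = x"
  by (rule iv_unique) auto

lemma iv_mul [simp]: "x \<in> G \<Longrightarrow> y \<in> G \<Longrightarrow> iv (x \<otimes> y) = iv y \<otimes> iv x"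
  by (rule iv_unique) auto

lemma iv_one [simp]: "iv \<one> = \<one>"
  by (rule iv_unique) auto

definition subgr :: "'g set \<Rightarrow> bool" where
  "subgr H \<longleftrightarrow> H \<subseteq> G \<and> \<one> \<in> H \<and> (\<forall>x\<in>H. \<forall>y\<in>H. x \<otimes> y \<in> H) \<and> (\<forall>x\<in>H. iv x \<in> H)"

lemma subgrD:
  assumes "subgr H"
  shows "x \<in> H \<Longrightarrow> x \<in> G" "\<one> \<in> H" "x \<in> H \<Longrightarrow> y \<in> H \<Longrightarrow> x \<otimes> y \<in> H" "x \<in> H \<Longrightarrow> iv x \<in> H"
  using assms unfolding subgr_def by auto

fun gpow :: "'g \<Rightarrow> nat \<Rightarrow> 'g" where
  "gpow x 0 = \<one>"
| "gpow x (Suc n) = x \<otimes> gpow x n"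

lemma gpow_subgr: "subgr H \<Longrightarrow> x \<in> H \<Longrightarrow> gpow x n \<in> H"
  by (induction n) (auto simp: subgrD)

lemma gpow_G [simp]: "x \<in> G \<Longrightarrow> gpow x n \<in> G"
  by (induction n) auto

definition cofinite_in :: "'g set \<Rightarrow> 'g set \<Rightarrow> bool" where
  "cofinite_in H' H \<longleftrightarrow> (\<exists>S. finite S \<and> S \<subseteq> H \<and> (\<forall>g\<in>H. \<exists>s\<in>S. iv s \<otimes> g \<in> H'))"

end

text \<open>The conditions say that \<open>P r\<close> modulo \<open>P (Suc r)\<close> is finite,
  commutative and killed by \<open>p\<close>-th powers, but on representatives, so that no quotient
  group has to be formed.\<close>

locale pro_p_filtration = group_in_monoid mul one iv G
  for mul :: "'g \<Rightarrow> 'g \<Rightarrow> 'g" (infixl "\<otimes>" 70) and one :: 'g ("\<one>") and iv G +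
  fixes K :: "'g set" and P :: "nat \<Rightarrow> 'g set" and T :: "'g set" and p :: nat
  assumes K_sub: "subgr K"
    and P_sub: "subgr (P r)" and P_K: "P r \<subseteq> K" and P_dec: "P (Suc r) \<subseteq> P r"
    and P_comm: "g \<in> P r \<Longrightarrow> h \<in> P r \<Longrightarrow> \<exists>z\<in>P (Suc r). g \<otimes> h = h \<otimes> g \<otimes> z"
    and P_pow: "g \<in> P r \<Longrightarrow> gpow g p \<in> P (Suc r)"
    and P_fin: "cofinite_in (P (Suc r)) (P r)"
    and T_sub: "subgr T" and T_K: "T \<subseteq> K"
    and T_comm: "t \<in> T \<Longrightarrow> t' \<in> T \<Longrightarrow> t \<otimes> t' = t' \<otimes> t"
    and T_norm: "t \<in> T \<Longrightarrow> h \<in> P 0 \<Longrightarrow> iv t \<otimes> h \<otimes> t \<in> P 0"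
    and T_fin: "cofinite_in (P 0) T"
    and p_prime: "prime p"
begin

lemma P_norm:
  assumes "g \<in> P r" "h \<in> P (Suc r)"
  shows "iv g \<otimes> h \<otimes> g \<in> P (Suc r)"
proof -
  obtain z where z: "z \<in> P (Suc r)" "h \<otimes> g = g \<otimes> h \<otimes> z"
    using P_comm[of h r g] assms P_dec by auto
  then have "iv g \<otimes> h \<otimes> g = h \<otimes> z"
    using subgrD(1)[OF P_sub assms(1)] by simp
  then show ?thesis
    using subgrD(3)[OF P_sub assms(2) z(1)] by simp
qed

text \<open>On vectors fixed by \<open>P (Suc r)\<close> the group \<open>P r\<close> acts through a
  finite commutative quotient of exponent \<open>p\<close>. A common eigenvector has eigenvalues
  that are \<open>p\<close>-th roots of unity, hence 1 in characteristic \<open>p\<close>.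
  Descending from a level that acts trivially leads to vectors fixed by \<open>P 0\<close>, among
  which the torus has a common eigenvector. The subspace \<open>Y\<close> lets the same statement
  serve vectors and functionals.\<close>

theorem fixed_eigenvector:
  fixes sc :: "'k::field \<Rightarrow> 'y::ab_group_add \<Rightarrow> 'y" and \<rho> :: "'g \<Rightarrow> 'y \<Rightarrow> 'y"
  assumes lin: "linear_space sc"
    and closed: "\<And>P :: 'k poly. 0 < degree P \<Longrightarrow> \<exists>z. poly P z = 0"
    and char: "CHAR('k) = p"
    and add: "\<And>g u v. g \<in> K \<Longrightarrow> \<rho> g (u + v) = \<rho> g u + \<rho> g v"
    and scl: "\<And>g a v. g \<in> K \<Longrightarrow> \<rho> g (sc a v) = sc a (\<rho> g v)"
    and hom: "\<And>g h v. g \<in> K \<Longrightarrow> h \<in> K \<Longrightarrow> \<rho> (g \<otimes> h) v = \<rho> g (\<rho> h v)"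
    and Y: "module.subspace sc Y" "\<exists>y\<in>Y. y \<noteq> 0" and st: "\<And>g y. g \<in> K \<Longrightarrow> y \<in> Y \<Longrightarrow> \<rho> g y \<in> Y"
    and id: "\<And>y. y \<in> Y \<Longrightarrow> \<rho> \<one> y = y"
    and N: "\<And>g y. g \<in> P N \<Longrightarrow> y \<in> Y \<Longrightarrow> \<rho> g y = y"
  shows "\<exists>y\<in>Y. y \<noteq> 0 \<and> (\<forall>g\<in>P 0. \<rho> g y = y) \<and> (\<forall>t\<in>T. \<exists>z. \<rho> t y = sc z y)"
proof -
  interpret linear_space sc by (rule lin)
  have KG: "g \<in> G" if "g \<in> K" for g
    using subgrD(1)[OF K_sub that] .
  have PK: "g \<in> K" if "g \<in> P r" for g r
    using that P_K by blast
  have pow: "((\<rho> g) ^^ n) y = \<rho> (gpow g n) y" if "g \<in> K" "y \<in> Y" for g n y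
    using that by (induction n) (simp_all add: id hom gpow_subgr[OF K_sub])
  define X where "X r = {y \<in> Y. \<forall>g\<in>P r. \<rho> g y = y}" for r
  have \<rho>0: "\<rho> g 0 = 0" if "g \<in> K" for g
    using add[OF that, of 0 0] by simp
  have Xsub: "subspace (X r)" for r
    unfolding X_def
  proof (rule subspaceI)
    show "0 \<in> {y \<in> Y. \<forall>g\<in>P r. \<rho> g y = y}"
      using subspace_0[OF Y(1)] \<rho>0[OF PK] by blast
    show "u + v \<in> {y \<in> Y. \<forall>g\<in>P r. \<rho> g y = y}"
      if "u \<in> {y \<in> Y. \<forall>g\<in>P r. \<rho> g y = y}" "v \<in> {y \<in> Y. \<forall>g\<in>P r. \<rho> g y = y}" for u v
      using that subspace_add[OF Y(1), of u v] add[OF PK, of _ r u v] by simp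
    show "sc a u \<in> {y \<in> Y. \<forall>g\<in>P r. \<rho> g y = y}"
      if "u \<in> {y \<in> Y. \<forall>g\<in>P r. \<rho> g y = y}" for a u
      using that subspace_scale[OF Y(1), of u a] scl[OF PK, of _ r a u] by simp
  qed
  have rep: "\<rho> g y = \<rho> s y" if "iv s \<otimes> g \<in> P r" "y \<in> X r" "s \<in> K" for g s y r
  proof -
    have "g = s \<otimes> (iv s \<otimes> g)"
      using that KG by simp
    then have "\<rho> g y = \<rho> s (\<rho> (iv s \<otimes> g) y)"
      using hom[of s "iv s \<otimes> g" y] PK[OF that(1)] that(3) by metis
    then show ?thesis
      using that unfolding X_def by simp
  qed
  have orb: "finite (range (\<lambda>n. ((\<rho> g) ^^ n) y))"
    if H: "subgr H" "H \<subseteq> K" "g \<in> H" "cofinite_in (P r) H" "y \<in> X r" for H g y r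
  proof -
    obtain S where S: "finite S" "S \<subseteq> H" "\<forall>g\<in>H. \<exists>s\<in>S. iv s \<otimes> g \<in> P r"
      using H(4) unfolding cofinite_in_def by blast
    have "((\<rho> g) ^^ n) y \<in> (\<lambda>s. \<rho> s y) ` S" for n
    proof -
      have "gpow g n \<in> H"
        using gpow_subgr H by blast
      then obtain s where s: "s \<in> S" "iv s \<otimes> gpow g n \<in> P r"
        using S by blast
      then have "\<rho> (gpow g n) y = \<rho> s y"
        using rep H S by blast
      then show ?thesis
        using s pow[of g y n] H unfolding X_def by auto
    qed
    then show ?thesis
      using S(1) by (meson finite_imageI finite_subset image_subsetI)
  qed
  have step: "\<exists>y\<in>X r. y \<noteq> 0" if "\<exists>y\<in>X (Suc r). y \<noteq> 0" for r
  proof -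
    obtain S where S: "finite S" "S \<subseteq> P r" "\<forall>g\<in>P r. \<exists>s\<in>S. iv s \<otimes> g \<in> P (Suc r)"
      using P_fin[of r] unfolding cofinite_in_def by blast
    have SK: "s \<in> K" if "s \<in> S" for s
      using that S PK by blast
    have "\<exists>y\<in>X (Suc r). y \<noteq> 0 \<and> (\<forall>s\<in>S. \<exists>z. \<rho> s y = sc z y)"
    proof (rule common_eigenvector[OF closed S(1) Xsub that])
      show "\<rho> s y \<in> X (Suc r)" if "s \<in> S" "y \<in> X (Suc r)" for s y
        unfolding X_def
      proof (intro CollectI conjI ballI)
        show "\<rho> s y \<in> Y"
          using that SK st unfolding X_def by blast
        fix h assume h: "h \<in> P (Suc r)"
        have n: "iv s \<otimes> h \<otimes> s \<in> P (Suc r)"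
          using P_norm h that S by blast
        have "\<rho> h (\<rho> s y) = \<rho> (s \<otimes> (iv s \<otimes> h \<otimes> s)) y"
          using hom[of h s y] PK[OF h] SK[OF that(1)] KG by simp
        also have "\<dots> = \<rho> s (\<rho> (iv s \<otimes> h \<otimes> s) y)"
          using hom PK[OF n] SK[OF that(1)] by blast
        also have "\<dots> = \<rho> s y"
          using n that(2) unfolding X_def by simp
        finally show "\<rho> h (\<rho> s y) = \<rho> s y" .
      qed
      show "\<rho> s (\<rho> s' y) = \<rho> s' (\<rho> s y)" if ss: "s \<in> S" "s' \<in> S" "y \<in> X (Suc r)" for s s' y
      proof -
        obtain z where z: "z \<in> P (Suc r)" "s \<otimes> s' = s' \<otimes> s \<otimes> z"
          using P_comm[of s r s'] ss S by blast
        have "\<rho> s (\<rho> s' y) = \<rho> ((s' \<otimes> s) \<otimes> z) y"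
          using hom[of s s' y] z(2) SK ss by simp
        also have "\<dots> = \<rho> (s' \<otimes> s) (\<rho> z y)"
          by (rule hom) (use SK ss PK[OF z(1)] subgrD(3)[OF K_sub] in auto)
        also have "\<dots> = \<rho> s' (\<rho> s y)"
          using hom[of s' s y] SK ss z unfolding X_def by simp
        finally show ?thesis .
      qed
      show "finite (range (\<lambda>n. (\<rho> s ^^ n) y))" if "s \<in> S" "y \<in> X (Suc r)" for s y
        by (rule orb[OF P_sub P_K _ P_fin that(2)]) (use that S in auto)
      show "\<rho> s (u + v) = \<rho> s u + \<rho> s v" if "s \<in> S" for s u v
      using add[OF SK[OF that]] .
    show "\<rho> s (sc a v) = sc a (\<rho> s v)" if "s \<in> S" for s a v
      using scl[OF SK[OF that]] .
  qed
    then obtain y where y: "y \<in> X (Suc r)" "y \<noteq> 0" "\<forall>s\<in>S. \<exists>z. \<rho> s y = sc z y"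
      by blast
    have fixS: "\<rho> s y = y" if s: "s \<in> S" for s
    proof -
      obtain z where z: "\<rho> s y = sc z y"
        using y s by blast
      have "(\<rho> s ^^ n) y = sc (z ^ n) y" for n
        by (induction n) (use z scl[OF SK[OF s]] in \<open>auto simp: mult.commute\<close>)
      moreover have "(\<rho> s ^^ p) y = y"
        using pow[of s y p] SK[OF s] y(1) P_pow[of s r] s S(2) unfolding X_def by auto
      ultimately have "sc (z ^ p - 1) y = 0"
        by (simp add: scale_left_diff_distrib)
      then have "z ^ p = 1"
        using y(2) by simp
      then have "z = 1"
        by (rule char_p_root_of_unity[OF char p_prime])
      then show ?thesis
        using z by simp
    qed
    have "\<rho> g y = y" if g: "g \<in> P r" for g
    proof -
      obtain s where "s \<in> S" "iv s \<otimes> g \<in> P (Suc r)"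
        using S g by blast
      then show ?thesis
        using rep[of s g "Suc r" y] fixS SK y(1) by simp
    qed
    then show ?thesis
      using y unfolding X_def by blast
  qed
  have "\<exists>y\<in>X N. y \<noteq> 0"
    using Y(2) N unfolding X_def by blast
  then have X0: "\<exists>y\<in>X 0. y \<noteq> 0"
    by (induction N) (use step in auto)
  obtain S where S: "finite S" "S \<subseteq> T" "\<forall>t\<in>T. \<exists>s\<in>S. iv s \<otimes> t \<in> P 0"
    using T_fin unfolding cofinite_in_def by blast
  have TK: "t \<in> K" if "t \<in> T" for t
    using that T_K by blast
  have SK: "s \<in> K" if "s \<in> S" for s
    using that S TK by blast
  have "\<exists>y\<in>X 0. y \<noteq> 0 \<and> (\<forall>s\<in>S. \<exists>z. \<rho> s y = sc z y)"
  proof (rule common_eigenvector[OF closed S(1) Xsub X0])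
    show "\<rho> s y \<in> X 0" if "s \<in> S" "y \<in> X 0" for s y
      unfolding X_def
    proof (intro CollectI conjI ballI)
      show "\<rho> s y \<in> Y"
        using that SK st unfolding X_def by blast
      fix h assume h: "h \<in> P 0"
      have n: "iv s \<otimes> h \<otimes> s \<in> P 0"
        using T_norm h that S by blast
      have "\<rho> h (\<rho> s y) = \<rho> (s \<otimes> (iv s \<otimes> h \<otimes> s)) y"
        using hom[of h s y] PK[OF h] SK[OF that(1)] KG by simp
      also have "\<dots> = \<rho> s (\<rho> (iv s \<otimes> h \<otimes> s) y)"
        using hom PK[OF n] SK[OF that(1)] by blast
      also have "\<dots> = \<rho> s y"
        using n that(2) unfolding X_def by simp
      finally show "\<rho> h (\<rho> s y) = \<rho> s y" .
    qed
    show "\<rho> s (\<rho> s' y) = \<rho> s' (\<rho> s y)" if "s \<in> S" "s' \<in> S" for s s' y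
    proof -
      have "s \<otimes> s' = s' \<otimes> s"
        using T_comm that S by blast
      then show ?thesis
        using hom[of s s' y] hom[of s' s y] that SK by simp
    qed
    show "finite (range (\<lambda>n. (\<rho> s ^^ n) y))" if "s \<in> S" "y \<in> X 0" for s y
      by (rule orb[OF T_sub T_K _ T_fin that(2)]) (use that S in auto)
    show "\<rho> s (u + v) = \<rho> s u + \<rho> s v" if "s \<in> S" for s u v
      using add[OF SK[OF that]] .
    show "\<rho> s (sc a v) = sc a (\<rho> s v)" if "s \<in> S" for s a v
      using scl[OF SK[OF that]] .
  qed
  then obtain y where y: "y \<in> X 0" "y \<noteq> 0" "\<forall>s\<in>S. \<exists>z. \<rho> s y = sc z y"
    by blast
  have "\<exists>z. \<rho> t y = sc z y" if t: "t \<in> T" for t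
  proof -
    obtain s where "s \<in> S" "iv s \<otimes> t \<in> P 0"
      using S t by blast
    then show ?thesis
      using rep[of s t 0 y] SK y by auto
  qed
  then show ?thesis
    using y unfolding X_def by blast
qed

end

section \<open>Sums over cosets\<close>

context group_in_monoid
begin

text \<open>The trace on \<open>A\<close> of a left coset of \<open>H\<close>. For subgroups
  \<open>A\<close> and \<open>H\<close>, neither inside the other, these are the left cosets of
  \<open>A \<inter> H\<close> in \<open>A\<close>.\<close>

definition cosetc :: "'g set \<Rightarrow> 'g set \<Rightarrow> 'g \<Rightarrow> 'g set" where
  "cosetc A H u = {u' \<in> A. iv u \<otimes> u' \<in> H}"

definition cosets_of :: "'g set \<Rightarrow> 'g set \<Rightarrow> 'g set set" where
  "cosets_of A H = cosetc A H ` A"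

definition rp :: "'g set \<Rightarrow> 'g" where "rp C = (SOME u. u \<in> C)"

text \<open>A sum over chosen representatives. It has an intrinsic meaning for functions invariant
  under \<open>H\<close> on the right, and the lemmas that change representatives assume this
  invariance.\<close>

definition coset_sum :: "'g set \<Rightarrow> 'g set \<Rightarrow> ('g \<Rightarrow> 'b::comm_monoid_add) \<Rightarrow> 'b" where
  "coset_sum A H h = (\<Sum>C\<in>cosets_of A H. h (rp C))"

context
  fixes A H :: "'g set"
  assumes A: "subgr A" and H: "subgr H"
begin

lemma cosetc_self: "u \<in> A \<Longrightarrow> u \<in> cosetc A H u"
  unfolding cosetc_def using subgrD[OF A] subgrD[OF H] by simp

lemma cosetc_eq:
  assumes u: "u \<in> A" "u' \<in> A"
  shows "cosetc A H u = cosetc A H u' \<longleftrightarrow> iv u \<otimes> u' \<in> H"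
proof
  show "iv u \<otimes> u' \<in> H" if "cosetc A H u = cosetc A H u'"
    using that cosetc_self[OF u(2)] unfolding cosetc_def by auto
  have *: "cosetc A H u \<subseteq> cosetc A H u'" if "iv u \<otimes> u' \<in> H" "u \<in> A" "u' \<in> A" for u u'
  proof
    fix x assume x: "x \<in> cosetc A H u"
    have "iv (iv u \<otimes> u') \<otimes> (iv u \<otimes> x) \<in> H"
      using x that subgrD(3,4)[OF H] unfolding cosetc_def by blast
    then show "x \<in> cosetc A H u'"
      using x that subgrD(1)[OF A] unfolding cosetc_def by simp
  qed
  show "cosetc A H u = cosetc A H u'" if q: "iv u \<otimes> u' \<in> H"
  proof -
    have "iv (iv u \<otimes> u') = iv u' \<otimes> u"
      using u subgrD(1)[OF A] by simp
    then have "iv u' \<otimes> u \<in> H"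
      using subgrD(4)[OF H q] by simp
    then show ?thesis
      using *[OF q u] *[of u' u] u by blast
  qed
qed

lemma cosetc_in: "u \<in> A \<Longrightarrow> cosetc A H u \<in> cosets_of A H"
  unfolding cosets_of_def by simp

lemma rp_cosetc:
  assumes "C \<in> cosets_of A H"
  shows "rp C \<in> A \<and> cosetc A H (rp C) = C"
proof -
  obtain u where u: "u \<in> A" "C = cosetc A H u"
    using assms unfolding cosets_of_def by auto
  have "rp C \<in> C"
    unfolding rp_def u(2) by (rule someI, rule cosetc_self, rule u(1))
  then have "rp C \<in> A" "iv u \<otimes> rp C \<in> H"
    unfolding u(2) cosetc_def by auto
  then show ?thesis
    using cosetc_eq[OF u(1)] u by auto
qed

lemma rp_cosetc_self: "u \<in> A \<Longrightarrow> rp (cosetc A H u) \<in> A \<and> iv u \<otimes> rp (cosetc A H u) \<in> H"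
  using rp_cosetc[OF cosetc_in] cosetc_eq by blast

lemma cosets_of_finite:
  assumes "cofinite_in H A"
  shows "finite (cosets_of A H)"
proof -
  obtain S where S: "finite S" "S \<subseteq> A" "\<forall>g\<in>A. \<exists>s\<in>S. iv s \<otimes> g \<in> H"
    using assms unfolding cofinite_in_def by blast
  have "cosets_of A H \<subseteq> cosetc A H ` S"
  proof
    fix C assume "C \<in> cosets_of A H"
    then obtain u where u: "u \<in> A" "C = cosetc A H u"
      unfolding cosets_of_def by auto
    then obtain r where "r \<in> S" "iv r \<otimes> u \<in> H"
      using S by blast
    then have "cosetc A H r = cosetc A H u" "r \<in> S"
      using u cosetc_eq[of r u] S by auto
    then show "C \<in> cosetc A H ` S"
      using u by (metis imageI)
  qed
  then show ?thesis
    using S finite_surj by blast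
qed

lemma coset_sum_cong: "(\<And>u. u \<in> A \<Longrightarrow> h u = h' u) \<Longrightarrow> coset_sum A H h = coset_sum A H h'"
  unfolding coset_sum_def by (rule sum.cong) (use rp_cosetc in auto)

text \<open>Injectivity of \<open>f\<close> modulo \<open>H\<close> gives an injective map of the
  finite set of cosets to itself, hence a permutation.\<close>

lemma coset_sum_reindex:
  assumes fin: "cofinite_in H A" and f: "\<And>u. u \<in> A \<Longrightarrow> f u \<in> A"
    and inj: "\<And>u u'. u \<in> A \<Longrightarrow> u' \<in> A \<Longrightarrow> iv (f u) \<otimes> f u' \<in> H \<Longrightarrow> iv u \<otimes> u' \<in> H"
    and h: "\<And>u q. u \<in> A \<Longrightarrow> q \<in> H \<Longrightarrow> h (u \<otimes> q) = h u"
  shows "coset_sum A H (\<lambda>u. h (f u)) = coset_sum A H h"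
proof -
  let ?g = "\<lambda>C. cosetc A H (f (rp C))"
  have "inj_on ?g (cosets_of A H)"
  proof (rule inj_onI)
    fix C C' assume CC: "C \<in> cosets_of A H" "C' \<in> cosets_of A H" "?g C = ?g C'"
    then have "iv (rp C) \<otimes> rp C' \<in> H"
      using inj[of "rp C" "rp C'"] cosetc_eq[of "f (rp C)" "f (rp C')"] f rp_cosetc by blast
    then show "C = C'"
      using cosetc_eq[of "rp C" "rp C'"] rp_cosetc CC by auto
  qed
  moreover have "?g ` cosets_of A H \<subseteq> cosets_of A H"
    using rp_cosetc f cosetc_in by blast
  ultimately have "bij_betw ?g (cosets_of A H) (cosets_of A H)"
    using cosets_of_finite[OF fin] by (metis bij_betw_def endo_inj_surj)
  then have "coset_sum A H h = (\<Sum>C\<in>cosets_of A H. h (rp (?g C)))"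
    unfolding coset_sum_def by (rule sum.reindex_bij_betw[symmetric])
  also have "\<dots> = coset_sum A H (\<lambda>u. h (f u))"
    unfolding coset_sum_def
  proof (rule sum.cong)
    fix C assume C: "C \<in> cosets_of A H"
    have fA: "f (rp C) \<in> A"
      using f rp_cosetc C by blast
    note r = conjunct2[OF rp_cosetc_self[OF fA]]
    show "h (rp (?g C)) = h (f (rp C))"
      using h[OF fA r] subgrD(1)[OF A fA] by simp
  qed simp
  finally show ?thesis ..
qed

lemma coset_sum_single:
  assumes fin: "cofinite_in H A" and x: "x \<in> A"
    and h: "\<And>u q. u \<in> A \<Longrightarrow> q \<in> H \<Longrightarrow> h (u \<otimes> q) = h u"
    and z: "\<And>u. u \<in> A \<Longrightarrow> h u \<noteq> 0 \<Longrightarrow> iv x \<otimes> u \<in> H"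
  shows "coset_sum A H h = h x"
proof -
  have "h (rp C) = 0" if C: "C \<in> cosets_of A H - {cosetc A H x}" for C
    using z[of "rp C"] rp_cosetc[of C] cosetc_eq[OF x, of "rp C"] C by auto
  then have "coset_sum A H h = h (rp (cosetc A H x))"
    unfolding coset_sum_def
    using sum.remove[OF cosets_of_finite[OF fin] cosetc_in[OF x], of "\<lambda>C. h (rp C)"] by simp
  then show ?thesis
    using h[OF x conjunct2[OF rp_cosetc_self[OF x]]] subgrD(1)[OF A x] by simp
qed

end

end

section \<open>Irreducible representations of K\<close>

text \<open>For the unitary group, U T Q is an Iwahori subgroup with torus T and pro-p radical U Q,
  Q is the pro-p radical of K, s represents the reflection, and ball n is the union of the double
  cosets K \<alpha>^j K with j \<le> n.\<close>

locale hecke_pair = group_in_monoid mul one iv G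
  for mul :: "'g \<Rightarrow> 'g \<Rightarrow> 'g" (infixl "\<otimes>" 70) and one :: 'g ("\<one>") and iv G +
  fixes K U T Q :: "'g set" and s \<alpha> :: 'g and p :: nat and ball :: "nat \<Rightarrow> 'g set"
  assumes K_sub: "subgr K"
    and U_sub: "subgr U" and U_K: "U \<subseteq> K" and T_sub: "subgr T" and T_K: "T \<subseteq> K"
    and Q_sub: "subgr Q" and Q_K: "Q \<subseteq> K"
    and Q_norm: "k \<in> K \<Longrightarrow> q \<in> Q \<Longrightarrow> k \<otimes> q \<otimes> iv k \<in> Q"
    and s_K: "s \<in> K" and s_s [simp]: "s \<otimes> s = \<one>"
    and \<alpha>_G [simp]: "\<alpha> \<in> G" and s_\<alpha>: "s \<otimes> \<alpha> \<otimes> s = iv \<alpha>"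
    and T_s: "t \<in> T \<Longrightarrow> s \<otimes> t \<otimes> s \<in> T"
    and T_U: "t \<in> T \<Longrightarrow> u \<in> U \<Longrightarrow> t \<otimes> u \<otimes> iv t \<in> U"
    and T_\<alpha>: "t \<in> T \<Longrightarrow> \<alpha> \<otimes> t = t \<otimes> \<alpha>"
    and K_dec: "k \<in> K \<Longrightarrow> (\<exists>u\<in>U. \<exists>t\<in>T. \<exists>q\<in>Q. k = u \<otimes> t \<otimes> q) \<or>
        (\<exists>u\<in>U. \<exists>t\<in>T. \<exists>u'\<in>U. k = u \<otimes> t \<otimes> s \<otimes> u')"
    and U_s: "u \<in> U \<Longrightarrow> u' \<in> U \<Longrightarrow> t \<in> T \<Longrightarrow> q \<in> Q \<Longrightarrow> s \<otimes> u \<otimes> s = u' \<otimes> t \<otimes> q \<Longrightarrow> u \<in> Q"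
    and U_fin: "cofinite_in Q U"
    and p_prime: "prime p" and U_p: "\<exists>z\<in>U. z \<notin> Q \<and> gpow z p \<in> Q"
    and U_\<alpha>: "u \<in> U \<Longrightarrow> iv \<alpha> \<otimes> u \<otimes> \<alpha> \<in> U \<inter> Q"
    and \<Gamma>_dec: "g \<in> K \<Longrightarrow> \<alpha> \<otimes> g \<otimes> iv \<alpha> \<in> K \<Longrightarrow>
        \<exists>u\<in>U. \<exists>t\<in>T. \<exists>u'\<in>U. g = s \<otimes> u \<otimes> s \<otimes> t \<otimes> (iv \<alpha> \<otimes> u' \<otimes> \<alpha>)"
    and \<Gamma>_fin: "cofinite_in {g \<in> K. \<alpha> \<otimes> g \<otimes> iv \<alpha> \<in> K} K"
    and ball_G: "ball n \<subseteq> G" and ball_0: "ball 0 = K"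
    and ball_Suc: "ball n \<subseteq> ball (Suc n)" and ball_exhaust: "g \<in> G \<Longrightarrow> \<exists>n. g \<in> ball n"
    and ball_l: "k \<in> K \<Longrightarrow> g \<in> ball n \<Longrightarrow> k \<otimes> g \<in> ball n"
    and ball_r: "k \<in> K \<Longrightarrow> g \<in> ball n \<Longrightarrow> g \<otimes> k \<in> ball n"
    and ball_\<alpha>: "g \<in> ball n \<Longrightarrow> \<alpha> \<otimes> g \<in> ball (Suc n)"
    and ball_iv\<alpha>: "g \<in> ball n \<Longrightarrow> iv \<alpha> \<otimes> g \<in> ball (Suc n)"
    and \<alpha>_ball: "gpow \<alpha> (Suc n) \<notin> ball n"
    and ball_parent: "k \<in> K \<Longrightarrow> \<alpha> \<otimes> k \<otimes> gpow \<alpha> (Suc n) \<in> ball n \<Longrightarrow> \<alpha> \<otimes> k \<otimes> s \<otimes> iv \<alpha> \<in> K"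
    and cartan: "g \<in> G \<Longrightarrow> \<exists>n. \<exists>k\<in>K. \<exists>k'\<in>K. g = k \<otimes> gpow \<alpha> n \<otimes> k'"
    and branching: "\<exists>q\<in>U \<inter> Q. \<alpha> \<otimes> q \<otimes> iv \<alpha> \<notin> K"
begin

lemma K_G: "k \<in> K \<Longrightarrow> k \<in> G" and U_G: "u \<in> U \<Longrightarrow> u \<in> G"
  and T_G: "t \<in> T \<Longrightarrow> t \<in> G" and Q_G: "q \<in> Q \<Longrightarrow> q \<in> G"
  using K_sub U_sub T_sub Q_sub subgrD(1) by blast+

lemma UK: "u \<in> U \<Longrightarrow> u \<in> K" and TK: "t \<in> T \<Longrightarrow> t \<in> K" and QK: "q \<in> Q \<Longrightarrow> q \<in> K"
  using U_K T_K Q_K by auto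

lemmas K_mul = subgrD(3)[OF K_sub] and K_iv = subgrD(4)[OF K_sub] and K_one = subgrD(2)[OF K_sub]
lemmas U_mul = subgrD(3)[OF U_sub] and U_iv = subgrD(4)[OF U_sub] and U_one = subgrD(2)[OF U_sub]
lemmas T_iv = subgrD(4)[OF T_sub]

lemma s_G [simp]: "s \<in> G"
  using s_K K_G by blast

lemma s_s' [simp]: "s \<otimes> (s \<otimes> x) = x"
  by (metis assoc one_l s_s)

lemma iv_s [simp]: "iv s = s"
  by (rule iv_unique) auto

lemma Q_norm': "k \<in> K \<Longrightarrow> q \<in> Q \<Longrightarrow> iv k \<otimes> q \<otimes> k \<in> Q"
  using Q_norm[OF K_iv] K_G by fastforce

lemma Q_s: "q \<in> Q \<Longrightarrow> s \<otimes> q \<otimes> s \<in> Q"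
  using Q_norm[OF s_K] by simp

lemma T_U': "t \<in> T \<Longrightarrow> u \<in> U \<Longrightarrow> iv t \<otimes> u \<otimes> t \<in> U"
  using T_U[OF T_iv] T_G by fastforce

lemma swap_nontrivial:
  assumes "u \<in> U" "u \<notin> Q"
  shows "\<exists>u1\<in>U. \<exists>t\<in>T. \<exists>u2\<in>U. s \<otimes> u \<otimes> s = u1 \<otimes> t \<otimes> s \<otimes> u2"
proof -
  have "s \<otimes> u \<otimes> s \<in> K"
    using assms UK s_K K_mul by simp
  then show ?thesis
    using K_dec[of "s \<otimes> u \<otimes> s"] U_s assms by blast
qed

abbreviation "cls \<equiv> cosetc U Q"

abbreviation "CL \<equiv> cosets_of U Q"

abbreviation csum :: "('g \<Rightarrow> 'b::comm_monoid_add) \<Rightarrow> 'b" where "csum \<equiv> coset_sum U Q"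

lemmas cls_eq = cosetc_eq[OF U_sub Q_sub]
lemmas rp_cls = rp_cosetc[OF U_sub Q_sub]
lemmas cls_CL = cosetc_in[OF U_sub Q_sub]
lemmas CL_finite = cosets_of_finite[OF U_sub Q_sub U_fin]
lemmas csum_def = coset_sum_def[of U Q]
lemmas csum_cong = coset_sum_cong[OF U_sub Q_sub]
lemmas csum_reindex = coset_sum_reindex[OF U_sub Q_sub U_fin]

text \<open>Left translation by an element \<open>z\<close> of order \<open>p\<close> modulo
  \<open>Q\<close> permutes the cosets. A fixed coset would put a conjugate of \<open>z\<close> into
  \<open>Q\<close>, and then \<open>z\<close> itself, as \<open>K\<close> normalizes
  \<open>Q\<close>.\<close>

lemma card_CL: "p dvd card CL"
proof -
  obtain z where z: "z \<in> U" "z \<notin> Q" "gpow z p \<in> Q"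
    using U_p by blast
  define f where "f C = cls (z \<otimes> rp C)" for C
  have f_cls: "f (cls u) = cls (z \<otimes> u)" if u: "u \<in> U" for u
  proof -
    have r: "rp (cls u) \<in> U" "cls (rp (cls u)) = cls u"
      using rp_cls[OF cls_CL[OF u]] by auto
    then have "iv (rp (cls u)) \<otimes> u \<in> Q"
      using cls_eq[OF r(1) u] by simp
    moreover have "iv (z \<otimes> rp (cls u)) \<otimes> (z \<otimes> u) = iv (rp (cls u)) \<otimes> u"
      using z r U_G by simp
    ultimately show ?thesis
      unfolding f_def using cls_eq[of "z \<otimes> rp (cls u)" "z \<otimes> u"] U_mul z(1) r(1) u by simp
  qed
  show ?thesis
  proof (rule prime_dvd_card_fixpoint_free[OF CL_finite _ _ _ p_prime])
    show "f ` CL \<subseteq> CL"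
      unfolding f_def using rp_cls cls_CL U_mul z(1) by blast
    fix C assume C: "C \<in> CL"
    then obtain u where u: "u \<in> U" "C = cls u"
      unfolding cosets_of_def by auto
    have "gpow z n \<in> U" for n
      using gpow_subgr[OF U_sub z(1)] .
    then have "(f ^^ n) C = cls (gpow z n \<otimes> u)" for n
      by (induction n) (simp_all add: u f_cls U_mul)
    moreover have "cls u = cls (gpow z p \<otimes> u)"
      using cls_eq[OF u(1), of "gpow z p \<otimes> u"] Q_norm'[OF UK[OF u(1)] z(3)]
        U_mul[OF gpow_subgr[OF U_sub z(1)] u(1)] by simp
    ultimately show "(f ^^ p) C = C"
      using u by simp
    show "f C \<noteq> C"
    proof
      assume "f C = C"
      then have "iv u \<otimes> (z \<otimes> u) \<in> Q"
        using f_cls[OF u(1)] u cls_eq[OF u(1), of "z \<otimes> u"] U_mul z(1) by simp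
      from Q_norm[OF UK[OF u(1)] this] show False
        using z u U_G by simp
    qed
  qed
qed

text \<open>The trivial coset is isolated because conjugation by \<open>s\<close> keeps its
  representative in \<open>Q\<close>, but moves every other representative into the big Bruhat
  cell.\<close>

lemma csum_split: "csum h = h (rp (cls \<one>)) + (\<Sum>C\<in>CL - {cls \<one>}. h (rp C))"
  unfolding csum_def by (rule sum.remove) (use CL_finite cls_CL U_one in auto)

lemma rp_one: "rp (cls \<one>) \<in> U \<inter> Q"
proof -
  have "rp (cls \<one>) \<in> U" "cls (rp (cls \<one>)) = cls \<one>"
    using rp_cls cls_CL U_one by auto
  then show ?thesis
    using cls_eq[OF U_one, of "rp (cls \<one>)"] by simp
qed

lemma rp_nontrivial: "C \<in> CL - {cls \<one>} \<Longrightarrow> rp C \<in> U \<and> rp C \<notin> Q"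
  using rp_cls[of C] cls_eq[OF U_one, of "rp C"] by auto

end

lemma sum_fun_apply: "(\<Sum>i\<in>A. f i) x = (\<Sum>i\<in>A. f i x)"
  for f :: "'i \<Rightarrow> 'x \<Rightarrow> 'y::comm_monoid_add"
  by (induction A rule: infinite_finite_induct) simp_all

definition functional :: "('k::field \<Rightarrow> 'w::ab_group_add \<Rightarrow> 'w) \<Rightarrow> ('w \<Rightarrow> 'k) \<Rightarrow> bool" where
  "functional sc l \<longleftrightarrow> (\<forall>u v. l (u + v) = l u + l v) \<and> (\<forall>a v. l (sc a v) = a * l v)"

locale hecke_rep = hecke_pair mul one iv G K U T Q s \<alpha> p ball + linear_space sc
  for mul :: "'g \<Rightarrow> 'g \<Rightarrow> 'g" (infixl "\<otimes>" 70) and one :: 'g ("\<one>") and iv G K U T Q s \<alpha> p ball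
    and sc :: "'k::field \<Rightarrow> 'w::ab_group_add \<Rightarrow> 'w" +
  fixes \<sigma> :: "'g \<Rightarrow> 'w \<Rightarrow> 'w"
  assumes \<sigma>_add: "k \<in> K \<Longrightarrow> \<sigma> k (u + v) = \<sigma> k u + \<sigma> k v"
    and \<sigma>_scl: "k \<in> K \<Longrightarrow> \<sigma> k (sc a v) = sc a (\<sigma> k v)"
    and \<sigma>_one [simp]: "\<sigma> \<one> v = v"
    and \<sigma>_mul: "k \<in> K \<Longrightarrow> k' \<in> K \<Longrightarrow> \<sigma> (k \<otimes> k') v = \<sigma> k (\<sigma> k' v)"
    and irreducible: "subspace S \<Longrightarrow> (\<And>k w. k \<in> K \<Longrightarrow> w \<in> S \<Longrightarrow> \<sigma> k w \<in> S) \<Longrightarrow> w \<in> S \<Longrightarrow> w \<noteq> 0 \<Longrightarrow> S = UNIV"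
    and char_p: "of_nat p = (0::'k)"
    and ex_functional: "\<exists>l. functional sc l \<and> (\<exists>w. l w \<noteq> 0) \<and> (\<forall>u\<in>U. \<forall>w. l (\<sigma> u w) = l w)
        \<and> (\<forall>t\<in>T. \<exists>a. \<forall>w. l (\<sigma> t w) = a * l w)"
    and ex_vector: "\<exists>v. v \<noteq> 0 \<and> (\<forall>u\<in>U. \<sigma> u v = v) \<and> (\<forall>q\<in>Q. \<sigma> q v = v)"
begin

lemma \<sigma>_0 [simp]: "k \<in> K \<Longrightarrow> \<sigma> k 0 = 0"
  using \<sigma>_add[of k 0 0] by simp

lemma \<sigma>_sum: "k \<in> K \<Longrightarrow> \<sigma> k (\<Sum>i\<in>A. f i) = (\<Sum>i\<in>A. \<sigma> k (f i))"
  by (induction A rule: infinite_finite_induct) (simp_all add: \<sigma>_add)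

lemma \<sigma>_csum: "k \<in> K \<Longrightarrow> \<sigma> k (csum f) = csum (\<lambda>u. \<sigma> k (f u))"
  unfolding csum_def by (rule \<sigma>_sum)

text \<open>As \<open>K\<close> normalizes \<open>Q\<close>, the vectors fixed by \<open>Q\<close>
  form a subrepresentation, nonzero by \<open>ex_vector\<close>.\<close>

lemma Q_trivial [simp]:
  assumes q: "q \<in> Q"
  shows "\<sigma> q w = w"
proof -
  let ?S = "{w. \<forall>q\<in>Q. \<sigma> q w = w}"
  obtain v where v: "v \<noteq> 0" "\<forall>q\<in>Q. \<sigma> q v = v"
    using ex_vector by blast
  have "?S = UNIV"
  proof (rule irreducible[of ?S v])
    show "subspace ?S"
      by (rule subspaceI) (auto simp: \<sigma>_add \<sigma>_scl QK)
    show "\<sigma> k w \<in> ?S" if k: "k \<in> K" and w: "w \<in> ?S" for k w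
    proof (intro CollectI ballI)
      fix q assume q: "q \<in> Q"
      have n: "iv k \<otimes> q \<otimes> k \<in> Q"
        using Q_norm'[OF k q] .
      have "\<sigma> q (\<sigma> k w) = \<sigma> (k \<otimes> (iv k \<otimes> q \<otimes> k)) w"
        using \<sigma>_mul[OF QK[OF q] k, of w] K_G[OF k] by simp
      also have "\<dots> = \<sigma> k w"
        using \<sigma>_mul[OF k QK[OF n], of w] n w by simp
      finally show "\<sigma> q (\<sigma> k w) = \<sigma> k w" .
    qed
  qed (use v in auto)
  then show ?thesis
    using q by blast
qed

lemma functional_add: "functional sc l \<Longrightarrow> l (u + v) = l u + l v"
  and functional_scl: "functional sc l \<Longrightarrow> l (sc a v) = a * l v"
  unfolding functional_def by auto

lemma functional_0: "functional sc l \<Longrightarrow> l 0 = 0"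
  using functional_scl[of l 0 0] by simp

lemma functional_sum: "functional sc l \<Longrightarrow> l (\<Sum>i\<in>A. f i) = (\<Sum>i\<in>A. l (f i))"
  by (induction A rule: infinite_finite_induct) (simp_all add: functional_add functional_0)

lemma functional_csum: "functional sc l \<Longrightarrow> l (csum f) = csum (\<lambda>u. l (f u))"
  unfolding csum_def by (rule functional_sum)

lemma functional_\<sigma>: "functional sc l \<Longrightarrow> k \<in> K \<Longrightarrow> functional sc (\<lambda>w. l (\<sigma> k w))"
  unfolding functional_def by (simp add: \<sigma>_add \<sigma>_scl)

text \<open>The vectors killed by all translates of \<open>l\<close> form a subrepresentation;
  containing \<open>v\<close>, it is everything.\<close>

lemma functional_eq_0:
  assumes l: "functional sc l" and v: "v \<noteq> 0" "\<And>k. k \<in> K \<Longrightarrow> l (\<sigma> k v) = 0"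
  shows "l w = 0"
proof -
  let ?S = "{w. \<forall>k\<in>K. l (\<sigma> k w) = 0}"
  have "?S = UNIV"
  proof (rule irreducible[of ?S v])
    show "subspace ?S"
    proof (rule subspaceI)
      show "x + y \<in> ?S" if "x \<in> ?S" "y \<in> ?S" for x y
        using that \<sigma>_add[of _ x y] functional_add[OF l] by simp
      show "sc a x \<in> ?S" if "x \<in> ?S" for a x
        using that \<sigma>_scl[of _ a x] functional_scl[OF l] by simp
    qed (simp add: functional_0[OF l])
    show "\<sigma> k w \<in> ?S" if k: "k \<in> K" and w: "w \<in> ?S" for k w
    proof (intro CollectI ballI)
      fix k' assume k': "k' \<in> K"
      show "l (\<sigma> k' (\<sigma> k w)) = 0"
        using bspec[OF CollectD[OF w] K_mul[OF k' k]] \<sigma>_mul[OF k' k, of w] by (rule back_subst[where P = "\<lambda>x. l x = 0"])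
    qed
  qed (use v in auto)
  then have "l (\<sigma> \<one> w) = 0"
    using K_one by blast
  then show ?thesis
    by simp
qed

section \<open>Weights and the swap operator\<close>

definition weight :: "('w \<Rightarrow> 'k) \<Rightarrow> bool" where
  "weight l \<longleftrightarrow> functional sc l \<and> (\<exists>w. l w \<noteq> 0) \<and> (\<forall>u\<in>U. \<forall>w. l (\<sigma> u w) = l w)
     \<and> (\<forall>t\<in>T. \<exists>a. \<forall>w. l (\<sigma> t w) = a * l w)"

text \<open>The double coset of \<open>s\<close> acting on \<open>U\<close>-invariant functionals,
  as in the Hecke algebra of a finite group of rank one. For such functionals the terms depend only
  on the class of \<open>u\<close>, since \<open>Q\<close> acts trivially.\<close>

definition swap_sum :: "('w \<Rightarrow> 'k) \<Rightarrow> 'w \<Rightarrow> 'k" where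
  "swap_sum l w = csum (\<lambda>u. l (\<sigma> (s \<otimes> u) w))"

lemma s_invariant:
  assumes l: "\<And>u w. u \<in> U \<Longrightarrow> l (\<sigma> u w) = l w" and u: "u \<in> U" and q: "q \<in> Q"
  shows "l (\<sigma> (s \<otimes> (u \<otimes> q)) w) = l (\<sigma> (s \<otimes> u) w)"
  using \<sigma>_mul[OF K_mul[OF s_K UK[OF u]] QK[OF q], of w] q by simp

text \<open>Both parts permute the cosets: the first by right translation, where normality of
  \<open>Q\<close> enters, the second by left translation. The second form is the one met in the
  quadratic relation.\<close>

lemma swap_sum_U:
  assumes l: "\<And>u w. u \<in> U \<Longrightarrow> l (\<sigma> u w) = l w" and u: "u \<in> U"
  shows "swap_sum l (\<sigma> u w) = swap_sum l w" and "csum (\<lambda>u'. l (\<sigma> (s \<otimes> (u \<otimes> u')) w)) = swap_sum l w"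
proof -
  note inv = s_invariant[of l, OF l]
  have "swap_sum l (\<sigma> u w) = csum (\<lambda>u'. l (\<sigma> (s \<otimes> (u' \<otimes> u)) w))"
    unfolding swap_sum_def
    by (rule csum_cong) (use \<sigma>_mul[OF K_mul[OF s_K UK] UK[OF u], of _ w] in simp)
  also have "\<dots> = csum (\<lambda>u'. l (\<sigma> (s \<otimes> u') w))"
  proof (rule csum_reindex)
    show "iv v \<otimes> v' \<in> Q" if "v \<in> U" "v' \<in> U" "iv (v \<otimes> u) \<otimes> (v' \<otimes> u) \<in> Q" for v v'
      using Q_norm[OF UK[OF u] that(3)] that U_G u by simp
  qed (use u U_mul inv in auto)
  finally show "swap_sum l (\<sigma> u w) = swap_sum l w"
    unfolding swap_sum_def .
  show "csum (\<lambda>u'. l (\<sigma> (s \<otimes> (u \<otimes> u')) w)) = swap_sum l w"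
    unfolding swap_sum_def
  proof (rule csum_reindex)
    show "iv v \<otimes> v' \<in> Q" if "v \<in> U" "v' \<in> U" "iv (u \<otimes> v) \<otimes> (u \<otimes> v') \<in> Q" for v v'
      using that U_G u by simp
  qed (use u U_mul inv in auto)
qed

text \<open>Moving \<open>t\<close> to the left past \<open>s\<close> turns it into
  \<open>s \<otimes> t \<otimes> s\<close>, so the torus character of \<open>l\<close> reappears
  twisted by the reflection, while conjugation by \<open>t\<close> permutes the cosets of
  \<open>U\<close>.\<close>

lemma swap_sum_T:
  assumes l: "weight l" and t: "t \<in> T"
  shows "\<exists>a. \<forall>w. swap_sum l (\<sigma> t w) = a * swap_sum l w"
proof -
  obtain a where a: "\<And>w. l (\<sigma> (s \<otimes> t \<otimes> s) w) = a * l w"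
    using l T_s[OF t] unfolding weight_def by blast
  have lU: "\<And>u w. u \<in> U \<Longrightarrow> l (\<sigma> u w) = l w"
    using l unfolding weight_def by blast
  have "swap_sum l (\<sigma> t w) = a * swap_sum l w" for w
  proof -
    have "swap_sum l (\<sigma> t w) = csum (\<lambda>u. a * l (\<sigma> (s \<otimes> (iv t \<otimes> u \<otimes> t)) w))"
      unfolding swap_sum_def
    proof (rule csum_cong)
      fix u assume u: "u \<in> U"
      have n: "iv t \<otimes> u \<otimes> t \<in> U"
        using T_U' t u by simp
      have "\<sigma> (s \<otimes> u) (\<sigma> t w) = \<sigma> ((s \<otimes> t \<otimes> s) \<otimes> (s \<otimes> (iv t \<otimes> u \<otimes> t))) w"
        using \<sigma>_mul[OF K_mul[OF s_K UK[OF u]] TK[OF t], of w] T_G[OF t] by simp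
      also have "\<dots> = \<sigma> (s \<otimes> t \<otimes> s) (\<sigma> (s \<otimes> (iv t \<otimes> u \<otimes> t)) w)"
        by (rule \<sigma>_mul[OF TK[OF T_s[OF t]] K_mul[OF s_K UK[OF n]]])
      finally show "l (\<sigma> (s \<otimes> u) (\<sigma> t w)) = a * l (\<sigma> (s \<otimes> (iv t \<otimes> u \<otimes> t)) w)"
        using a by simp
    qed
    also have "\<dots> = csum (\<lambda>u. a * l (\<sigma> (s \<otimes> u) w))"
    proof (rule csum_reindex)
      show "iv v \<otimes> v' \<in> Q" if "v \<in> U" "v' \<in> U" "iv (iv t \<otimes> v \<otimes> t) \<otimes> (iv t \<otimes> v' \<otimes> t) \<in> Q" for v v'
        using Q_norm[OF TK[OF t] that(3)] that U_G T_G t by simp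
    qed (use t T_U' s_invariant[of l, OF lU] in auto)
    also have "\<dots> = a * swap_sum l w"
      unfolding swap_sum_def csum_def by (simp add: sum_distrib_left)
    finally show ?thesis .
  qed
  then show ?thesis
    by blast
qed

lemma functional_swap_sum: "functional sc l \<Longrightarrow> functional sc (swap_sum l)"
  using functional_\<sigma>[of l "s \<otimes> _"] K_mul[OF s_K UK] rp_cls
  unfolding functional_def swap_sum_def csum_def
  by (auto simp: sum.distrib sum_distrib_left intro!: sum.cong)

text \<open>Here \<open>s \<otimes> u \<otimes> s\<close> lies in the big cell, and \<open>l\<close>
  absorbs the factors from \<open>U\<close> and \<open>T\<close> on its left up to a scalar.\<close>

lemma swap_nontrivial_weight:
  assumes l: "weight l" and u: "u \<in> U" "u \<notin> Q"
  shows "\<exists>a. \<exists>u2\<in>U. \<forall>w. l (\<sigma> (s \<otimes> u \<otimes> s) w) = a * l (\<sigma> (s \<otimes> u2) w)"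
proof -
  obtain u1 t u2 where d: "u1 \<in> U" "t \<in> T" "u2 \<in> U" "s \<otimes> u \<otimes> s = u1 \<otimes> (t \<otimes> (s \<otimes> u2))"
    using swap_nontrivial[OF u] by auto
  obtain a where a: "\<And>w. l (\<sigma> t w) = a * l w"
    using l d(2) unfolding weight_def by blast
  have "l (\<sigma> (s \<otimes> u \<otimes> s) w) = a * l (\<sigma> (s \<otimes> u2) w)" for w
    unfolding d(4)
    using \<sigma>_mul[OF UK[OF d(1)] K_mul[OF TK[OF d(2)] K_mul[OF s_K UK[OF d(3)]]], of w]
      \<sigma>_mul[OF TK[OF d(2)] K_mul[OF s_K UK[OF d(3)]], of w] a l d(1)
    unfolding weight_def by simp
  then show ?thesis
    using d(3) by blast
qed

text \<open>The operator swap-sum satisfies a quadratic relation whose constant term is the index of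
  U \<inter> Q in U, hence vanishes in characteristic p.\<close>

lemma swap_sum_swap_sum:
  assumes l: "weight l"
  shows "\<exists>c. \<forall>w. swap_sum (swap_sum l) w = c * swap_sum l w"
proof -
  have lU: "\<And>u w. u \<in> U \<Longrightarrow> l (\<sigma> u w) = l w"
    using l unfolding weight_def by blast
  have K2: "s \<otimes> u \<in> K" if "u \<in> U" for u
    using K_mul[OF s_K UK[OF that]] .
  have "\<exists>a. \<forall>w. csum (\<lambda>u. l (\<sigma> (s \<otimes> rp C) (\<sigma> (s \<otimes> u) w))) = a * swap_sum l w"
    if C: "C \<in> CL - {cls \<one>}" for C
  proof -
    obtain a u2 where a: "u2 \<in> U" "\<And>w. l (\<sigma> (s \<otimes> rp C \<otimes> s) w) = a * l (\<sigma> (s \<otimes> u2) w)"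
      using swap_nontrivial_weight[OF l] rp_nontrivial[OF C] by blast
    have "csum (\<lambda>u. l (\<sigma> (s \<otimes> rp C) (\<sigma> (s \<otimes> u) w))) = a * swap_sum l w" for w
    proof -
      have "csum (\<lambda>u. l (\<sigma> (s \<otimes> rp C) (\<sigma> (s \<otimes> u) w))) = csum (\<lambda>u. a * l (\<sigma> (s \<otimes> (u2 \<otimes> u)) w))"
      proof (rule csum_cong)
        fix u assume u: "u \<in> U"
        have r: "rp C \<in> U"
          using rp_nontrivial[OF C] by blast
        have "\<sigma> (s \<otimes> rp C) (\<sigma> (s \<otimes> u) w) = \<sigma> (s \<otimes> rp C \<otimes> s) (\<sigma> u w)"
          using \<sigma>_mul[OF K2[OF r] K2[OF u], of w] \<sigma>_mul[OF K_mul[OF K2[OF r] s_K] UK[OF u], of w]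
          by simp
        moreover have "\<sigma> (s \<otimes> u2) (\<sigma> u w) = \<sigma> (s \<otimes> (u2 \<otimes> u)) w"
          using \<sigma>_mul[OF K2[OF a(1)] UK[OF u], of w] by simp
        ultimately show "l (\<sigma> (s \<otimes> rp C) (\<sigma> (s \<otimes> u) w)) = a * l (\<sigma> (s \<otimes> (u2 \<otimes> u)) w)"
          using a(2) by simp
      qed
      also have "\<dots> = a * csum (\<lambda>u. l (\<sigma> (s \<otimes> (u2 \<otimes> u)) w))"
        unfolding csum_def by (simp add: sum_distrib_left)
      finally show ?thesis
        using swap_sum_U(2)[of l, OF lU a(1)] by simp
    qed
    then show ?thesis
      by blast
  qed
  then obtain a where a: "\<And>C w. C \<in> CL - {cls \<one>} \<Longrightarrow>
      csum (\<lambda>u. l (\<sigma> (s \<otimes> rp C) (\<sigma> (s \<otimes> u) w))) = a C * swap_sum l w"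
    by metis
  have "swap_sum (swap_sum l) w = (\<Sum>C\<in>CL - {cls \<one>}. a C) * swap_sum l w" for w
  proof -
    have "swap_sum (swap_sum l) w = csum (\<lambda>u'. csum (\<lambda>u. l (\<sigma> (s \<otimes> u') (\<sigma> (s \<otimes> u) w))))"
      \<comment> \<open>The exchange makes the outer index the one next to \<open>l\<close>, which
        is the index that has to be split by cells.\<close>
      unfolding swap_sum_def csum_def by (rule sum.swap)
    also have "\<dots> = csum (\<lambda>u. l (\<sigma> (s \<otimes> rp (cls \<one>)) (\<sigma> (s \<otimes> u) w)))
        + (\<Sum>C\<in>CL - {cls \<one>}. a C * swap_sum l w)"
      unfolding csum_split[of "\<lambda>u'. csum (\<lambda>u. l (\<sigma> (s \<otimes> u') (\<sigma> (s \<otimes> u) w)))"]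
      using a by simp
    also have "csum (\<lambda>u. l (\<sigma> (s \<otimes> rp (cls \<one>)) (\<sigma> (s \<otimes> u) w))) = csum (\<lambda>u. l w)"
    proof (rule csum_cong)
      fix u assume u: "u \<in> U"
      have r: "rp (cls \<one>) \<in> U" "s \<otimes> rp (cls \<one>) \<otimes> s \<in> Q"
        using rp_one Q_s by auto
      have "\<sigma> (s \<otimes> rp (cls \<one>)) (\<sigma> (s \<otimes> u) w) = \<sigma> (s \<otimes> rp (cls \<one>) \<otimes> s) (\<sigma> u w)"
        using \<sigma>_mul[OF K2[OF r(1)] K2[OF u], of w] \<sigma>_mul[OF K_mul[OF K2[OF r(1)] s_K] UK[OF u], of w]
        by simp
      then show "l (\<sigma> (s \<otimes> rp (cls \<one>)) (\<sigma> (s \<otimes> u) w)) = l w"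
        using r(2) lU[OF u] by simp
    qed
    also have "csum (\<lambda>u. l w) = 0"
    proof -
      obtain n where "card CL = p * n"
        using card_CL by blast
      then have "of_nat (card CL) = (0::'k)"
        using char_p by simp
      then show ?thesis
        unfolding csum_def by simp
    qed
    finally show ?thesis
      by (simp add: sum_distrib_right)
  qed
  then show ?thesis
    by blast
qed

text \<open>If \<open>swap_sum l\<close> vanishes, \<open>l\<close> has eigenvalue 0. Otherwise
  \<open>swap_sum l\<close> is again a weight, and the quadratic relation makes it an
  eigenfunctional.\<close>

lemma ex_swap_eigen_weight: "\<exists>l c. weight l \<and> (\<forall>w. swap_sum l w = c * l w)"
proof -
  obtain l where l: "weight l"
    using ex_functional unfolding weight_def by blast
  show ?thesis
  proof (cases "\<forall>w. swap_sum l w = 0")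
    case True
    then show ?thesis
      using l by (intro exI[of _ l] exI[of _ 0]) auto
  next
    case False
    have "functional sc l" "\<And>u w. u \<in> U \<Longrightarrow> l (\<sigma> u w) = l w"
      using l unfolding weight_def by auto
    then have "weight (swap_sum l)"
      unfolding weight_def using False functional_swap_sum swap_sum_U(1)[of l] swap_sum_T[OF l] by auto
    then show ?thesis
      using swap_sum_swap_sum[OF l] by blast
  qed
qed

definition \<phi> :: "'w \<Rightarrow> 'k" where
  "\<phi> = (SOME l. weight l \<and> (\<exists>c. \<forall>w. swap_sum l w = c * l w))"

lemma \<phi>_props: "weight \<phi> \<and> (\<exists>c. \<forall>w. swap_sum \<phi> w = c * \<phi> w)"
proof -
  have "\<exists>l. weight l \<and> (\<exists>c. \<forall>w. swap_sum l w = c * l w)"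
    using ex_swap_eigen_weight by blast
  from someI_ex[OF this] show ?thesis
    unfolding \<phi>_def .
qed

lemma \<phi>_functional: "functional sc \<phi>"
  and \<phi>_nonzero: "\<exists>w. \<phi> w \<noteq> 0"
  and \<phi>_U: "u \<in> U \<Longrightarrow> \<phi> (\<sigma> u w) = \<phi> w"
  and \<phi>_T: "t \<in> T \<Longrightarrow> \<exists>a. \<forall>w. \<phi> (\<sigma> t w) = a * \<phi> w"
  using \<phi>_props unfolding weight_def by auto

text \<open>The point is \<open>\<phi> w = 0\<close>; the two Bruhat cells then kill every
  translate. If the eigenvalue \<open>c\<close> is nonzero, the swap sum at \<open>w\<close> has
  only zero terms and equals \<open>c * \<phi> w\<close>. If \<open>c\<close> is zero, the swap sum
  at \<open>\<sigma> s w\<close> vanishes, and by the big cell formula its only possibly nonzero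
  term is \<open>\<phi> w\<close>.\<close>

lemma functional_U_separates:
  assumes w: "\<And>u. u \<in> U \<Longrightarrow> \<phi> (\<sigma> (s \<otimes> u) w) = 0"
  shows "w = 0"
proof -
  have l: "weight \<phi>"
    using \<phi>_props by blast
  obtain c where c: "\<And>w. swap_sum \<phi> w = c * \<phi> w"
    using \<phi>_props by blast
  have l0: "\<phi> w = 0"
  proof (cases "c = 0")
    case False
    have "swap_sum \<phi> w = 0"
      unfolding swap_sum_def csum_def using w rp_cls by (intro sum.neutral) auto
    then show ?thesis
      using c False by simp
  next
    case True
    have K2: "s \<otimes> u \<in> K" if "u \<in> U" for u
      using K_mul[OF s_K UK[OF that]] .
    have "\<phi> (\<sigma> (s \<otimes> rp C) (\<sigma> s w)) = 0" if C: "C \<in> CL - {cls \<one>}" for C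
    proof -
      have r: "rp C \<in> U" "rp C \<notin> Q"
        using rp_nontrivial[OF C] by auto
      obtain a u2 where a: "u2 \<in> U" "\<And>w. \<phi> (\<sigma> (s \<otimes> rp C \<otimes> s) w) = a * \<phi> (\<sigma> (s \<otimes> u2) w)"
        using swap_nontrivial_weight[OF l r] by blast
      show ?thesis
        using a(2)[of w] \<sigma>_mul[OF K2[OF r(1)] s_K, of w] w[OF a(1)] by simp
    qed
    moreover have "\<phi> (\<sigma> (s \<otimes> rp (cls \<one>)) (\<sigma> s w)) = \<phi> w"
      using rp_one Q_s[of "rp (cls \<one>)"] \<sigma>_mul[OF K2 s_K, of "rp (cls \<one>)" w] by simp
    ultimately have "swap_sum \<phi> (\<sigma> s w) = \<phi> w"
      unfolding swap_sum_def csum_split[of "\<lambda>u. \<phi> (\<sigma> (s \<otimes> u) (\<sigma> s w))"] by simp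
    then show ?thesis
      using c True by simp
  qed
  have K0: "\<phi> (\<sigma> k w) = 0" if k: "k \<in> K" for k
    using K_dec[OF k]
  proof (elim disjE bexE)
    fix u t q assume d: "u \<in> U" "t \<in> T" "q \<in> Q" "k = u \<otimes> t \<otimes> q"
    have "\<sigma> k w = \<sigma> u (\<sigma> t w)"
      unfolding d(4) using d UK TK QK K_mul by (simp add: \<sigma>_mul)
    then show ?thesis
      using \<phi>_U[OF d(1)] \<phi>_T[OF d(2)] l0 by auto
  next
    fix u t u' assume d: "u \<in> U" "t \<in> T" "u' \<in> U" "k = u \<otimes> t \<otimes> s \<otimes> u'"
    have "\<sigma> k w = \<sigma> u (\<sigma> t (\<sigma> (s \<otimes> u') w))"
      unfolding d(4) using d UK TK s_K K_mul by (simp add: \<sigma>_mul)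
    then show ?thesis
      using \<phi>_U[OF d(1)] \<phi>_T[OF d(2)] w[OF d(3)] by auto
  qed
  show ?thesis
    using functional_eq_0[OF \<phi>_functional _ K0] \<phi>_nonzero by blast
qed

section \<open>The line of fixed vectors and its dual\<close>

definition v0 :: 'w where
  "v0 = (SOME v. v \<noteq> 0 \<and> (\<forall>u\<in>U. \<sigma> u v = v))"

lemma v0_props: "v0 \<noteq> 0 \<and> (\<forall>u\<in>U. \<sigma> u v0 = v0)"
  unfolding v0_def by (rule someI_ex) (use ex_vector in blast)

lemma v0_nonzero [simp]: "v0 \<noteq> 0" and v0_U: "u \<in> U \<Longrightarrow> \<sigma> u v0 = v0"
  using v0_props by auto

lemma \<phi>_s_fixed:
  assumes "\<And>u. u \<in> U \<Longrightarrow> \<sigma> u v = v" "v \<noteq> 0"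
  shows "\<phi> (\<sigma> s v) \<noteq> 0"
proof
  assume "\<phi> (\<sigma> s v) = 0"
  then have "v = 0"
    by (intro functional_U_separates) (use assms \<sigma>_mul[OF s_K UK] in simp)
  then show False
    using assms by simp
qed

lemma \<phi>_s_v0 [simp]: "\<phi> (\<sigma> s v0) \<noteq> 0"
  using \<phi>_s_fixed v0_U v0_nonzero by blast

text \<open>By \<open>\<phi>_s_fixed\<close> the functional \<open>\<phi> (\<sigma> s _)\<close> is
  injective on \<open>U\<close>-fixed vectors, so these form a line and the scalar is a quotient of
  its values.\<close>

lemma fixed_line:
  assumes v: "\<And>u. u \<in> U \<Longrightarrow> \<sigma> u v = v"
  shows "\<exists>a. v = sc a v0"
proof -
  define a where "a = \<phi> (\<sigma> s v) / \<phi> (\<sigma> s v0)"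
  let ?d = "v + sc (- a) v0"
  have "\<sigma> u ?d = ?d" if "u \<in> U" for u
    using that v v0_U by (simp add: \<sigma>_add \<sigma>_scl UK del: scale_minus_left)
  moreover have "\<phi> (\<sigma> s ?d) = 0"
    by (simp add: \<sigma>_add \<sigma>_scl s_K functional_add[OF \<phi>_functional] functional_scl[OF \<phi>_functional]
        a_def del: scale_minus_left)
  ultimately have "?d = 0"
    using \<phi>_s_fixed by blast
  then show ?thesis
    by (intro exI[of _ a]) simp
qed

lemma v0_T:
  assumes t: "t \<in> T"
  shows "\<exists>a. \<sigma> t v0 = sc a v0"
proof (rule fixed_line)
  fix u assume u: "u \<in> U"
  have n: "iv t \<otimes> u \<otimes> t \<in> U"
    using T_U' t u by simp
  have "\<sigma> u (\<sigma> t v0) = \<sigma> (t \<otimes> (iv t \<otimes> u \<otimes> t)) v0"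
    using \<sigma>_mul[OF UK[OF u] TK[OF t], of v0] T_G[OF t] by simp
  also have "\<dots> = \<sigma> t v0"
    using \<sigma>_mul[OF TK[OF t] UK[OF n], of v0] v0_U[OF n] by simp
  finally show "\<sigma> u (\<sigma> t v0) = \<sigma> t v0" .
qed

text \<open>The dual statement: a functional invariant under the opposite unipotent group is
  determined by its value at \<open>v0\<close>. The key is \<open>\<mu> (\<sigma> s v0) = 0\<close>,
  obtained by a case distinction on a swap eigenvalue parallel to the one for \<open>\<phi>\<close>;
  afterwards the Bruhat decomposition kills all translates of \<open>v0\<close>.\<close>

lemma opposite_invariant_functional:
  assumes m: "functional sc \<mu>" and inv: "\<And>u w. u \<in> U \<Longrightarrow> \<mu> (\<sigma> (s \<otimes> u \<otimes> s) w) = \<mu> w"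
    and z: "\<mu> v0 = 0"
  shows "\<mu> w = 0"
proof -
  have K2: "s \<otimes> u \<in> K" "u \<otimes> s \<in> K" "s \<otimes> u \<otimes> s \<in> K" if "u \<in> U" for u
    using K_mul s_K UK[OF that] by auto
  have inv': "\<mu> (\<sigma> s (\<sigma> u w)) = \<mu> (\<sigma> s w)" if "u \<in> U" for u w
  proof -
    have "\<sigma> s (\<sigma> u w) = \<sigma> (s \<otimes> u \<otimes> s) (\<sigma> s w)"
      using \<sigma>_mul[OF s_K UK[OF that], of w] \<sigma>_mul[OF K2(3)[OF that] s_K, of w] by simp
    then show ?thesis
      using inv[OF that] by simp
  qed
  \<comment> \<open>The swap sum on the side of vectors: it is fixed by \<open>U\<close>, hence a
    multiple \<open>c\<close> of \<open>v0\<close>, and \<open>c\<close> plays the role of the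
    eigenvalue.\<close>
  define v' where "v' = csum (\<lambda>u. \<sigma> (u \<otimes> s) v0)"
  have "\<sigma> u v' = v'" if u: "u \<in> U" for u
  proof -
    have "\<sigma> u v' = csum (\<lambda>u'. \<sigma> ((u \<otimes> u') \<otimes> s) v0)"
      unfolding v'_def \<sigma>_csum[OF UK[OF u]]
      by (rule csum_cong) (use \<sigma>_mul[OF UK[OF u] K2(2)] in simp)
    also have "\<dots> = v'"
      unfolding v'_def
    proof (rule csum_reindex)
      show "iv v \<otimes> v' \<in> Q" if "v \<in> U" "v' \<in> U" "iv (u \<otimes> v) \<otimes> (u \<otimes> v') \<in> Q" for v v'
        using that U_G u by simp
      show "\<sigma> (v \<otimes> q \<otimes> s) v0 = \<sigma> (v \<otimes> s) v0" if v: "v \<in> U" and q: "q \<in> Q" for v q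
        using \<sigma>_mul[OF K2(2)[OF v] QK[OF Q_s[OF q]], of v0] Q_s[OF q] by simp
    qed (use u U_mul in auto)
    finally show ?thesis .
  qed
  then obtain c where c: "v' = sc c v0"
    using fixed_line by blast
  have s0: "\<mu> (\<sigma> s v0) = 0"
  proof (cases "c = 0")
    case False
    have "c * \<mu> (\<sigma> s v0) = \<mu> (\<sigma> s v')"
      unfolding c using \<sigma>_scl[OF s_K] functional_scl[OF m] by simp
    also have "\<dots> = csum (\<lambda>u. \<mu> (\<sigma> s (\<sigma> (u \<otimes> s) v0)))"
      unfolding v'_def \<sigma>_csum[OF s_K] functional_csum[OF m] ..
    also have "\<dots> = csum (\<lambda>u. 0)"
    proof (rule csum_cong)
      fix u assume u: "u \<in> U"
      have "\<sigma> s (\<sigma> (u \<otimes> s) v0) = \<sigma> (s \<otimes> u \<otimes> s) v0"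
        using \<sigma>_mul[OF s_K K2(2)[OF u], of v0] by simp
      then show "\<mu> (\<sigma> s (\<sigma> (u \<otimes> s) v0)) = 0"
        using inv[OF u] z by simp
    qed
    finally show ?thesis
      using False by (simp add: csum_def)
  next
    case True
    have "\<mu> (\<sigma> (rp C \<otimes> s) v0) = 0" if C: "C \<in> CL - {cls \<one>}" for C
    proof -
      have r: "rp C \<in> U" "rp C \<notin> Q"
        using rp_nontrivial[OF C] by auto
      obtain u1 t u2 where d: "u1 \<in> U" "t \<in> T" "u2 \<in> U" "s \<otimes> rp C \<otimes> s = u1 \<otimes> t \<otimes> s \<otimes> u2"
        using swap_nontrivial[OF r] by blast
      obtain a where a: "\<sigma> (s \<otimes> t \<otimes> s) v0 = sc a v0"
        using v0_T[OF T_s[OF d(2)]] by blast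
      have "rp C \<otimes> s = s \<otimes> (s \<otimes> rp C \<otimes> s)"
        by simp
      also have "\<dots> = (s \<otimes> u1 \<otimes> s) \<otimes> ((s \<otimes> t \<otimes> s) \<otimes> u2)"
        unfolding d(4) by simp
      finally have "\<sigma> (rp C \<otimes> s) v0 = \<sigma> (s \<otimes> u1 \<otimes> s) (\<sigma> (s \<otimes> t \<otimes> s) (\<sigma> u2 v0))"
        using \<sigma>_mul[OF K2(3)[OF d(1)] K_mul[OF TK[OF T_s[OF d(2)]] UK[OF d(3)]], of v0]
          \<sigma>_mul[OF TK[OF T_s[OF d(2)]] UK[OF d(3)], of v0] by simp
      then show ?thesis
        using inv[OF d(1)] v0_U[OF d(3)] a z functional_scl[OF m] by simp
    qed
    moreover have "\<sigma> (rp (cls \<one>) \<otimes> s) v0 = \<sigma> s v0"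
      using rp_one \<sigma>_mul[OF UK s_K, of "rp (cls \<one>)" v0] by simp
    moreover have "0 = csum (\<lambda>u. \<mu> (\<sigma> (u \<otimes> s) v0))"
      using True c functional_csum[OF m] functional_0[OF m] unfolding v'_def by (metis scale_zero_left)
    ultimately show ?thesis
      unfolding csum_split[of "\<lambda>u. \<mu> (\<sigma> (u \<otimes> s) v0)"] by simp
  qed
  have "\<mu> (\<sigma> k v0) = 0" if k: "k \<in> K" for k
  proof -
    \<comment> \<open>Decomposing \<open>s \<otimes> k\<close> instead of \<open>k\<close> places
      the factor from \<open>U\<close> right after \<open>s\<close>, where \<open>inv'\<close>
      removes it.\<close>
    have e: "\<sigma> k v0 = \<sigma> s (\<sigma> (s \<otimes> k) v0)"
      using \<sigma>_mul[OF s_K K_mul[OF s_K k], of v0] by simp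
    show ?thesis
      using K_dec[OF K_mul[OF s_K k]]
    proof (elim disjE bexE)
      fix u t q assume d: "u \<in> U" "t \<in> T" "q \<in> Q" "s \<otimes> k = u \<otimes> t \<otimes> q"
      have "\<sigma> (s \<otimes> k) v0 = \<sigma> u (\<sigma> t v0)"
        unfolding d(4) using d UK TK QK K_mul by (simp add: \<sigma>_mul)
      then show ?thesis
        unfolding e using inv'[OF d(1)] v0_T[OF d(2)] s0 \<sigma>_scl[OF s_K] functional_scl[OF m] by auto
    next
      fix u t u' assume d: "u \<in> U" "t \<in> T" "u' \<in> U" "s \<otimes> k = u \<otimes> t \<otimes> s \<otimes> u'"
      have "\<sigma> (s \<otimes> k) v0 = \<sigma> u (\<sigma> (t \<otimes> s) v0)"
        unfolding d(4) using d UK TK s_K K_mul v0_U by (simp add: \<sigma>_mul)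
      moreover have "\<sigma> s (\<sigma> (t \<otimes> s) v0) = \<sigma> (s \<otimes> t \<otimes> s) v0"
        using \<sigma>_mul[OF s_K K_mul[OF TK[OF d(2)] s_K], of v0] by simp
      ultimately show ?thesis
        unfolding e using inv'[OF d(1)] v0_T[OF T_s[OF d(2)]] z functional_scl[OF m] by auto
    qed
  qed
  then show ?thesis
    using functional_eq_0[OF m v0_nonzero] by blast
qed

end

section \<open>The compactly induced representation\<close>

context hecke_rep
begin

text \<open>The stabilizer in \<open>K\<close> of the right coset of \<open>K\<close> through
  \<open>\<alpha>\<close>; the cosets of \<open>\<Gamma>\<close> in \<open>K\<close> index the
  neighbours of the base vertex.\<close>

definition \<Gamma> :: "'g set" where "\<Gamma> = {g \<in> K. \<alpha> \<otimes> g \<otimes> iv \<alpha> \<in> K}"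

lemma \<Gamma>_sub: "subgr \<Gamma>"
  unfolding subgr_def
proof (intro conjI ballI)
  show "\<Gamma> \<subseteq> G" "\<one> \<in> \<Gamma>"
    unfolding \<Gamma>_def using K_G K_one by auto
  show "x \<otimes> y \<in> \<Gamma>" if "x \<in> \<Gamma>" "y \<in> \<Gamma>" for x y
    using that K_mul[of x y] K_mul[of "\<alpha> \<otimes> x \<otimes> iv \<alpha>" "\<alpha> \<otimes> y \<otimes> iv \<alpha>"] unfolding \<Gamma>_def by simp
  show "iv x \<in> \<Gamma>" if "x \<in> \<Gamma>" for x
    using that K_iv[of x] K_iv[of "\<alpha> \<otimes> x \<otimes> iv \<alpha>"] K_G[of x] unfolding \<Gamma>_def by simp
qed

lemma \<Gamma>_K: "x \<in> \<Gamma> \<Longrightarrow> x \<in> K"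
  unfolding \<Gamma>_def by simp

lemma s_\<alpha>': "s \<otimes> iv \<alpha> = \<alpha> \<otimes> s" "s \<otimes> (iv \<alpha> \<otimes> x) = \<alpha> \<otimes> (s \<otimes> x)"
  using s_\<alpha>[symmetric] by simp_all

definition \<alpha>p :: "nat \<Rightarrow> 'g" where "\<alpha>p = gpow \<alpha>"

lemma \<alpha>p_G [simp]: "\<alpha>p n \<in> G"
  unfolding \<alpha>p_def by simp

lemma \<alpha>p_0 [simp]: "\<alpha>p 0 = \<one>" and \<alpha>p_Suc [simp]: "\<alpha>p (Suc n) = \<alpha> \<otimes> \<alpha>p n"
  unfolding \<alpha>p_def by simp_all

lemma \<alpha>p_commute: "\<alpha> \<otimes> \<alpha>p n = \<alpha>p n \<otimes> \<alpha>"
proof (induction n)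
  case (Suc n)
  then show ?case
    by (metis \<alpha>p_Suc assoc)
qed simp

lemma s_\<alpha>p: "s \<otimes> \<alpha>p n = iv (\<alpha>p n) \<otimes> s"
proof (induction n)
  case (Suc n)
  have "s \<otimes> \<alpha>p (Suc n) = (s \<otimes> \<alpha> \<otimes> s) \<otimes> (s \<otimes> \<alpha>p n)"
    by simp
  also have "\<dots> = iv \<alpha> \<otimes> iv (\<alpha>p n) \<otimes> s"
    unfolding s_\<alpha> Suc by simp
  also have "\<dots> = iv (\<alpha>p n \<otimes> \<alpha>) \<otimes> s"
    by simp
  finally show ?case
    using \<alpha>p_commute by simp
qed simp

lemma s_iv\<alpha>p: "\<alpha>p n \<otimes> s = s \<otimes> iv (\<alpha>p n)"
proof -
  have "\<alpha>p n \<otimes> s = \<alpha>p n \<otimes> s \<otimes> (\<alpha>p n \<otimes> iv (\<alpha>p n))"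
    by simp
  also have "\<dots> = \<alpha>p n \<otimes> (s \<otimes> \<alpha>p n) \<otimes> iv (\<alpha>p n)"
    by (simp only: assoc)
  finally show ?thesis
    unfolding s_\<alpha>p by simp
qed

lemma U_\<alpha>p: "u \<in> U \<Longrightarrow> iv (\<alpha>p n) \<otimes> u \<otimes> \<alpha>p n \<in> U"
proof (induction n arbitrary: u)
  case (Suc n)
  have "iv \<alpha> \<otimes> u \<otimes> \<alpha> \<in> U"
    using U_\<alpha> Suc.prems by blast
  from Suc.IH[OF this] show ?case
    by simp
qed simp

lemma U_\<alpha>p_Suc:
  assumes "u \<in> U"
  shows "iv (\<alpha>p (Suc n)) \<otimes> u \<otimes> \<alpha>p (Suc n) \<in> U \<inter> Q"
proof -
  have "iv \<alpha> \<otimes> (iv (\<alpha>p n) \<otimes> u \<otimes> \<alpha>p n) \<otimes> \<alpha> \<in> U \<inter> Q"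
    using U_\<alpha> U_\<alpha>p[OF assms] by blast
  moreover have "iv \<alpha> \<otimes> (iv (\<alpha>p n) \<otimes> u \<otimes> \<alpha>p n) \<otimes> \<alpha> = iv (\<alpha>p n \<otimes> \<alpha>) \<otimes> u \<otimes> (\<alpha>p n \<otimes> \<alpha>)"
    by simp
  ultimately show ?thesis
    using \<alpha>p_commute by simp
qed

lemma ball_mono: "m \<le> n \<Longrightarrow> ball m \<subseteq> ball n"
  using lift_Suc_mono_le[of ball m n] ball_Suc by auto

lemma ball_l_iff: "k \<in> K \<Longrightarrow> g \<in> G \<Longrightarrow> k \<otimes> g \<in> ball n \<longleftrightarrow> g \<in> ball n"
  using ball_l[of k g n] ball_l[OF K_iv, of k "k \<otimes> g" n] K_G by auto

lemma ball_r_iff: "k \<in> K \<Longrightarrow> g \<in> G \<Longrightarrow> g \<otimes> k \<in> ball n \<longleftrightarrow> g \<in> ball n"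
  using ball_r[of k g n] ball_r[OF K_iv, of k "g \<otimes> k" n] K_G by auto

lemma \<alpha>p_ball: "\<alpha>p n \<in> ball n"
proof (induction n)
  case 0
  then show ?case using ball_0 K_one by simp
qed (simp add: ball_\<alpha>)

lemma \<alpha>p_Suc_ball: "\<alpha>p (Suc n) \<notin> ball n"
  unfolding \<alpha>p_def by (rule \<alpha>_ball)

text \<open>The abstract group carries no topology; \<open>right_smooth\<close> later supplies local
  constancy and so identifies this space with \<open>cind\<close>.\<close>

definition V :: "('g \<Rightarrow> 'w) set" where
  "V = {f. (\<forall>g. g \<notin> G \<longrightarrow> f g = 0) \<and> (\<forall>k\<in>K. \<forall>g\<in>G. f (k \<otimes> g) = \<sigma> k (f g)) \<and>
     (\<exists>S. finite S \<and> S \<subseteq> G \<and> (\<forall>g\<in>G. f g \<noteq> 0 \<longrightarrow> (\<exists>k\<in>K. \<exists>x\<in>S. g = k \<otimes> x)))}"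

definition rt :: "'g \<Rightarrow> ('g \<Rightarrow> 'w) \<Rightarrow> 'g \<Rightarrow> 'w" where "rt g f = (\<lambda>x. f (x \<otimes> g))"

definition scf :: "'k \<Rightarrow> ('g \<Rightarrow> 'w) \<Rightarrow> 'g \<Rightarrow> 'w" where "scf a f = (\<lambda>x. sc a (f x))"

sublocale fun_space: vector_space scf
proof unfold_locales
  fix a b :: 'k and f f' :: "'g \<Rightarrow> 'w"
  show "scf a (f + f') = scf a f + scf a f'"
    unfolding scf_def plus_fun_def by (simp only: scale_right_distrib)
  show "scf (a + b) f = scf a f + scf b f"
    unfolding scf_def plus_fun_def by (simp only: scale_left_distrib)
  show "scf a (scf b f) = scf (a * b) f"
    unfolding scf_def by (simp only: scale_scale)
  show "scf 1 f = f"
    unfolding scf_def by (simp only: scale_one)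
qed

lemma V_outside: "f \<in> V \<Longrightarrow> g \<notin> G \<Longrightarrow> f g = 0"
  by (simp add: V_def)

lemma V_K: "f \<in> V \<Longrightarrow> k \<in> K \<Longrightarrow> g \<in> G \<Longrightarrow> f (k \<otimes> g) = \<sigma> k (f g)"
  by (simp add: V_def)

lemma V_supp: "f \<in> V \<Longrightarrow> \<exists>S. finite S \<and> S \<subseteq> G \<and> (\<forall>g\<in>G. f g \<noteq> 0 \<longrightarrow> (\<exists>k\<in>K. \<exists>x\<in>S. g = k \<otimes> x))"
  unfolding V_def by (elim CollectE conjE)

lemma V_I:
  assumes "\<And>g. g \<notin> G \<Longrightarrow> f g = 0" "\<And>k g. k \<in> K \<Longrightarrow> g \<in> G \<Longrightarrow> f (k \<otimes> g) = \<sigma> k (f g)"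
    and "finite S" "S \<subseteq> G" "\<And>g. g \<in> G \<Longrightarrow> f g \<noteq> 0 \<Longrightarrow> \<exists>k\<in>K. \<exists>x\<in>S. g = k \<otimes> x"
  shows "f \<in> V"
  unfolding V_def by (intro CollectI conjI allI ballI impI exI[of _ S]) (fact assms)+

lemma V_subspace: "fun_space.subspace V"
proof (rule fun_space.subspaceI)
  show "0 \<in> V"
    by (rule V_I[of _ "{}"]) auto
  fix f f' assume f: "f \<in> V" "f' \<in> V"
  obtain S where S: "finite S" "S \<subseteq> G" "\<And>g. g \<in> G \<Longrightarrow> f g \<noteq> 0 \<Longrightarrow> \<exists>k\<in>K. \<exists>x\<in>S. g = k \<otimes> x"
    using V_supp[OF f(1)] by blast
  obtain S' where S': "finite S'" "S' \<subseteq> G" "\<And>g. g \<in> G \<Longrightarrow> f' g \<noteq> 0 \<Longrightarrow> \<exists>k\<in>K. \<exists>x\<in>S'. g = k \<otimes> x"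
    using V_supp[OF f(2)] by blast
  show "f + f' \<in> V"
  proof (rule V_I[of _ "S \<union> S'"])
    show "\<exists>k\<in>K. \<exists>x\<in>S \<union> S'. g = k \<otimes> x" if g: "g \<in> G" "(f + f') g \<noteq> 0" for g
    proof -
      have "f g \<noteq> 0 \<or> f' g \<noteq> 0"
        using g(2) by auto
      then show ?thesis
        using S(3)[OF g(1)] S'(3)[OF g(1)] by blast
    qed
  qed (use f S S' in \<open>auto simp: V_outside V_K \<sigma>_add\<close>)
next
  fix a f assume f: "f \<in> V"
  obtain S where S: "finite S" "S \<subseteq> G" "\<And>g. g \<in> G \<Longrightarrow> f g \<noteq> 0 \<Longrightarrow> \<exists>k\<in>K. \<exists>x\<in>S. g = k \<otimes> x"
    using V_supp[OF f(1)] by blast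
  show "scf a f \<in> V"
    by (rule V_I[of _ S]) (use f S in \<open>auto simp: V_outside V_K \<sigma>_scl scf_def\<close>)
qed

definition F :: "nat \<Rightarrow> ('g \<Rightarrow> 'w) set" where
  "F n = {f \<in> V. \<forall>g. f g \<noteq> 0 \<longrightarrow> g \<in> ball n}"

lemma F_V: "f \<in> F n \<Longrightarrow> f \<in> V" and F_ball: "f \<in> F n \<Longrightarrow> f g \<noteq> 0 \<Longrightarrow> g \<in> ball n"
  unfolding F_def by auto

lemma F_subspace: "fun_space.subspace (F n)"
proof (rule fun_space.subspaceI)
  show "0 \<in> F n"
    unfolding F_def using fun_space.subspace_0[OF V_subspace] by auto
  show "f + f' \<in> F n" if "f \<in> F n" "f' \<in> F n" for f f'
    using that fun_space.subspace_add[OF V_subspace, of f f'] unfolding F_def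
    by (auto simp: plus_fun_def) (metis add.left_neutral)
  show "scf a f \<in> F n" if "f \<in> F n" for a f
    using that fun_space.subspace_scale[OF V_subspace, of f a] unfolding F_def by (auto simp: scf_def)
qed

lemma F_Suc: "F n \<subseteq> F (Suc n)"
  unfolding F_def using ball_Suc by blast

lemma F_exhaust:
  assumes f: "f \<in> V"
  shows "\<exists>n. f \<in> F n"
proof -
  obtain S where S: "finite S" "S \<subseteq> G" "\<And>g. g \<in> G \<Longrightarrow> f g \<noteq> 0 \<Longrightarrow> \<exists>k\<in>K. \<exists>x\<in>S. g = k \<otimes> x"
    using V_supp[OF f(1)] by blast
  obtain d where d: "\<And>x. x \<in> S \<Longrightarrow> x \<in> ball (d x)"
    using ball_exhaust S(2) by (metis subsetD)
  define n where "n = Max (insert 0 (d ` S))"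
  have "x \<in> ball n" if "x \<in> S" for x
    using d[OF that] ball_mono[of "d x" n] S(1) that unfolding n_def by auto
  then have "f \<in> F n"
    unfolding F_def using f S(3) ball_l V_outside[OF f] by blast
  then show ?thesis ..
qed

text \<open>By the Cartan decomposition the support meets only the double cosets of
  \<open>\<alpha>p j\<close> with \<open>j \<le> n\<close>, and left equivariance reduces the
  outermost of them to the values at \<open>\<alpha>p n \<otimes> k\<close>.\<close>

lemma sphere:
  assumes f: "f \<in> F n" and z: "\<And>k. k \<in> K \<Longrightarrow> f (\<alpha>p n \<otimes> k) = 0"
  shows "f \<in> prev F n"
proof -
  have lt: "\<exists>k\<in>K. \<exists>k'\<in>K. \<exists>j<n. g = k \<otimes> \<alpha>p j \<otimes> k'" if g: "f g \<noteq> 0" for g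
  proof -
    have gG: "g \<in> G"
      using V_outside[OF F_V[OF f]] g by blast
    then obtain j k k' where d: "k \<in> K" "k' \<in> K" "g = k \<otimes> (\<alpha>p j \<otimes> k')"
      using cartan unfolding \<alpha>p_def by (metis assoc)
    have "\<alpha>p j \<in> ball n"
      using F_ball[OF f g] d ball_l_iff[OF d(1), of "\<alpha>p j \<otimes> k'"] ball_r_iff[OF d(2), of "\<alpha>p j"] K_G by simp
    have "\<not> j > n"
    proof
      assume "j > n"
      then obtain j' where "j = Suc j'" "n \<le> j'"
        by (cases j) auto
      then show False
        using \<open>\<alpha>p j \<in> ball n\<close> \<alpha>p_Suc_ball[of j'] ball_mono[of n j'] by blast
    qed
    moreover have "j \<noteq> n"
      using V_K[OF F_V[OF f] d(1), of "\<alpha>p n \<otimes> k'"] z[OF d(2)] d(1,2) g K_G unfolding d(3) by auto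
    ultimately show ?thesis
      using d by (intro bexI[OF _ d(1)] bexI[OF _ d(2)] exI[of _ j]) auto
  qed
  show ?thesis
  proof (cases n)
    case 0
    then have "f g = 0" for g
      using lt[of g] by auto
    then show ?thesis
      using 0 by (simp add: fun_eq_iff)
  next
    case (Suc m)
    have "g \<in> ball m" if nz: "f g \<noteq> 0" for g
    proof -
      obtain k k' j where d: "k \<in> K" "k' \<in> K" "j \<le> m" "g = k \<otimes> \<alpha>p j \<otimes> k'"
        using lt[OF nz] Suc by (metis less_Suc_eq_le)
      have "\<alpha>p j \<in> ball m"
        using \<alpha>p_ball ball_mono[OF d(3)] by blast
      then show ?thesis
        unfolding d(4) using ball_l[OF d(1)] ball_r[OF d(2)] by blast
    qed
    then show ?thesis
      using f Suc unfolding F_def by simp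
  qed
qed

text \<open>A section concentrated at one vertex. Those with \<open>x = \<one>\<close> generate
  \<open>V\<close> under \<open>G\<close>, so an equivariant operator is known from its values on
  them.\<close>

definition delta :: "'g \<Rightarrow> 'w \<Rightarrow> 'g \<Rightarrow> 'w" where
  "delta x w = (\<lambda>g. if g \<otimes> iv x \<in> K then \<sigma> (g \<otimes> iv x) w else 0)"

lemma delta_V:
  assumes x: "x \<in> G"
  shows "delta x w \<in> V"
proof (rule V_I[of _ "{x}"])
  have *: "g = (g \<otimes> iv x) \<otimes> x" for g
    using x by simp
  show "delta x w g = 0" if "g \<notin> G" for g
    using that *[of g] K_G x G_mul unfolding delta_def by metis
  show "delta x w (k \<otimes> g) = \<sigma> k (delta x w g)" if k: "k \<in> K" and g: "g \<in> G" for k g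
  proof -
    have "k \<otimes> g \<otimes> iv x \<in> K \<longleftrightarrow> g \<otimes> iv x \<in> K"
      using K_mul[OF k, of "g \<otimes> iv x"] K_mul[OF K_iv[OF k], of "k \<otimes> g \<otimes> iv x"] K_G[OF k] by auto
    then show ?thesis
      unfolding delta_def using \<sigma>_mul[OF k] k by simp
  qed
  show "\<exists>k\<in>K. \<exists>y\<in>{x}. g = k \<otimes> y" if "delta x w g \<noteq> 0" for g
    using that *[of g] unfolding delta_def by (metis insertI1)
qed (use x in auto)

lemma delta_rt: "x \<in> G \<Longrightarrow> delta x w = rt (iv x) (delta \<one> w)"
  unfolding delta_def rt_def fun_eq_iff by simp

lemma delta_self [simp]: "x \<in> G \<Longrightarrow> delta x w x = w"
  unfolding delta_def using K_one by simp

lemma delta_one_add: "delta \<one> (u + v) = delta \<one> u + delta \<one> v"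
  and delta_one_scl: "delta \<one> (sc a v) = scf a (delta \<one> v)"
  unfolding delta_def scf_def fun_eq_iff by (auto simp: \<sigma>_add \<sigma>_scl)

lemma delta_one_\<sigma>:
  assumes k: "k \<in> K"
  shows "delta \<one> (\<sigma> k w) = rt k (delta \<one> w)"
proof
  fix g
  have "g \<otimes> k \<in> K \<longleftrightarrow> g \<in> K"
    using K_mul[OF _ k, of g] K_mul[OF _ K_iv[OF k], of "g \<otimes> k"] K_G[OF k] by auto
  then show "delta \<one> (\<sigma> k w) g = rt k (delta \<one> w) g"
    unfolding delta_def rt_def using \<sigma>_mul[OF _ k] by simp
qed

lemma delta_one_F: "delta \<one> w \<in> F 0"
  unfolding F_def using delta_V[OF G_one] ball_0 by (auto simp: delta_def)

section \<open>The Hecke operator\<close>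

text \<open>As a runs over K modulo \<Gamma>, the products of \<alpha> and iv a represent the right cosets of K
  in the double coset of \<alpha>.\<close>

definition kern :: "('g \<Rightarrow> 'w) \<Rightarrow> 'g \<Rightarrow> 'g \<Rightarrow> 'w" where
  "kern f g a = sc (\<phi> (f (\<alpha> \<otimes> iv a \<otimes> g))) (\<sigma> (a \<otimes> s) v0)"

text \<open>Convolution with the kernel supported on the double coset of \<open>iv \<alpha>\<close>,
  which is also that of \<open>\<alpha>\<close>, whose value at \<open>iv \<alpha>\<close> is the
  rank one map sending \<open>w\<close> to \<open>sc (\<phi> w) (\<sigma> s v0)\<close>.\<close>

definition hop :: "('g \<Rightarrow> 'w) \<Rightarrow> 'g \<Rightarrow> 'w" where
  "hop f g = (if g \<in> G then coset_sum K \<Gamma> (kern f g) else 0)"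

lemma hop_add: "hop (f + f') = hop f + hop f'"
  unfolding hop_def kern_def coset_sum_def fun_eq_iff
  by (auto simp: functional_add[OF \<phi>_functional] scale_left_distrib sum.distrib)

lemma hop_scf: "hop (scf a f) = scf a (hop f)"
  unfolding hop_def kern_def coset_sum_def fun_eq_iff scf_def
  by (auto simp: functional_scl[OF \<phi>_functional] scale_sum_right)

lemma hop_rt: "g \<in> G \<Longrightarrow> hop (rt g f) = rt g (hop f)"
proof
  fix x assume g: "g \<in> G"
  have "x \<otimes> g \<in> G \<longleftrightarrow> x \<in> G"
    using G_mul[OF _ g, of x] G_mul[OF _ G_iv[OF g], of "x \<otimes> g"] g by auto
  then show "hop (rt g f) x = rt g (hop f) x"
    unfolding hop_def rt_def kern_def by simp
qed

text \<open>Compatibility of the rank one map with \<open>\<Gamma>\<close>. By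
  \<open>\<Gamma>_dec\<close> only the torus part of \<open>g\<close> matters: it acts on
  \<open>\<sigma> s v0\<close> by one scalar and through \<open>\<phi>\<close> by another.
  Evaluating \<open>\<phi>\<close> at \<open>\<sigma> s v0\<close>, where it is nonzero, shows that
  the scalars are inverse to each other.\<close>

lemma \<Gamma>_weight:
  assumes g: "g \<in> \<Gamma>"
  shows "sc (\<phi> (\<sigma> (\<alpha> \<otimes> iv g \<otimes> iv \<alpha>) w)) (\<sigma> (g \<otimes> s) v0) = sc (\<phi> w) (\<sigma> s v0)"
proof -
  obtain u t u' where d: "u \<in> U" "t \<in> T" "u' \<in> U" "g = s \<otimes> u \<otimes> s \<otimes> t \<otimes> (iv \<alpha> \<otimes> u' \<otimes> \<alpha>)"
    using \<Gamma>_dec g unfolding \<Gamma>_def by blast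
  define q where "q = iv \<alpha> \<otimes> u' \<otimes> \<alpha>"
  have q: "q \<in> Q"
    using U_\<alpha>[OF d(3)] unfolding q_def by blast
  define t' where "t' = s \<otimes> t \<otimes> s"
  have t': "t' \<in> T"
    using T_s[OF d(2)] unfolding t'_def .
  obtain a where a: "\<sigma> t' v0 = sc a v0"
    using v0_T[OF t'] by blast
  have "g \<otimes> s = s \<otimes> (u \<otimes> (t' \<otimes> (s \<otimes> q \<otimes> s)))"
    unfolding d(4) q_def t'_def by simp
  moreover have "\<sigma> (s \<otimes> (u \<otimes> (t' \<otimes> (s \<otimes> q \<otimes> s)))) v0 = \<sigma> s (\<sigma> u (\<sigma> t' v0))"
    using UK[OF d(1)] TK[OF t'] s_K QK[OF Q_s[OF q]] Q_s[OF q] K_mul by (simp add: \<sigma>_mul del: assoc)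
  ultimately have 1: "\<sigma> (g \<otimes> s) v0 = sc a (\<sigma> s v0)"
    using a v0_U[OF d(1)] \<sigma>_scl[OF s_K] \<sigma>_scl[OF UK[OF d(1)]] by simp
  define q' where "q' = s \<otimes> (iv \<alpha> \<otimes> iv u \<otimes> \<alpha>) \<otimes> s"
  have q': "q' \<in> Q"
    using U_\<alpha>[OF U_iv[OF d(1)]] Q_s unfolding q'_def by blast
  have tG: "t \<in> G" "u \<in> G" "u' \<in> G"
    using d T_G U_G by auto
  have ta: "iv t \<otimes> \<alpha> = \<alpha> \<otimes> iv t"
    using T_\<alpha>[OF T_iv[OF d(2)]] by simp
  have "\<alpha> \<otimes> iv g \<otimes> iv \<alpha> = iv u' \<otimes> \<alpha> \<otimes> iv t \<otimes> s \<otimes> iv u \<otimes> s \<otimes> iv \<alpha>"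
    unfolding d(4) using tG by simp
  also have "\<dots> = iv u' \<otimes> (\<alpha> \<otimes> iv t) \<otimes> s \<otimes> iv u \<otimes> s \<otimes> iv \<alpha>"
    by simp
  also have "\<dots> = iv u' \<otimes> (iv t \<otimes> q')"
    unfolding ta[symmetric] q'_def using s_\<alpha>' by simp
  finally have "\<sigma> (\<alpha> \<otimes> iv g \<otimes> iv \<alpha>) w = \<sigma> (iv u') (\<sigma> (iv t) w)"
    using UK[OF U_iv[OF d(3)]] TK[OF T_iv[OF d(2)]] QK[OF q'] q' K_mul by (simp add: \<sigma>_mul)
  then have 2: "\<phi> (\<sigma> (\<alpha> \<otimes> iv g \<otimes> iv \<alpha>) w) = \<phi> (\<sigma> (iv t) w)"
    using \<phi>_U[OF U_iv[OF d(3)]] by simp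
  obtain b where b: "\<And>w. \<phi> (\<sigma> (iv t) w) = b * \<phi> w"
    using \<phi>_T[OF T_iv[OF d(2)]] by blast
  have "\<sigma> (iv t) (\<sigma> s (\<sigma> t' v0)) = \<sigma> (iv t \<otimes> (s \<otimes> t')) v0"
    using TK[OF T_iv[OF d(2)]] TK[OF t'] s_K K_mul by (simp add: \<sigma>_mul)
  also have "\<dots> = \<sigma> s v0"
    unfolding t'_def using tG by simp
  finally have "b * (a * \<phi> (\<sigma> s v0)) = \<phi> (\<sigma> s v0)"
    using b[of "\<sigma> s (\<sigma> t' v0)"] a \<sigma>_scl[OF s_K] functional_scl[OF \<phi>_functional] by simp
  then have ba: "b * a = 1"
    by (metis \<phi>_s_v0 mult.assoc mult_cancel_right1)
  show ?thesis
    unfolding 1 2 b using ba by (simp add: mult.commute mult.left_commute)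
qed

text \<open>This makes the sum in \<open>hop\<close> independent of the representatives.\<close>

lemma kern_\<Gamma>:
  assumes f: "f \<in> V" and g: "g \<in> G" and a: "a \<in> K" and q: "q \<in> \<Gamma>"
  shows "kern f g (a \<otimes> q) = kern f g a"
proof -
  have aG: "a \<in> G" "q \<in> G"
    using a q K_G \<Gamma>_K by auto
  have "\<alpha> \<otimes> iv (a \<otimes> q) \<otimes> g = (\<alpha> \<otimes> iv q \<otimes> iv \<alpha>) \<otimes> (\<alpha> \<otimes> iv a \<otimes> g)"
    using aG by simp
  moreover have "\<alpha> \<otimes> iv q \<otimes> iv \<alpha> \<in> K"
    using subgrD(4)[OF \<Gamma>_sub q] unfolding \<Gamma>_def by simp
  ultimately have "f (\<alpha> \<otimes> iv (a \<otimes> q) \<otimes> g) = \<sigma> (\<alpha> \<otimes> iv q \<otimes> iv \<alpha>) (f (\<alpha> \<otimes> iv a \<otimes> g))"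
    using V_K[OF f, of "\<alpha> \<otimes> iv q \<otimes> iv \<alpha>" "\<alpha> \<otimes> iv a \<otimes> g"] aG g by simp
  moreover have "\<sigma> (a \<otimes> q \<otimes> s) v0 = \<sigma> a (\<sigma> (q \<otimes> s) v0)"
    using \<sigma>_mul[OF a K_mul[OF \<Gamma>_K[OF q] s_K], of v0] by simp
  moreover have "\<sigma> (a \<otimes> s) v0 = \<sigma> a (\<sigma> s v0)"
    using \<sigma>_mul[OF a s_K] .
  ultimately show ?thesis
    unfolding kern_def using \<Gamma>_weight[OF q, of "f (\<alpha> \<otimes> iv a \<otimes> g)"] \<sigma>_scl[OF a, symmetric] by simp
qed

lemma \<Gamma>_cofinite: "cofinite_in \<Gamma> K"
  unfolding \<Gamma>_def by (rule \<Gamma>_fin)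

lemmas K\<Gamma> = K_sub \<Gamma>_sub

lemma hop_nonzero: "hop f g \<noteq> 0 \<Longrightarrow> \<exists>a\<in>K. f (\<alpha> \<otimes> iv a \<otimes> g) \<noteq> 0 \<and> g \<in> G \<and> (\<exists>C\<in>cosets_of K \<Gamma>. a = rp C)"
proof -
  assume nz: "hop f g \<noteq> 0"
  then have g: "g \<in> G" and "coset_sum K \<Gamma> (kern f g) \<noteq> 0"
    unfolding hop_def by (auto split: if_splits)
  then obtain C where C: "C \<in> cosets_of K \<Gamma>" "kern f g (rp C) \<noteq> 0"
    unfolding coset_sum_def by (metis (no_types, lifting) sum.neutral)
  then have "f (\<alpha> \<otimes> iv (rp C) \<otimes> g) \<noteq> 0"
    unfolding kern_def using functional_0[OF \<phi>_functional] by auto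
  then show ?thesis
    using C g rp_cosetc[OF K\<Gamma>] by blast
qed

lemma hop_V:
  assumes f: "f \<in> V"
  shows "hop f \<in> V"
proof -
  obtain S where S: "finite S" "S \<subseteq> G" "\<And>g. g \<in> G \<Longrightarrow> f g \<noteq> 0 \<Longrightarrow> \<exists>k\<in>K. \<exists>x\<in>S. g = k \<otimes> x"
    using V_supp[OF f(1)] by blast
  define R where "R = rp ` cosets_of K \<Gamma>"
  have R: "finite R" "R \<subseteq> K"
    unfolding R_def using cosets_of_finite[OF K\<Gamma> \<Gamma>_cofinite] rp_cosetc[OF K\<Gamma>] by auto
  show ?thesis
  proof (rule V_I[of _ "(\<lambda>(b, x). \<alpha> \<otimes> (iv b \<otimes> x)) ` (R \<times> S)"])
    show "hop f g = 0" if "g \<notin> G" for g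
      using that unfolding hop_def by simp
    show "hop f (k \<otimes> g) = \<sigma> k (hop f g)" if k: "k \<in> K" and g: "g \<in> G" for k g
    proof -
      have kG: "k \<in> G"
        using K_G k by blast
      have "coset_sum K \<Gamma> (kern f (k \<otimes> g)) = coset_sum K \<Gamma> (\<lambda>a. kern f (k \<otimes> g) (k \<otimes> a))"
        by (rule coset_sum_reindex[OF K\<Gamma> \<Gamma>_cofinite, symmetric])
          (use k kG g K_G K_mul kern_\<Gamma>[OF f] in auto)
      also have "\<dots> = coset_sum K \<Gamma> (\<lambda>a. \<sigma> k (kern f g a))"
        by (rule coset_sum_cong[OF K\<Gamma>])
          (use k kG K_G K_mul s_K \<sigma>_mul[OF k] in \<open>simp add: kern_def \<sigma>_scl\<close>)
      also have "\<dots> = \<sigma> k (coset_sum K \<Gamma> (kern f g))"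
        unfolding coset_sum_def by (rule \<sigma>_sum[OF k, symmetric])
      finally show ?thesis
        unfolding hop_def using g kG by simp
    qed
    show "\<exists>k\<in>K. \<exists>y\<in>(\<lambda>(b, x). \<alpha> \<otimes> (iv b \<otimes> x)) ` (R \<times> S). g = k \<otimes> y"
      if nz: "hop f g \<noteq> 0" for g
    proof -
      obtain a where a: "a \<in> K" "f (\<alpha> \<otimes> iv a \<otimes> g) \<noteq> 0" "g \<in> G"
        using hop_nonzero[OF nz] by blast
      have aG: "a \<in> G"
        using K_G a by blast
      obtain k x where kx: "k \<in> K" "x \<in> S" "\<alpha> \<otimes> iv a \<otimes> g = k \<otimes> x"
        using S(3)[OF _ a(2)] a aG by auto
      \<comment> \<open>Choosing \<open>b\<close> in the class of \<open>iv (s \<otimes> k)\<close>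
        puts \<open>c\<close> into \<open>\<Gamma>\<close>, hence
        \<open>\<alpha> \<otimes> c \<otimes> iv \<alpha>\<close> into \<open>K\<close>. Since
        \<open>iv \<alpha> \<otimes> s\<close> is \<open>s \<otimes> \<alpha>\<close>, this exhibits
        \<open>g\<close> as an element of \<open>K\<close> times one of finitely many
        products.\<close>
      define u where "u = iv (s \<otimes> k)"
      define b where "b = rp (cosetc K \<Gamma> u)"
      have sk: "s \<otimes> k \<in> K" "u \<in> K"
        unfolding u_def using K_mul[OF s_K kx(1)] K_iv by auto
      have b: "b \<in> K" "iv u \<otimes> b \<in> \<Gamma>" "b \<in> R"
        using rp_cosetc_self[OF K\<Gamma> sk(2)] cosetc_in[OF K\<Gamma> sk(2)] unfolding b_def R_def by auto
      define c where "c = s \<otimes> k \<otimes> b"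
      have c: "c \<in> \<Gamma>"
        using b(2) K_G[OF sk(1)] unfolding u_def c_def by (simp del: iv_mul)
      have bG: "b \<in> G" "c \<in> G" "k \<in> G"
        using b c kx K_G \<Gamma>_K by auto
      have kc: "k = s \<otimes> c \<otimes> iv b"
        unfolding c_def using bG by simp
      have "g = a \<otimes> (iv \<alpha> \<otimes> (\<alpha> \<otimes> iv a \<otimes> g))"
        using aG by simp
      also have "\<dots> = a \<otimes> (iv \<alpha> \<otimes> s) \<otimes> c \<otimes> iv b \<otimes> x"
        unfolding kx(3) kc by simp
      also have "iv \<alpha> \<otimes> s = s \<otimes> \<alpha>"
        using s_\<alpha>[symmetric] by simp
      also have "a \<otimes> (s \<otimes> \<alpha>) \<otimes> c \<otimes> iv b \<otimes> x
          = (a \<otimes> (s \<otimes> (\<alpha> \<otimes> c \<otimes> iv \<alpha>))) \<otimes> (\<alpha> \<otimes> (iv b \<otimes> x))"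
        by simp
      finally have e: "g = (a \<otimes> (s \<otimes> (\<alpha> \<otimes> c \<otimes> iv \<alpha>))) \<otimes> (\<alpha> \<otimes> (iv b \<otimes> x))" .
      have "a \<otimes> (s \<otimes> (\<alpha> \<otimes> c \<otimes> iv \<alpha>)) \<in> K"
        using c a(1) s_K K_mul unfolding \<Gamma>_def by blast
      moreover have "\<alpha> \<otimes> (iv b \<otimes> x) \<in> (\<lambda>(b, x). \<alpha> \<otimes> (iv b \<otimes> x)) ` (R \<times> S)"
        using b(3) kx(2) by force
      ultimately show ?thesis
        using e by blast
    qed
    show "(\<lambda>(b, x). \<alpha> \<otimes> (iv b \<otimes> x)) ` (R \<times> S) \<subseteq> G"
      using R(2) S(2) K_G by (auto simp: subset_iff)
  qed (use R S in auto)
qed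


lemma hop_F:
  assumes f: "f \<in> F n"
  shows "hop f \<in> F (Suc n)"
  unfolding F_def
proof (intro CollectI conjI allI impI)
  show "hop f \<in> V"
    using hop_V F_V f by blast
  fix g assume "hop f g \<noteq> 0"
  then obtain a where a: "a \<in> K" "f (\<alpha> \<otimes> iv a \<otimes> g) \<noteq> 0" "g \<in> G"
    using hop_nonzero by blast
  have "iv \<alpha> \<otimes> (\<alpha> \<otimes> iv a \<otimes> g) \<in> ball (Suc n)"
    by (rule ball_iv\<alpha>, rule F_ball[OF f a(2)])
  then have "iv a \<otimes> g \<in> ball (Suc n)"
    using a(1,3) K_G by simp
  then show "g \<in> ball (Suc n)"
    using ball_l_iff[OF K_iv[OF a(1)] a(3)] by simp
qed

text \<open>Of the neighbours of a vertex at distance n + 1 only one, its parent, is at distance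
  at most n.\<close>

lemma hop_outer:
  assumes f: "f \<in> F n" and k: "k \<in> K"
  shows "hop f (\<alpha>p (Suc n) \<otimes> k) = sc (\<phi> (\<sigma> s (f (\<alpha>p n \<otimes> k)))) v0"
proof -
  have g: "\<alpha>p (Suc n) \<otimes> k \<in> G"
    using k K_G by simp
  \<comment> \<open>The parent belongs to the class of \<open>s\<close>, because
    \<open>\<alpha> \<otimes> s \<otimes> \<alpha>p (Suc n)\<close> equals
    \<open>s \<otimes> \<alpha>p n\<close>.\<close>
  have "coset_sum K \<Gamma> (kern f (\<alpha>p (Suc n) \<otimes> k)) = kern f (\<alpha>p (Suc n) \<otimes> k) s"
  proof (rule coset_sum_single[OF K\<Gamma> \<Gamma>_cofinite s_K])
    show "kern f (\<alpha>p (Suc n) \<otimes> k) (u \<otimes> q) = kern f (\<alpha>p (Suc n) \<otimes> k) u" if "u \<in> K" "q \<in> \<Gamma>" for u q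
      by (rule kern_\<Gamma>[OF F_V[OF f] g that])
    fix a assume a: "a \<in> K" "kern f (\<alpha>p (Suc n) \<otimes> k) a \<noteq> 0"
    have aG: "a \<in> G"
      using K_G a by blast
    have "f (\<alpha> \<otimes> iv a \<otimes> (\<alpha>p (Suc n) \<otimes> k)) \<noteq> 0"
      using a(2) functional_0[OF \<phi>_functional] unfolding kern_def by auto
    then have "(\<alpha> \<otimes> iv a \<otimes> \<alpha>p (Suc n)) \<otimes> k \<in> ball n"
      using F_ball[OF f] by simp
    then have "\<alpha> \<otimes> iv a \<otimes> \<alpha>p (Suc n) \<in> ball n"
      using ball_r_iff[OF k, of "\<alpha> \<otimes> iv a \<otimes> \<alpha>p (Suc n)"] aG by simp
    then have "\<alpha> \<otimes> iv a \<otimes> s \<otimes> iv \<alpha> \<in> K"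
      unfolding \<alpha>p_def by (rule ball_parent[OF K_iv[OF a(1)]])
    then have "iv a \<otimes> s \<in> \<Gamma>"
      unfolding \<Gamma>_def using K_mul[OF K_iv[OF a(1)] s_K] by simp
    from subgrD(4)[OF \<Gamma>_sub this] show "iv s \<otimes> a \<in> \<Gamma>"
      using aG by simp
  qed
  also have "\<dots> = sc (\<phi> (f (\<alpha> \<otimes> s \<otimes> (\<alpha>p (Suc n) \<otimes> k)))) v0"
    unfolding kern_def by simp
  also have "\<alpha> \<otimes> s \<otimes> (\<alpha>p (Suc n) \<otimes> k) = s \<otimes> (\<alpha>p n \<otimes> k)"
    using s_\<alpha>'(2)[of "\<alpha>p (Suc n) \<otimes> k"] by simp
  also have "f (s \<otimes> (\<alpha>p n \<otimes> k)) = \<sigma> s (f (\<alpha>p n \<otimes> k))"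
    using V_K[OF F_V[OF f] s_K] k K_G by simp
  finally show ?thesis
    unfolding hop_def using g by simp
qed

lemma U_conj:
  assumes "u \<in> U"
  shows "\<exists>u'\<in>U. u \<otimes> \<alpha>p n = \<alpha>p n \<otimes> u'"
  using U_\<alpha>p[OF assms, of n] by (intro bexI[of _ "iv (\<alpha>p n) \<otimes> u \<otimes> \<alpha>p n"]) auto

lemma U_conj_Suc:
  assumes "u \<in> U"
  shows "\<exists>u'\<in>U \<inter> Q. u \<otimes> \<alpha>p (Suc n) = \<alpha>p (Suc n) \<otimes> u'"
  using U_\<alpha>p_Suc[OF assms, of n]
  by (intro bexI[of _ "iv (\<alpha>p (Suc n)) \<otimes> u \<otimes> \<alpha>p (Suc n)"]) (auto simp del: \<alpha>p_Suc)

lemma outside_ball: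
  assumes k: "k \<in> K"
  shows "\<alpha>p (Suc n) \<otimes> k \<notin> ball n"
  using \<alpha>p_Suc_ball ball_r_iff[OF k \<alpha>p_G, of "Suc n"] by blast

text \<open>Vanishing of \<open>hop f\<close> on the next sphere only says that
  \<open>\<phi> (\<sigma> s _)\<close> kills every value at \<open>\<alpha>p n \<otimes> k\<close>.
  Varying \<open>k\<close> by elements of \<open>U\<close> carried through
  \<open>\<alpha>p n\<close> gives the vanishing at all \<open>s \<otimes> u\<close>, which
  separates points.\<close>

lemma hop_inj:
  assumes f: "f \<in> F n" and hf: "hop f \<in> F n"
  shows "f \<in> prev F n"
proof (rule sphere[OF f])
  have fK: "f (k \<otimes> g) = \<sigma> k (f g)" if "k \<in> K" "g \<in> G" for k g
    using V_K[OF F_V[OF f]] that .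
  have z: "\<phi> (\<sigma> s (f (\<alpha>p n \<otimes> k))) = 0" if k: "k \<in> K" for k
  proof -
    have "hop f (\<alpha>p (Suc n) \<otimes> k) = 0"
      using F_ball[OF hf] outside_ball[OF k] by blast
    then show ?thesis
      using hop_outer[OF f k] by simp
  qed
  fix k assume k: "k \<in> K"
  show "f (\<alpha>p n \<otimes> k) = 0"
  proof (rule functional_U_separates)
    fix u assume u: "u \<in> U"
    obtain u' where u': "u' \<in> U" "u \<otimes> \<alpha>p n = \<alpha>p n \<otimes> u'"
      using U_conj[OF u] by blast
    have "\<sigma> (s \<otimes> u) (f (\<alpha>p n \<otimes> k)) = \<sigma> s (f (u \<otimes> (\<alpha>p n \<otimes> k)))"
      using \<sigma>_mul[OF s_K UK[OF u]] fK[OF UK[OF u]] k K_G by simp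
    also have "u \<otimes> (\<alpha>p n \<otimes> k) = \<alpha>p n \<otimes> (u' \<otimes> k)"
      using u'(2) by (metis assoc)
    finally show "\<phi> (\<sigma> (s \<otimes> u) (f (\<alpha>p n \<otimes> k))) = 0"
      using z[OF K_mul[OF UK[OF u'(1)] k]] by simp
  qed
qed

text \<open>Each vertex has two distinct children at which hop b takes the same value, so a function
  supported on a single coset is not in the image modulo lower terms.\<close>

lemma hop_grow: "\<exists>x\<in>F (Suc n). \<forall>a\<in>F n. \<forall>b\<in>F n. x \<noteq> a + hop b"
proof (intro bexI ballI notI)
  let ?x = "delta (\<alpha>p (Suc n)) v0"
  show "?x \<in> F (Suc n)"
    unfolding F_def
  proof (intro CollectI conjI allI impI delta_V[OF \<alpha>p_G])
    fix g assume "?x g \<noteq> 0"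
    then have "g \<otimes> iv (\<alpha>p (Suc n)) \<in> K"
      unfolding delta_def by (auto split: if_splits)
    from ball_l[OF this \<alpha>p_ball[of "Suc n"]] show "g \<in> ball (Suc n)"
      using iv_l[OF \<alpha>p_G[of "Suc n"]] by (simp del: \<alpha>p_Suc)
  qed
  fix a b assume a: "a \<in> F n" and b: "b \<in> F n" and eq: "?x = a + hop b"
  have val: "?x (\<alpha>p (Suc n) \<otimes> k) = sc (\<phi> (\<sigma> s (b (\<alpha>p n \<otimes> k)))) v0" if k: "k \<in> K" for k
  proof -
    have "a (\<alpha>p (Suc n) \<otimes> k) = 0"
      using F_ball[OF a] outside_ball[OF k] by blast
    then show ?thesis
      unfolding eq using hop_outer[OF b k] by simp
  qed
  obtain q where q: "q \<in> U \<inter> Q" "\<alpha> \<otimes> q \<otimes> iv \<alpha> \<notin> K"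
    using branching by blast
  obtain u where u: "u \<in> U" "q \<otimes> \<alpha>p n = \<alpha>p n \<otimes> u"
    using U_conj q(1) by blast
  have "b (\<alpha>p n \<otimes> u) = b (\<alpha>p n)"
    unfolding u(2)[symmetric] using V_K[OF F_V[OF b] QK] q(1) by simp
  then have "?x (\<alpha>p (Suc n) \<otimes> u) = ?x (\<alpha>p (Suc n) \<otimes> \<one>)"
    using val[OF UK[OF u(1)]] val[OF K_one] by (simp del: \<alpha>p_Suc)
  then have "?x (\<alpha>p (Suc n) \<otimes> u) = v0"
    using delta_self[OF \<alpha>p_G] by simp
  moreover have "\<alpha>p (Suc n) \<otimes> u \<otimes> iv (\<alpha>p (Suc n)) = \<alpha> \<otimes> q \<otimes> iv \<alpha>"
  proof -
    have "\<alpha>p (Suc n) \<otimes> u \<otimes> iv (\<alpha>p (Suc n)) = \<alpha> \<otimes> (\<alpha>p n \<otimes> u) \<otimes> iv (\<alpha> \<otimes> \<alpha>p n)"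
      by simp
    also have "\<dots> = \<alpha> \<otimes> q \<otimes> iv \<alpha>"
      unfolding u(2)[symmetric] by simp
    finally show ?thesis .
  qed
  ultimately show False
    unfolding delta_def using q(2) by (simp del: \<alpha>p_Suc assoc)
qed

sublocale raising_operator scf F hop
proof -
  show "raising_operator scf F hop"
    by unfold_locales (fact F_subspace F_Suc hop_add hop_scf hop_F hop_inj hop_grow)+
qed

section \<open>The spherical Hecke algebra\<close>

definition Hecke :: "(('g \<Rightarrow> 'w) \<Rightarrow> 'g \<Rightarrow> 'w) set" where
  "Hecke = {X. (\<forall>f\<in>V. X f \<in> V) \<and> (\<forall>f\<in>V. \<forall>f'\<in>V. X (f + f') = X f + X f') \<and>
     (\<forall>f\<in>V. \<forall>a. X (scf a f) = scf a (X f)) \<and> (\<forall>f\<in>V. \<forall>g\<in>G. X (rt g f) = rt g (X f))}"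

lemma HeckeD:
  assumes "X \<in> Hecke" "f \<in> V"
  shows "X f \<in> V" "f' \<in> V \<Longrightarrow> X (f + f') = X f + X f'" "X (scf a f) = scf a (X f)"
    "g \<in> G \<Longrightarrow> X (rt g f) = rt g (X f)"
  using assms unfolding Hecke_def by auto

lemma HeckeI:
  assumes "\<And>f. f \<in> V \<Longrightarrow> X f \<in> V" "\<And>f f'. f \<in> V \<Longrightarrow> f' \<in> V \<Longrightarrow> X (f + f') = X f + X f'"
    and "\<And>f a. f \<in> V \<Longrightarrow> X (scf a f) = scf a (X f)"
    and "\<And>f g. f \<in> V \<Longrightarrow> g \<in> G \<Longrightarrow> X (rt g f) = rt g (X f)"
  shows "X \<in> Hecke"
  unfolding Hecke_def using assms by simp

lemma hop_pow:
  shows "f \<in> V \<Longrightarrow> (hop ^^ j) f \<in> V" and "(hop ^^ j) (f + f') = (hop ^^ j) f + (hop ^^ j) f'"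
    and "(hop ^^ j) (scf a f) = scf a ((hop ^^ j) f)"
    and "g \<in> G \<Longrightarrow> (hop ^^ j) (rt g f) = rt g ((hop ^^ j) f)"
  by (induction j) (simp_all add: hop_V hop_add hop_scf hop_rt)

lemma Tpoly_Hecke: "Tpoly m c \<in> Hecke"
proof (rule HeckeI)
  show "Tpoly m c f \<in> V" if "f \<in> V" for f
    unfolding Tpoly_def
    by (rule fun_space.subspace_sum[OF V_subspace], rule fun_space.subspace_scale[OF V_subspace],
        rule hop_pow(1)[OF that])
  show "Tpoly m c (f + f') = Tpoly m c f + Tpoly m c f'" for f f'
    unfolding Tpoly_def by (simp add: hop_pow(2) fun_space.scale_right_distrib sum.distrib)
  show "Tpoly m c (scf a f) = scf a (Tpoly m c f)" for f a
    unfolding Tpoly_def fun_space.scale_sum_right hop_pow(3)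
    by (rule sum.cong) (auto simp: fun_space.scale_left_commute)
  show "Tpoly m c (rt g f) = rt g (Tpoly m c f)" if "g \<in> G" for f g
    unfolding Tpoly_def hop_pow(4)[OF that] by (simp add: rt_def scf_def fun_eq_iff sum_fun_apply)
qed

text \<open>Induction on the number of cosets carrying the support: subtracting
  \<open>delta x (f x)\<close> clears the coset of \<open>x\<close>, and this function is a
  translate of one at \<open>\<one>\<close>.\<close>

lemma Hecke_delta_eq:
  assumes X: "X \<in> Hecke" and Y: "Y \<in> Hecke" and eq: "\<And>w. X (delta \<one> w) = Y (delta \<one> w)"
    and f: "f \<in> V"
  shows "X f = Y f"
proof -
  have XY: "X (delta x w) = Y (delta x w)" if "x \<in> G" for x w
    unfolding delta_rt[OF that]
    using HeckeD(4)[OF X delta_V[OF G_one] G_iv[OF that]] HeckeD(4)[OF Y delta_V[OF G_one] G_iv[OF that]] eq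
    by simp
  have z: "X 0 = 0" if "X \<in> Hecke" for X
    using HeckeD(3)[OF that fun_space.subspace_0[OF V_subspace], of 0] by simp
  have "X f = Y f" if "finite S" "S \<subseteq> G" "f \<in> V" "\<And>g. g \<in> G \<Longrightarrow> f g \<noteq> 0 \<Longrightarrow> \<exists>k\<in>K. \<exists>x\<in>S. g = k \<otimes> x" for S f
    using that
  proof (induction S arbitrary: f rule: finite_induct)
    case empty
    have "f = 0"
      using V_outside[OF empty.prems(2)] empty.prems(3) by (force simp: fun_eq_iff)
    show ?case
      unfolding \<open>f = 0\<close> z[OF X] z[OF Y] ..
  next
    case (insert x S)
    have x: "x \<in> G"
      using insert.prems by blast
    let ?d = "delta x (f x)"
    define f' where "f' = f + scf (- 1) ?d"
    have dV: "?d \<in> V"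
      by (rule delta_V[OF x])
    have f'V: "f' \<in> V"
      unfolding f'_def
      by (intro fun_space.subspace_add[OF V_subspace] fun_space.subspace_scale[OF V_subspace] insert.prems dV)
    have "X f' = Y f'"
    proof (rule insert.IH[OF _ f'V])
      show "S \<subseteq> G"
        using insert.prems by blast
      fix g assume g: "g \<in> G" "f' g \<noteq> 0"
      have nK: "g \<otimes> iv x \<notin> K"
      proof
        assume k: "g \<otimes> iv x \<in> K"
        have "f g = f ((g \<otimes> iv x) \<otimes> x)"
          using x by simp
        also have "\<dots> = \<sigma> (g \<otimes> iv x) (f x)"
          by (rule V_K[OF insert.prems(2) k x])
        finally have "f' g = 0"
          unfolding f'_def scf_def delta_def using k by simp
        then show False
          using g by simp
      qed
      then have "f g \<noteq> 0"
        using g unfolding f'_def scf_def delta_def by simp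
      then obtain k y where ky: "k \<in> K" "y \<in> insert x S" "g = k \<otimes> y"
        using insert.prems(3)[OF g(1)] by blast
      then have "y \<noteq> x"
        using nK x by auto
      then show "\<exists>k\<in>K. \<exists>x\<in>S. g = k \<otimes> x"
        using ky by blast
    qed
    moreover have "f = f' + ?d"
      unfolding f'_def scf_def by (simp add: fun_eq_iff)
    ultimately show ?case
      using HeckeD(2)[OF X f'V dV] HeckeD(2)[OF Y f'V dV] XY[OF x] by metis
  qed
  then show ?thesis
    using V_supp[OF f] f by blast
qed

lemma Hecke_delta_add:
  assumes X: "X \<in> Hecke"
  shows "X (delta \<one> (u + v)) g = X (delta \<one> u) g + X (delta \<one> v) g"
    and "X (delta \<one> (sc a v)) g = sc a (X (delta \<one> v) g)"
    and "k \<in> K \<Longrightarrow> X (delta \<one> (\<sigma> k w)) g = X (delta \<one> w) (g \<otimes> k)"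
proof -
  note d = delta_V[OF G_one]
  show "X (delta \<one> (u + v)) g = X (delta \<one> u) g + X (delta \<one> v) g"
    unfolding delta_one_add HeckeD(2)[OF X d d] by simp
  show "X (delta \<one> (sc a v)) g = sc a (X (delta \<one> v) g)"
    unfolding delta_one_scl HeckeD(3)[OF X d] by (simp add: scf_def)
  show "X (delta \<one> (\<sigma> k w)) g = X (delta \<one> w) (g \<otimes> k)" if "k \<in> K"
    unfolding delta_one_\<sigma>[OF that] HeckeD(4)[OF X d K_G[OF that]] by (simp add: rt_def)
qed

text \<open>Elements of \<open>U\<close> pass through \<open>\<alpha>p (Suc n)\<close> into
  \<open>Q\<close>, which acts trivially, so the values are fixed by \<open>U\<close> and lie on the
  line of \<open>v0\<close>. In the other direction \<open>s \<otimes> u \<otimes> s\<close> passes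
  through to an element of \<open>Q\<close> on the left, which gives the invariance of
  \<open>\<mu>\<close>. The exponent is positive because at least one conjugation by
  \<open>\<alpha>\<close> is required to reach \<open>Q\<close>.\<close>

lemma Hecke_leading:
  assumes X: "X \<in> Hecke"
  shows "\<exists>\<mu>. functional sc \<mu> \<and> (\<forall>w. X (delta \<one> w) (\<alpha>p (Suc n)) = sc (\<mu> w) v0) \<and>
    (\<forall>u\<in>U. \<forall>w. \<mu> (\<sigma> (s \<otimes> u \<otimes> s) w) = \<mu> w)"
proof -
  define A where "A w = X (delta \<one> w) (\<alpha>p (Suc n))" for w
  define \<mu> where "\<mu> w = \<phi> (\<sigma> s (A w)) / \<phi> (\<sigma> s v0)" for w
  have XV: "X (delta \<one> w) \<in> V" for w
    by (rule HeckeD(1)[OF X delta_V[OF G_one]])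
  have AK: "A (\<sigma> k w) = X (delta \<one> w) (\<alpha>p (Suc n) \<otimes> k)" if "k \<in> K" for k w
    unfolding A_def by (rule Hecke_delta_add(3)[OF X that])
  have "\<sigma> u (A w) = A w" if u: "u \<in> U" for u w
  proof -
    obtain u' where u': "u' \<in> U" "u' \<in> Q" "u \<otimes> \<alpha>p (Suc n) = \<alpha>p (Suc n) \<otimes> u'"
      using U_conj_Suc[OF u, of n] by blast
    have "\<sigma> u (A w) = X (delta \<one> w) (u \<otimes> \<alpha>p (Suc n))"
      unfolding A_def by (rule V_K[OF XV UK[OF u] \<alpha>p_G, symmetric])
    also have "\<dots> = A (\<sigma> u' w)"
      unfolding u'(3) by (rule AK[OF UK[OF u'(1)], symmetric])
    finally show ?thesis
      using u'(2) by simp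
  qed
  then have Av: "\<exists>a. A w = sc a v0" for w
    using fixed_line by blast
  have A\<mu>: "A w = sc (\<mu> w) v0" for w
  proof -
    obtain a where a: "A w = sc a v0"
      using Av by blast
    then have "\<mu> w = a"
      unfolding \<mu>_def by (simp add: \<sigma>_scl[OF s_K] functional_scl[OF \<phi>_functional])
    then show ?thesis
      using a by simp
  qed
  have lin: "functional sc \<mu>"
    unfolding functional_def \<mu>_def A_def
    by (simp add: Hecke_delta_add(1,2)[OF X] \<sigma>_add[OF s_K] \<sigma>_scl[OF s_K]
        functional_add[OF \<phi>_functional] functional_scl[OF \<phi>_functional] add_divide_distrib del: \<alpha>p_Suc)
  have inv: "A (\<sigma> (s \<otimes> u \<otimes> s) w) = A w" if u: "u \<in> U" for u w
  proof -
    define q where "q = s \<otimes> (iv (\<alpha>p (Suc n)) \<otimes> u \<otimes> \<alpha>p (Suc n)) \<otimes> s"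
    have q: "q \<in> Q"
      unfolding q_def using U_\<alpha>p_Suc[OF u, of n] Q_s by blast
    have "\<alpha>p (Suc n) \<otimes> (s \<otimes> u \<otimes> s) = (\<alpha>p (Suc n) \<otimes> s) \<otimes> u \<otimes> s"
      by (simp del: \<alpha>p_Suc)
    also have "\<dots> = s \<otimes> iv (\<alpha>p (Suc n)) \<otimes> u \<otimes> s"
      unfolding s_iv\<alpha>p ..
    also have "\<dots> = s \<otimes> iv (\<alpha>p (Suc n)) \<otimes> u \<otimes> (\<alpha>p (Suc n) \<otimes> iv (\<alpha>p (Suc n))) \<otimes> s"
      by (simp del: \<alpha>p_Suc)
    also have "\<dots> = s \<otimes> iv (\<alpha>p (Suc n)) \<otimes> u \<otimes> \<alpha>p (Suc n) \<otimes> (iv (\<alpha>p (Suc n)) \<otimes> s)"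
      by (simp del: \<alpha>p_Suc iv_r iv_r')
    also have "\<dots> = q \<otimes> \<alpha>p (Suc n)"
      unfolding s_\<alpha>p[symmetric] q_def by (simp del: \<alpha>p_Suc)
    finally have e: "\<alpha>p (Suc n) \<otimes> (s \<otimes> u \<otimes> s) = q \<otimes> \<alpha>p (Suc n)" .
    have "A (\<sigma> (s \<otimes> u \<otimes> s) w) = X (delta \<one> w) (q \<otimes> \<alpha>p (Suc n))"
      unfolding e[symmetric] by (rule AK) (use K_mul s_K UK u in blast)
    also have "\<dots> = \<sigma> q (A w)"
      unfolding A_def by (rule V_K[OF XV QK[OF q] \<alpha>p_G])
    finally show ?thesis
      using q by simp
  qed
  show ?thesis
  proof (intro exI[of _ \<mu>] conjI lin allI ballI)
    show "X (delta \<one> w) (\<alpha>p (Suc n)) = sc (\<mu> w) v0" for w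
      using A\<mu> unfolding A_def .
    show "\<mu> (\<sigma> (s \<otimes> u \<otimes> s) w) = \<mu> w" if "u \<in> U" for u w
      unfolding \<mu>_def inv[OF that] ..
  qed
qed

text \<open>Injectivity on the graded space preserves the exact degree; hence the leading functional
  of a power of \<open>hop\<close> is nonzero.\<close>

lemma hop_pow_degree: "w \<noteq> 0 \<Longrightarrow> (hop ^^ n) (delta \<one> w) \<in> F n \<and> (hop ^^ n) (delta \<one> w) \<notin> prev F n"
proof (induction n)
  case 0
  have "delta \<one> w \<noteq> 0"
  proof
    assume "delta \<one> w = 0"
    then have "delta \<one> w \<one> = 0"
      by simp
    then show False
      using 0 delta_self[OF G_one] by simp
  qed
  then show ?case
    using delta_one_F by simp
next
  case (Suc n)
  then show ?case
    using hop_F[of "(hop ^^ n) (delta \<one> w)" n] hop_inj[of "(hop ^^ n) (delta \<one> w)" n] by auto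
qed

text \<open>Degree 0 is Schur's lemma, with the scalar read off on the line of \<open>v0\<close>. In
  degree \<open>Suc n\<close> the leading functionals of \<open>X\<close> and of
  \<open>hop ^^ Suc n\<close> are both invariant under the opposite unipotent group, hence
  proportional, and subtracting a multiple of the power lowers the degree.\<close>

lemma Hecke_poly:
  assumes "X \<in> Hecke" "\<And>w. X (delta \<one> w) \<in> F n"
  shows "\<exists>c. \<forall>w. X (delta \<one> w) = Tpoly n c (delta \<one> w)"
  using assms
proof (induction n arbitrary: X)
  case 0
  define A where "A w = X (delta \<one> w) \<one>" for w
  have XV: "X (delta \<one> w) \<in> V" for w
    by (rule HeckeD(1)[OF 0(1) delta_V[OF G_one]])
  have A_K: "A (\<sigma> k w) = \<sigma> k (A w)" if k: "k \<in> K" for k w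
    unfolding A_def using Hecke_delta_add(3)[OF 0(1) k] V_K[OF XV k G_one] by simp
  have "\<sigma> u (A v0) = A v0" if "u \<in> U" for u
    using A_K[OF UK[OF that], of v0] v0_U[OF that] by simp
  then obtain a where a: "A v0 = sc a v0"
    using fixed_line by blast
  let ?S = "{w. A w = sc a w}"
  have "?S = UNIV"
  proof (rule irreducible[of ?S v0])
    have A_add: "A (u + v) = A u + A v" and A_scl: "A (sc b v) = sc b (A v)" for u v b
      unfolding A_def using Hecke_delta_add(1,2)[OF 0(1)] by auto
    have "A 0 = 0"
      using A_scl[of 0 0] by simp
    then show "subspace ?S"
      by (intro subspaceI) (auto simp: A_add A_scl scale_right_distrib scale_left_commute)
    show "\<sigma> k w \<in> ?S" if "k \<in> K" "w \<in> ?S" for k w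
      using that A_K \<sigma>_scl by simp
  qed (use a in auto)
  then have A: "A w = sc a w" for w
    by blast
  have "X (delta \<one> w) = scf a (delta \<one> w)" for w
  proof
    fix g
    show "X (delta \<one> w) g = scf a (delta \<one> w) g"
    proof (cases "g \<in> K")
      case True
      then show ?thesis
        using V_K[OF XV True G_one, of w] A[of w] \<sigma>_scl[OF True] unfolding A_def scf_def delta_def by simp
    next
      case False
      then show ?thesis
        using F_ball[OF 0(2)] ball_0 unfolding scf_def delta_def by auto
    qed
  qed
  then show ?case
    by (intro exI[of _ "\<lambda>_. a"]) (simp add: Tpoly_def)
next
  case (Suc n)
  have hopH: "hop ^^ Suc n \<in> Hecke"
    by (rule HeckeI) (auto simp del: funpow.simps simp: hop_pow)
  obtain \<mu> where \<mu>: "functional sc \<mu>" "\<And>w. X (delta \<one> w) (\<alpha>p (Suc n)) = sc (\<mu> w) v0"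
    "\<And>u w. u \<in> U \<Longrightarrow> \<mu> (\<sigma> (s \<otimes> u \<otimes> s) w) = \<mu> w"
    using Hecke_leading[OF Suc.prems(1), of n] by blast
  obtain \<nu> where \<nu>: "functional sc \<nu>" "\<And>w. (hop ^^ Suc n) (delta \<one> w) (\<alpha>p (Suc n)) = sc (\<nu> w) v0"
    "\<And>u w. u \<in> U \<Longrightarrow> \<nu> (\<sigma> (s \<otimes> u \<otimes> s) w) = \<nu> w"
    using Hecke_leading[OF hopH, of n] by blast
  have \<nu>0: "\<nu> v0 \<noteq> 0"
  proof
    assume "\<nu> v0 = 0"
    then have z: "\<nu> w = 0" for w
      using opposite_invariant_functional[OF \<nu>(1) \<nu>(3)] by blast
    have "(hop ^^ Suc n) (delta \<one> v0) \<in> prev F (Suc n)"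
    proof (rule sphere)
      show "(hop ^^ Suc n) (delta \<one> v0) \<in> F (Suc n)"
        using hop_pow_degree[OF v0_nonzero] by blast
      fix k assume k: "k \<in> K"
      show "(hop ^^ Suc n) (delta \<one> v0) (\<alpha>p (Suc n) \<otimes> k) = 0"
        unfolding Hecke_delta_add(3)[OF hopH k, symmetric] \<nu>(2) z by simp
    qed
    then show False
      using hop_pow_degree[OF v0_nonzero, of "Suc n"] by blast
  qed
  define c where "c = \<mu> v0 / \<nu> v0"
  have \<mu>\<nu>: "\<mu> w + - c * \<nu> w = 0" for w
  proof (rule opposite_invariant_functional[where \<mu> = "\<lambda>w. \<mu> w + - c * \<nu> w"])
    show "functional sc (\<lambda>w. \<mu> w + - c * \<nu> w)"
      using \<mu>(1) \<nu>(1) unfolding functional_def by (simp add: algebra_simps)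
  qed (use \<mu>(3) \<nu>(3) \<nu>0 in \<open>auto simp: c_def\<close>)
  define Y where "Y f = X f + scf (- c) ((hop ^^ Suc n) f)" for f
  have YH: "Y \<in> Hecke"
  proof (rule HeckeI)
    fix f assume f: "f \<in> V"
    show "Y f \<in> V"
      unfolding Y_def by (intro fun_space.subspace_add[OF V_subspace] fun_space.subspace_scale[OF V_subspace]
          HeckeD(1)[OF Suc.prems(1) f] HeckeD(1)[OF hopH f])
    show "Y (f + f') = Y f + Y f'" if "f' \<in> V" for f'
      unfolding Y_def HeckeD(2)[OF Suc.prems(1) f that] HeckeD(2)[OF hopH f that] fun_space.scale_right_distrib
      by (simp only: add_ac)
    show "Y (scf a f) = scf a (Y f)" for a
      unfolding Y_def HeckeD(3)[OF Suc.prems(1) f] HeckeD(3)[OF hopH f] fun_space.scale_right_distrib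
      by (simp only: fun_space.scale_scale mult.commute)
    show "Y (rt g f) = rt g (Y f)" if "g \<in> G" for g
      unfolding Y_def HeckeD(4)[OF Suc.prems(1) f that] HeckeD(4)[OF hopH f that]
      by (simp add: rt_def scf_def fun_eq_iff)
  qed
  have "Y (delta \<one> w) \<in> F n" for w
  proof -
    have "Y (delta \<one> w) \<in> prev F (Suc n)"
    proof (rule sphere)
      have "(hop ^^ Suc n) (delta \<one> w) \<in> F (Suc n)"
        using pow_F[OF delta_one_F[of w], of "Suc n"] by simp
      then show "Y (delta \<one> w) \<in> F (Suc n)"
        unfolding Y_def
        by (intro fun_space.subspace_add[OF F_subspace] fun_space.subspace_scale[OF F_subspace] Suc.prems(2))
      fix k assume k: "k \<in> K"
      have "Y (delta \<one> w) (\<alpha>p (Suc n) \<otimes> k) = Y (delta \<one> (\<sigma> k w)) (\<alpha>p (Suc n))"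
        by (rule Hecke_delta_add(3)[OF YH k, symmetric])
      also have "\<dots> = sc (\<mu> (\<sigma> k w) + - c * \<nu> (\<sigma> k w)) v0"
        unfolding Y_def plus_fun_apply scf_def \<mu>(2) \<nu>(2) by (simp add: scale_left_distrib scale_left_diff_distrib)
      finally show "Y (delta \<one> w) (\<alpha>p (Suc n) \<otimes> k) = 0"
        unfolding \<mu>\<nu> by simp
    qed
    then show ?thesis
      by simp
  qed
  then obtain d where d: "\<And>w. Y (delta \<one> w) = Tpoly n d (delta \<one> w)"
    using Suc.IH[OF YH] by blast
  have "X (delta \<one> w) = Tpoly (Suc n) (d(Suc n := c)) (delta \<one> w)" for w
  proof -
    have "X (delta \<one> w) = Y (delta \<one> w) + scf c ((hop ^^ Suc n) (delta \<one> w))"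
      unfolding Y_def by (simp add: scf_def fun_eq_iff)
    also have "\<dots> = Tpoly (Suc n) (d(Suc n := c)) (delta \<one> w)"
      unfolding d Tpoly_def sum.atMost_Suc by (simp del: funpow.simps)
    finally show ?thesis .
  qed
  then show ?case
    by blast
qed

text \<open>A support bound valid for \<open>v0\<close> is valid for all \<open>w\<close>, because
  the vectors \<open>w\<close> with \<open>X (delta \<one> w) \<in> F n\<close> form a
  subrepresentation.\<close>

lemma Hecke_is_polynomial:
  assumes X: "X \<in> Hecke"
  shows "\<exists>n c. \<forall>f\<in>V. X f = Tpoly n c f"
proof -
  obtain n where n: "X (delta \<one> v0) \<in> F n"
    using F_exhaust[OF HeckeD(1)[OF X delta_V[OF G_one]]] by blast
  let ?S = "{w. X (delta \<one> w) \<in> F n}"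
  have "?S = UNIV"
  proof (rule irreducible[of ?S v0])
    show "subspace ?S"
    proof (rule subspaceI)
      have "delta \<one> (0::'w) = 0"
        by (auto simp: delta_def fun_eq_iff)
      then have "X (delta \<one> 0) = 0"
        using HeckeD(3)[OF X fun_space.subspace_0[OF V_subspace], of 0] by simp
      then show "0 \<in> ?S"
        using fun_space.subspace_0[OF F_subspace] by simp
      show "u + v \<in> ?S" if "u \<in> ?S" "v \<in> ?S" for u v
        using that HeckeD(2)[OF X delta_V[OF G_one] delta_V[OF G_one]] fun_space.subspace_add[OF F_subspace]
        by (simp add: delta_one_add)
      show "sc a v \<in> ?S" if "v \<in> ?S" for a v
        using that HeckeD(3)[OF X delta_V[OF G_one]] fun_space.subspace_scale[OF F_subspace]
        by (simp add: delta_one_scl)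
    qed
    show "\<sigma> k w \<in> ?S" if k: "k \<in> K" and w: "w \<in> ?S" for k w
    proof -
      have "g \<in> ball n" if "X (delta \<one> (\<sigma> k w)) g \<noteq> 0" for g
      proof -
        have gk: "g \<otimes> k \<in> ball n"
          using that F_ball[of "X (delta \<one> w)"] w Hecke_delta_add(3)[OF X k] by auto
        have "g \<otimes> k \<otimes> iv k \<in> ball n"
          by (rule ball_r[OF K_iv[OF k] gk])
        then show ?thesis
          using K_G[OF k] by simp
      qed
      then show ?thesis
        unfolding F_def using HeckeD(1)[OF X delta_V[OF G_one]] by blast
    qed
  qed (use n in auto)
  then have "\<And>w. X (delta \<one> w) \<in> F n"
    by blast
  then obtain c where "\<And>w. X (delta \<one> w) = Tpoly n c (delta \<one> w)"
    using Hecke_poly[OF X] by blast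
  then show ?thesis
    using Hecke_delta_eq[OF X Tpoly_Hecke] by blast
qed

theorem free_over_Hecke: "\<exists>B. infinite B \<and> free_basis Hecke V B"
proof (intro exI[of _ B] conjI infinite_B)
  have BV: "B \<subseteq> V"
    using B_F F_V by blast
  show "free_basis Hecke V B"
    unfolding free_basis_def
  proof (intro conjI ballI allI impI BV)
    fix f assume "f \<in> V"
    then have "f \<in> gen"
      using F_exhaust powers_span by blast
    then obtain B0 m c where "finite B0" "B0 \<subseteq> B" "f = (\<Sum>b\<in>B0. Tpoly m (c b) b)"
      unfolding gen_def by blast
    then show "\<exists>B0 X. finite B0 \<and> B0 \<subseteq> B \<and> (\<forall>b\<in>B0. X b \<in> Hecke) \<and> f = (\<Sum>b\<in>B0. X b b)"
      using Tpoly_Hecke by (intro exI[of _ B0] exI[of _ "\<lambda>b. Tpoly m (c b)"]) auto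
  next
    fix B0 X b f
    assume B0: "finite B0" "B0 \<subseteq> B" and X: "\<forall>b\<in>B0. X b \<in> Hecke" and z: "(\<Sum>b\<in>B0. X b b) = 0"
      and b: "b \<in> B0" and f: "f \<in> V"
    have "\<forall>b\<in>B0. \<exists>nc. \<forall>f\<in>V. X b f = Tpoly (fst nc) (snd nc) f"
      using Hecke_is_polynomial X by fastforce
    from bchoice[OF this] obtain nc where
      nc': "\<forall>b\<in>B0. \<forall>f\<in>V. X b f = Tpoly (fst (nc b)) (snd (nc b)) f" ..
    define n c where "n b = fst (nc b)" and "c b = snd (nc b)" for b
    have nc: "X b f = Tpoly (n b) (c b) f" if "b \<in> B0" "f \<in> V" for b f
      using nc' that unfolding n_def c_def by blast
    define m where "m = Max (n ` B0)"
    \<comment> \<open>The operators come with different degree bounds; cutting off and padding with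
      zeros up to the common bound \<open>m\<close> prepares them for
      \<open>powers_independent\<close>.\<close>
    define d where "d b j = (if j \<le> n b then c b j else 0)" for b j
    have nm: "n b \<le> m" if "b \<in> B0" for b
      unfolding m_def using that B0 by simp
    have ext: "Tpoly (n b) (c b) f = Tpoly m (d b) f" if "b \<in> B0" for b f
      unfolding Tpoly_def by (rule sum.mono_neutral_cong_left) (use nm[OF that] in \<open>auto simp: d_def\<close>)
    have "(\<Sum>b\<in>B0. \<Sum>j\<le>m. scf (d b j) ((hop ^^ j) b)) = (\<Sum>b\<in>B0. X b b)"
      by (rule sum.cong) (use nc ext B0 BV in \<open>auto simp: Tpoly_def\<close>)
    then have "\<forall>b\<in>B0. \<forall>j\<le>m. d b j = 0"
      using powers_independent[OF B0, where m = m and c = d] z by simp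
    then show "X b f = 0"
      using nc[OF b f] ext[OF b] b by (simp add: Tpoly_def)
  qed
qed

end

section \<open>Matrices with entries in prescribed fractional ideals\<close>

definition rev3 :: "3 \<Rightarrow> 3" where "rev3 i = (if i = 1 then 3 else if i = 3 then 1 else 2)"

lemma rev3_simps [simp]: "rev3 1 = 3" "rev3 2 = 2" "rev3 3 = 1"
  by (simp_all add: rev3_def)

lemma rev3_rev3 [simp]: "rev3 (rev3 i) = i"
  using exhaust_3[of i] by auto

lemma mult3_nth: "(A ** B) $ i $ j = A $ i $ 1 * B $ 1 $ j + A $ i $ 2 * B $ 2 $ j + A $ i $ 3 * B $ 3 $ j"
  for A :: "'a::semiring_1^3^'n" and B :: "'a^'k^3"
  by (simp add: matrix_matrix_mult_def sum_3)

lemma mat3_eq_iff: "A = B \<longleftrightarrow> A$1$1 = B$1$1 \<and> A$1$2 = B$1$2 \<and> A$1$3 = B$1$3 \<and> A$2$1 = B$2$1 \<and> A$2$2 = B$2$2 \<and>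
    A$2$3 = B$2$3 \<and> A$3$1 = B$3$1 \<and> A$3$2 = B$3$2 \<and> A$3$3 = B$3$3"
  for A B :: "'a^3^3"
  by (auto simp: vec_eq_iff forall_3)

definition tab :: "'a \<Rightarrow> 'a \<Rightarrow> 'a \<Rightarrow> 'a \<Rightarrow> 'a \<Rightarrow> 'a \<Rightarrow> 'a \<Rightarrow> 'a \<Rightarrow> 'a \<Rightarrow> 3 \<Rightarrow> 3 \<Rightarrow> 'a" where
  "tab a b c d e f g h l i j = (if i = 1 then if j = 1 then a else if j = 2 then b else c
     else if i = 2 then if j = 1 then d else if j = 2 then e else f
     else if j = 1 then g else if j = 2 then h else l)"

lemma tab_simps [simp]: "tab a b c d e f g h l 1 1 = a" "tab a b c d e f g h l 1 2 = b"
  "tab a b c d e f g h l 1 3 = c" "tab a b c d e f g h l 2 1 = d" "tab a b c d e f g h l 2 2 = e"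
  "tab a b c d e f g h l 2 3 = f" "tab a b c d e f g h l 3 1 = g" "tab a b c d e f g h l 3 2 = h"
  "tab a b c d e f g h l 3 3 = l"
  by (simp_all add: tab_def)

definition mk3 :: "'a \<Rightarrow> 'a \<Rightarrow> 'a \<Rightarrow> 'a \<Rightarrow> 'a \<Rightarrow> 'a \<Rightarrow> 'a \<Rightarrow> 'a \<Rightarrow> 'a \<Rightarrow> 'a^3^3" where
  "mk3 a b c d e f g h l = (\<chi> i j. tab a b c d e f g h l i j)"

lemma mk3_nth [simp]: "mk3 a b c d e f g h l $ i $ j = tab a b c d e f g h l i j"
  by (simp add: mk3_def)

lemma mat_one_nth [simp]: "(mat 1 :: 'a::zero_neq_one^3^3) $ i $ j = (if i = j then 1 else 0)"
  by (simp add: mat_def)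

text \<open>Some difference \<open>c x - x\<close> is nonzero and is negated by \<open>c\<close>; a
  power of the fixed uniformizer rescales it to a unit. It provides explicit unipotent elements
  \<open>lowr 0 y\<close> with a single off-diagonal entry.\<close>

lemma ex_antisymmetric_unit:
  fixes c :: "'e::field \<Rightarrow> 'e"
  assumes "unramified_quadratic w c p" "c \<pi> = \<pi>" "\<pi> \<noteq> 0" "w \<pi> = 1"
  shows "\<exists>\<epsilon>. \<epsilon> \<noteq> 0 \<and> w \<epsilon> = 0 \<and> c \<epsilon> = - \<epsilon>"
proof -
  have dv: "\<And>x y. x \<noteq> 0 \<Longrightarrow> y \<noteq> 0 \<Longrightarrow> w (x * y) = w x + w y"
    and c: "\<And>x y. c (x + y) = c x + c y" "\<And>x y. c (x * y) = c x * c y" "\<And>x. c (c x) = x" "c 1 = 1"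
    and ex: "\<exists>x. c x \<noteq> x"
    using assms(1) unfolding unramified_quadratic_def nonarch_local_field_def discrete_valuation_def by auto
  have w1: "w 1 = 0"
    using dv[of 1 1] by simp
  have cp: "c (\<pi> ^ n) = \<pi> ^ n" for n
    by (induction n) (simp_all add: c assms)
  have wp: "w (\<pi> ^ n) = int n" for n
    by (induction n) (simp_all add: w1 dv assms)
  obtain x where x: "c x \<noteq> x"
    using ex by blast
  define y where "y = c x - x"
  have c0: "c 0 = 0"
    using c(1)[of 0 0] by (metis add.right_neutral add_cancel_left_left)
  have "c (- x) = - c x" for x
    using c(1)[of x "- x"] c0 by (simp add: eq_neg_iff_add_eq_0 add.commute)
  then have y: "y \<noteq> 0" "c y = - y"
    unfolding y_def using x c(1)[of "c x" "- x"] c(3) by auto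
  define n where "n = nat \<bar>w y\<bar>"
  show ?thesis
  proof (cases "w y \<ge> 0")
    case True
    define z where "z = y / \<pi> ^ n"
    have e: "y = z * \<pi> ^ n"
      unfolding z_def using assms by simp
    then have z0: "z \<noteq> 0"
      using y by auto
    have "w z + int n = w y"
      unfolding e using dv[OF z0, of "\<pi> ^ n"] assms wp by simp
    have "c z * \<pi> ^ n = - z * \<pi> ^ n"
      using y(2) unfolding e c(2) cp by simp
    then have "c z = - z"
      using assms(3) by (metis mult_cancel_right power_not_zero)
    moreover have "w z = 0"
      using \<open>w z + int n = w y\<close> True unfolding n_def by simp
    ultimately show ?thesis
      using z0 by (intro exI[of _ z]) simp
  next
    case False
    have "w (y * \<pi> ^ n) = 0"
      using dv[OF y(1), of "\<pi> ^ n"] assms wp False unfolding n_def by simp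
    then show ?thesis
      using y assms by (intro exI[of _ "y * \<pi> ^ n"]) (simp add: c cp)
  qed
qed

section \<open>The unitary group over a valued field\<close>

locale unitary3 =
  fixes w :: "'e::field \<Rightarrow> int" and c :: "'e \<Rightarrow> 'e" and p :: nat and \<pi> \<epsilon> :: 'e and m :: int
  assumes uq: "unramified_quadratic w c p"
    and c_pi [simp]: "c \<pi> = \<pi>" and pi0 [simp]: "\<pi> \<noteq> 0" and w_pi [simp]: "w \<pi> = 1"
    and eps0 [simp]: "\<epsilon> \<noteq> 0" and w_eps [simp]: "w \<epsilon> = 0" and c_eps [simp]: "c \<epsilon> = - \<epsilon>"
    and m01: "m = 0 \<or> m = 1"
begin

lemma w_mult [simp]: "x \<noteq> 0 \<Longrightarrow> y \<noteq> 0 \<Longrightarrow> w (x * y) = w x + w y"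
  and w_plus: "x \<noteq> 0 \<Longrightarrow> y \<noteq> 0 \<Longrightarrow> x + y \<noteq> 0 \<Longrightarrow> min (w x) (w y) \<le> w (x + y)"
  and c_add [simp]: "c (x + y) = c x + c y" and c_mult [simp]: "c (x * y) = c x * c y"
  and c_one [simp]: "c 1 = 1" and c_c [simp]: "c (c x) = x"
  and w_c [simp]: "w (c x) = w x"
  and p_prime: "prime p" and vge_p: "vge w (of_nat p) 1"
  and residue_finite: "finite (residue_classes w)"
proof -
  show "w (c x) = w x" for x
    using uq unfolding unramified_quadratic_def
    by (cases "x = 0") (metis add_cancel_left_left, blast)
qed (use uq in \<open>auto simp: unramified_quadratic_def nonarch_local_field_def discrete_valuation_def\<close>)

lemma c_0 [simp]: "c 0 = 0"
  using c_add[of 0 0] by (metis add.right_neutral add_cancel_left_left)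

lemma c_eq_0 [simp]: "c x = 0 \<longleftrightarrow> x = 0"
  by (metis c_0 c_c)

lemma c_minus [simp]: "c (- x) = - c x"
  using c_add[of x "- x"] by (simp add: eq_neg_iff_add_eq_0 add.commute del: c_add)

lemma c_diff [simp]: "c (x - y) = c x - c y"
  using c_add[of x "- y"] by (simp del: c_add)

lemma c_inverse [simp]: "c (inverse x) = inverse (c x)"
proof (cases "x = 0")
  case False
  then have "c x * c (inverse x) = 1"
    using c_mult[of x "inverse x"] by (simp del: c_mult)
  then show ?thesis
    by (rule inverse_unique[symmetric])
qed simp

lemma c_divide [simp]: "c (x / y) = c x / c y"
  by (simp add: divide_inverse)

lemma c_power [simp]: "c (x ^ n) = c x ^ n"
  by (induction n) simp_all

lemma w_one [simp]: "w 1 = 0"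
  using w_mult[of 1 1] by simp

lemma w_minus [simp]: "w (- x) = w x"
proof (cases "x = 0")
  case False
  have "w (- 1) + w (- 1) = 0"
    using w_mult[of "- 1" "- 1"] by simp
  then show ?thesis
    using w_mult[of "- 1" x] False by simp
qed simp

lemma w_inverse [simp]: "x \<noteq> 0 \<Longrightarrow> w (inverse x) = - w x"
  using w_mult[of x "inverse x"] by simp

lemma w_divide [simp]: "x \<noteq> 0 \<Longrightarrow> y \<noteq> 0 \<Longrightarrow> w (x / y) = w x - w y"
  by (simp add: divide_inverse)

lemma w_power [simp]: "x \<noteq> 0 \<Longrightarrow> w (x ^ n) = int n * w x"
  by (induction n) (simp_all add: algebra_simps)

abbreviation ge :: "'e \<Rightarrow> int \<Rightarrow> bool" where "ge \<equiv> vge w"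

lemma ge_0 [simp]: "ge 0 n"
  by (simp add: vge_def)

lemma ge_nz: "x \<noteq> 0 \<Longrightarrow> ge x n \<longleftrightarrow> n \<le> w x"
  by (simp add: vge_def)

lemma ge_mono: "ge x n \<Longrightarrow> k \<le> n \<Longrightarrow> ge x k"
  by (auto simp: vge_def)

lemma ge_add: "ge x n \<Longrightarrow> ge y n \<Longrightarrow> ge (x + y) n"
  using w_plus[of x y] unfolding vge_def by (cases "x = 0"; cases "y = 0"; cases "x + y = 0") auto

lemma ge_minus [simp]: "ge (- x) n \<longleftrightarrow> ge x n"
  by (simp add: vge_def)

lemma ge_diff: "ge x n \<Longrightarrow> ge y n \<Longrightarrow> ge (x - y) n"
  using ge_add[of x n "- y"] by simp

lemma ge_c [simp]: "ge (c x) n \<longleftrightarrow> ge x n"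
  by (simp add: vge_def)

lemma ge_mult: "ge x a \<Longrightarrow> ge y b \<Longrightarrow> n \<le> a + b \<Longrightarrow> ge (x * y) n"
  unfolding vge_def by (cases "x = 0"; cases "y = 0") auto

lemma ge_mult_iff: "x \<noteq> 0 \<Longrightarrow> ge (x * y) n \<longleftrightarrow> ge y (n - w x)"
  unfolding vge_def by (cases "y = 0") auto

lemma ge_divide_iff: "x \<noteq> 0 \<Longrightarrow> ge (y / x) n \<longleftrightarrow> ge y (n + w x)"
  unfolding vge_def by (cases "y = 0") auto

text \<open>The valuation of \<open>c x * x\<close> is the even number \<open>2 * w x\<close>, so an
  odd lower bound rounds up. Unitarity bounds such norms in terms of the other entries, and this
  lemma turns them into bounds on entries of the middle row and column.\<close>

lemma ge_norm:
  assumes "ge (c x * x) n" "2 * k - 1 \<le> n"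
  shows "ge x k"
  using assms unfolding vge_def by (cases "x = 0") auto

lemma ge_of_nat: "ge (of_nat n) 0"
  by (induction n) (simp_all add: ge_add ge_nz)

definition Mat :: "(3 \<Rightarrow> 3 \<Rightarrow> int) \<Rightarrow> 'e mat3 \<Rightarrow> bool" where
  "Mat e A \<longleftrightarrow> (\<forall>i j. ge (A $ i $ j) (e i j))"

lemma Mat_mono: "Mat e A \<Longrightarrow> (\<And>i j. e' i j \<le> e i j) \<Longrightarrow> Mat e' A"
  unfolding Mat_def using ge_mono by blast

lemma Mat_mult: "Mat e A \<Longrightarrow> Mat e' B \<Longrightarrow> (\<And>i j k. e'' i k \<le> e i j + e' j k) \<Longrightarrow> Mat e'' (A ** B)"
  unfolding Mat_def mult3_nth by (intro allI ge_add) (blast intro: ge_mult)+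

lemma Mat_add: "Mat e A \<Longrightarrow> Mat e B \<Longrightarrow> Mat e (A + B)"
  unfolding Mat_def by (simp add: ge_add)

lemma Mat_diff: "Mat e A \<Longrightarrow> Mat e B \<Longrightarrow> Mat e (A - B)"
  unfolding Mat_def by (simp add: ge_diff)

lemma Mat_0 [simp]: "Mat e 0"
  unfolding Mat_def by simp

lemma Mat_3: "Mat e A \<longleftrightarrow> ge (A$1$1) (e 1 1) \<and> ge (A$1$2) (e 1 2) \<and> ge (A$1$3) (e 1 3) \<and>
    ge (A$2$1) (e 2 1) \<and> ge (A$2$2) (e 2 2) \<and> ge (A$2$3) (e 2 3) \<and>
    ge (A$3$1) (e 3 1) \<and> ge (A$3$2) (e 3 2) \<and> ge (A$3$3) (e 3 3)"
  unfolding Mat_def by (simp add: forall_3)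

text \<open>The matrix \<open>beta\<close> times the conjugate transpose times \<open>beta\<close>:
  an anti-involution of all matrices that is the inverse on the group.\<close>

definition inv3 :: "'e mat3 \<Rightarrow> 'e mat3" where
  "inv3 g = (\<chi> i j. c (g $ rev3 j $ rev3 i))"

lemma inv3_nth [simp]: "inv3 g $ i $ j = c (g $ rev3 j $ rev3 i)"
  by (simp add: inv3_def)

abbreviation "G \<equiv> U21 c"

text \<open>Both conditions list the same nine equations in a different order, and a left inverse of
  a square matrix is two-sided, which yields membership in \<open>GL3\<close>.\<close>

lemma U21_iff: "g \<in> G \<longleftrightarrow> inv3 g ** g = mat 1"
proof -
  have "transpose g ** beta ** conjm c g = beta \<longleftrightarrow> inv3 g ** g = mat 1"
    unfolding mat3_eq_iff mult3_nth by (auto simp: transpose_def beta_def conjm_def algebra_simps)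
  moreover have "g \<in> GL3" if "inv3 g ** g = mat 1"
    using that matrix_left_right_inverse[of "inv3 g" g] unfolding GL3_def by blast
  ultimately show ?thesis
    unfolding U21_def by auto
qed

lemma inv3_inv3 [simp]: "inv3 (inv3 g) = g"
  by (simp add: vec_eq_iff)

lemma inv3_mult: "inv3 (g ** h) = inv3 h ** inv3 g"
  unfolding vec_eq_iff[of "inv3 (g ** h)"] vec_eq_iff[of "inv3 (g ** h) $ _"] mult3_nth inv3_nth
  by (simp add: mult3_nth algebra_simps)

lemma group_G: "group_in_monoid (**) (mat 1) inv3 G"
proof
  show "mat 1 \<in> G"
    unfolding U21_iff mat3_eq_iff mult3_nth by simp
  show "inv3 x ** x = mat 1" if "x \<in> G" for x
    using that by (simp add: U21_iff)
  then show r: "x ** inv3 x = mat 1" if "x \<in> G" for x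
    using that matrix_left_right_inverse by blast
  then show "inv3 x \<in> G" if "x \<in> G" for x
    using that unfolding U21_iff[of "inv3 x"] by simp
  show "x ** y \<in> G" if "x \<in> G" "y \<in> G" for x y
  proof -
    have "inv3 (x ** y) ** (x ** y) = inv3 y ** (inv3 x ** x) ** y"
      unfolding inv3_mult by (simp add: matrix_mul_assoc)
    then show ?thesis
      using that by (simp add: U21_iff)
  qed
qed (simp_all add: matrix_mul_assoc)

sublocale group_in_monoid "(**)" "mat 1 :: 'e mat3" inv3 G
  by (rule group_G)

lemma Mat_inv3: "Mat e g \<Longrightarrow> (\<And>i j. e' i j \<le> e (rev3 j) (rev3 i)) \<Longrightarrow> Mat e' (inv3 g)"
  unfolding Mat_def inv3_nth ge_c using ge_mono by blast

lemma columns: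
  assumes "g \<in> G"
  shows "c (g $ 3 $ rev3 i) * g $ 1 $ j + c (g $ 2 $ rev3 i) * g $ 2 $ j + c (g $ 1 $ rev3 i) * g $ 3 $ j =
     (if i = j then 1 else 0)"
  using iv_l[OF assms] by (metis (no_types) mult3_nth inv3_nth mat_one_nth rev3_simps)

lemma rows:
  assumes "g \<in> G"
  shows "g $ i $ 1 * c (g $ rev3 j $ 3) + g $ i $ 2 * c (g $ rev3 j $ 2) + g $ i $ 3 * c (g $ rev3 j $ 1) =
     (if i = j then 1 else 0)"
  using iv_r[OF assms] by (metis (no_types) mult3_nth inv3_nth mat_one_nth rev3_simps)

section \<open>Unipotent elements and Gaussian elimination\<close>

lemma diagonal_shape:
  assumes g: "g \<in> G" and z: "g$2$1 = 0" "g$3$1 = 0" "g$1$2 = 0" "g$1$3 = 0"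
  shows "g$2$3 = 0 \<and> g$3$2 = 0 \<and> c (g$3$3) * g$1$1 = 1 \<and> c (g$2$2) * g$2$2 = 1"
proof -
  have 1: "c (g$3$3) * g$1$1 = 1" "c (g$2$2) * g$2$2 = 1"
    using columns[OF g, of 1 1] columns[OF g, of 2 2] z by simp_all
  have "c (g$2$3) * g$2$2 = 0" "c (g$3$2) * g$1$1 = 0"
    using columns[OF g, of 1 2] columns[OF g, of 2 1] z by simp_all
  then show ?thesis
    using 1 by auto
qed

definition lowr :: "'e \<Rightarrow> 'e \<Rightarrow> 'e mat3" where "lowr x y = mk3 1 0 0 x 1 0 y (- c x) 1"

definition uppr :: "'e \<Rightarrow> 'e \<Rightarrow> 'e mat3" where "uppr x y = mk3 1 x y 0 1 (- c x) 0 0 1"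

lemma lowr_G: "y + c y + x * c x = 0 \<Longrightarrow> lowr x y \<in> G"
  unfolding U21_iff mat3_eq_iff mult3_nth lowr_def by (simp add: algebra_simps)

lemma uppr_G: "y + c y + x * c x = 0 \<Longrightarrow> uppr x y \<in> G"
  unfolding U21_iff mat3_eq_iff mult3_nth uppr_def by (simp add: algebra_simps)

text \<open>Elimination with pivot \<open>g$1$1\<close>. Isotropy of the first column and of the
  first row is exactly the condition for the two triangular factors to be unitary. The middle factor
  is then unitary, and its four zeros force it to be diagonal.\<close>

lemma LDU:
  assumes g: "g \<in> G" and g0: "g$1$1 \<noteq> 0"
  shows "\<exists>t\<in>G. lowr (g$2$1 / g$1$1) (g$3$1 / g$1$1) \<in> G \<and> uppr (g$1$2 / g$1$1) (g$1$3 / g$1$1) \<in> G \<and>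
    g = lowr (g$2$1 / g$1$1) (g$3$1 / g$1$1) ** t ** uppr (g$1$2 / g$1$1) (g$1$3 / g$1$1) \<and>
    t$2$1 = 0 \<and> t$3$1 = 0 \<and> t$1$2 = 0 \<and> t$1$3 = 0 \<and> t$2$3 = 0 \<and> t$3$2 = 0 \<and> t$1$1 = g$1$1 \<and>
    c (t$3$3) * t$1$1 = 1 \<and> c (t$2$2) * t$2$2 = 1"
proof -
  define x y u v where "x = g$2$1 / g$1$1" and "y = g$3$1 / g$1$1"
    and "u = g$1$2 / g$1$1" and "v = g$1$3 / g$1$1"
  have e: "g$2$1 = x * g$1$1" "g$3$1 = y * g$1$1" "g$1$2 = u * g$1$1" "g$1$3 = v * g$1$1"
    unfolding x_def y_def u_def v_def using g0 by simp_all
  have "(g$1$1 * c (g$1$1)) * (y + c y + x * c x) = 0" "(g$1$1 * c (g$1$1)) * (v + c v + u * c u) = 0"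
    using columns[OF g, of 3 1] rows[OF g, of 1 3] unfolding e by (simp_all add: e algebra_simps)
  then have xy: "y + c y + x * c x = 0" and uv: "v + c v + u * c u = 0"
    using g0 by simp_all
  have L: "lowr x y \<in> G" and R: "uppr u v \<in> G"
    using lowr_G[OF xy] uppr_G[OF uv] .
  define t where "t = inv3 (lowr x y) ** g ** inv3 (uppr u v)"
  have tG: "t \<in> G"
    unfolding t_def using L R g by simp
  have cy: "c y = - y - x * c x" and cv: "c v = - v - u * c u"
    using xy uv by (simp_all add: algebra_simps eq_neg_iff_add_eq_0)
  have z: "t$2$1 = 0" "t$3$1 = 0" "t$1$2 = 0" "t$1$3 = 0" "t$1$1 = g$1$1"
    unfolding t_def mult3_nth by (simp_all add: lowr_def uppr_def e cy cv algebra_simps)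
  have "g = lowr x y ** t ** uppr u v"
    unfolding t_def using L R g by simp
  then show ?thesis
    using diagonal_shape[OF tG z(1-4)] tG L R z unfolding x_def y_def u_def v_def by blast
qed

end

lemma mult_diff_left: "A ** (B - C) = A ** B - A ** (C :: 'a::ring_1^'n^'k)"
  by (simp add: vec_eq_iff matrix_matrix_mult_def right_diff_distrib sum_subtractf)

lemma mult_diff_right: "(A - B) ** C = A ** C - B ** (C :: 'a::ring_1^'n^'k)"
  by (simp add: vec_eq_iff matrix_matrix_mult_def left_diff_distrib sum_subtractf)

context unitary3
begin

section \<open>Congruence subgroups\<close>

definition Cong :: "(3 \<Rightarrow> 3 \<Rightarrow> int) \<Rightarrow> 'e mat3 set" where
  "Cong e = {g \<in> G. Mat e (g - mat 1)}"

lemma Mat_one: "(\<And>i. e i i \<le> 0) \<Longrightarrow> Mat e (mat 1)"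
  unfolding Mat_def by (auto simp: ge_nz)

lemma Cong_Mat: "g \<in> Cong e \<Longrightarrow> (\<And>i j. e' i j \<le> e i j) \<Longrightarrow> (\<And>i. e' i i \<le> 0) \<Longrightarrow> Mat e' g"
  using Mat_add[of e' "g - mat 1" "mat 1"] Mat_mono[of e "g - mat 1" e'] Mat_one[of e']
  unfolding Cong_def by simp

lemma Cong_G: "g \<in> Cong e \<Longrightarrow> g \<in> G"
  unfolding Cong_def by simp

lemma Cong_mono: "g \<in> Cong e \<Longrightarrow> (\<And>i j. e' i j \<le> e i j) \<Longrightarrow> g \<in> Cong e'"
  unfolding Cong_def using Mat_mono by blast

lemma Cong_subgr:
  assumes tri: "\<And>i j k. e i k \<le> e i j + e j k" and rev: "\<And>i j. e (rev3 j) (rev3 i) = e i j"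
  shows "subgr (Cong e)"
  unfolding subgr_def
proof (intro conjI ballI)
  show "Cong e \<subseteq> G" "mat 1 \<in> Cong e"
    unfolding Cong_def by auto
  fix x assume x: "x \<in> Cong e"
  have "inv3 x - mat 1 = inv3 (x - mat 1)"
    unfolding mat3_eq_iff by simp
  then show "inv3 x \<in> Cong e"
    using x Mat_inv3[of e "x - mat 1" e] rev unfolding Cong_def by simp
  fix y assume y: "y \<in> Cong e"
  have "x ** y - mat 1 = (x - mat 1) ** (y - mat 1) + ((x - mat 1) + (y - mat 1))"
    by (simp add: mult_diff_left mult_diff_right)
  moreover have "Mat e ((x - mat 1) ** (y - mat 1))"
    by (rule Mat_mult[of e _ e]) (use x y tri in \<open>auto simp: Cong_def\<close>)
  ultimately have "Mat e (x ** y - mat 1)"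
    using x y Mat_add unfolding Cong_def by (metis (no_types, lifting) mem_Collect_eq)
  then show "x ** y \<in> Cong e"
    using x y unfolding Cong_def by simp
qed

lemma finite_residues: "\<exists>R. finite R \<and> (\<forall>x. ge x 0 \<longrightarrow> (\<exists>y\<in>R. ge (x - y) 1))"
proof (intro exI conjI allI impI)
  show "finite ((\<lambda>C. SOME y. y \<in> C) ` residue_classes w)"
    using residue_finite by simp
  fix x assume x: "ge x 0"
  let ?C = "{y \<in> val_ring w. ge (x - y) 1}"
  have C: "?C \<in> residue_classes w"
    using x unfolding residue_classes_def val_ring_def by blast
  have "x \<in> ?C"
    using x unfolding val_ring_def by simp
  then have "(SOME y. y \<in> ?C) \<in> ?C"
    by (rule someI)
  then show "\<exists>y\<in>(\<lambda>C. SOME y. y \<in> C) ` residue_classes w. ge (x - y) 1"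
    using C by blast
qed

text \<open>Successive approximation: the error, divided by an element of valuation
  \<open>a + int n\<close>, is integral and supplies the next residue digit.\<close>

lemma finite_mod: "\<exists>R. finite R \<and> (\<forall>x. ge x a \<longrightarrow> (\<exists>y\<in>R. ge (x - y) (a + int n)))"
proof (induction n)
  case 0
  then show ?case
    by (intro exI[of _ "{0}"]) simp
next
  case (Suc n)
  then obtain R where R: "finite R" "\<And>x. ge x a \<Longrightarrow> \<exists>y\<in>R. ge (x - y) (a + int n)"
    by blast
  obtain R1 where R1: "finite R1" "\<And>x. ge x 0 \<Longrightarrow> \<exists>y\<in>R1. ge (x - y) 1"
    using finite_residues by blast
  obtain b where b: "b \<noteq> 0" "w b = a + int n"
    using uq unfolding unramified_quadratic_def nonarch_local_field_def discrete_valuation_def by blast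
  show ?case
  proof (intro exI[of _ "(\<lambda>(y, r). y + b * r) ` (R \<times> R1)"] conjI allI impI)
    fix x assume "ge x a"
    then obtain y where y: "y \<in> R" "ge (x - y) (a + int n)"
      using R by blast
    then have "ge ((x - y) / b) 0"
      using b by (simp add: ge_divide_iff)
    then obtain r where r: "r \<in> R1" "ge ((x - y) / b - r) 1"
      using R1 by blast
    have "x - (y + b * r) = b * ((x - y) / b - r)"
      using b by (simp add: right_diff_distrib diff_divide_distrib)
    then have "ge (x - (y + b * r)) (a + int (Suc n))"
      using r b by (simp add: ge_mult_iff)
    then show "\<exists>y\<in>(\<lambda>(y, r). y + b * r) ` (R \<times> R1). ge (x - y) (a + int (Suc n))"
      using y r by force
  qed (use R R1 in auto)
qed

text \<open>Finitely many matrices approximate all members of \<open>A\<close> up to valuation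
  \<open>N + 1\<close>, and two members with the same approximation agree modulo the congruence
  subgroup of level \<open>N\<close>. The extra unit of precision pays for the entries of
  \<open>inv3 h\<close>, whose valuation may be -1.\<close>

lemma cofinite_Cong:
  assumes A: "A \<subseteq> G" "\<And>g. g \<in> A \<Longrightarrow> Mat (\<lambda>_ _. - 1) g" and H: "Cong (\<lambda>_ _. int N) \<subseteq> H"
  shows "cofinite_in H A"
proof -
  obtain R where R: "finite R" "\<And>x. ge x (- 1) \<Longrightarrow> \<exists>y\<in>R. ge (x - y) (- 1 + int (N + 2))"
    using finite_mod by blast
  let ?FS = "(UNIV \<rightarrow>\<^sub>E (UNIV \<rightarrow>\<^sub>E R)) :: (3 \<Rightarrow> 3 \<Rightarrow> 'e) set"
  define rel where "rel g f \<longleftrightarrow> (\<forall>i j. ge (g $ i $ j - f i j) (int N + 1))" for g :: "'e mat3" and f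
  have fin: "finite ?FS"
    using R(1) by (intro finite_PiE) auto
  have ex: "\<exists>f\<in>?FS. rel g f" if g: "g \<in> A" for g
  proof -
    have "\<forall>i j. \<exists>y\<in>R. ge (g $ i $ j - y) (int N + 1)"
      using R(2) A(2)[OF g] unfolding Mat_def by (simp add: add.commute)
    then obtain f where f: "\<And>i j. f i j \<in> R \<and> ge (g $ i $ j - f i j) (int N + 1)"
      unfolding Bex_def choice_iff by blast
    then have "f \<in> ?FS"
      by (auto simp: PiE_def extensional_def)
    then show ?thesis
      using f unfolding rel_def by blast
  qed
  define S where "S = (\<lambda>f. SOME g. g \<in> A \<and> rel g f) ` {f \<in> ?FS. \<exists>g\<in>A. rel g f}"
  have S: "(SOME g. g \<in> A \<and> rel g f) \<in> A \<and> rel (SOME g. g \<in> A \<and> rel g f) f" if "\<exists>g\<in>A. rel g f" for f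
    by (rule someI_ex[OF that[unfolded Bex_def]])
  show ?thesis
    unfolding cofinite_in_def
  proof (intro exI[of _ S] conjI ballI)
    show "finite S"
      unfolding S_def using fin by simp
    show "S \<subseteq> A"
      unfolding S_def using S by blast
    fix g assume g: "g \<in> A"
    then obtain f where f: "f \<in> ?FS" "rel g f"
      using ex[OF g] by (elim bexE)
    define h where "h = (SOME g. g \<in> A \<and> rel g f)"
    have gf: "\<exists>g\<in>A. rel g f"
      by (rule bexI[of _ g]) (fact f(2) g)+
    have h: "h \<in> A" "rel h f"
      using S[OF gf] unfolding h_def by auto
    have "h \<in> S"
      unfolding S_def h_def by (rule imageI) (use f(1) gf in simp)
    have gh: "Mat (\<lambda>_ _. int N + 1) (g - h)"
      unfolding Mat_def
    proof (intro allI)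
      fix i j
      have "(g - h) $ i $ j = (g $ i $ j - f i j) - (h $ i $ j - f i j)"
        by simp
      then show "ge ((g - h) $ i $ j) (int N + 1)"
        using f(2) h(2) ge_diff unfolding rel_def by metis
    qed
    have "Mat (\<lambda>_ _. - 1) (inv3 h)"
      by (rule Mat_inv3[OF A(2)[OF h(1)]]) simp
    then have "Mat (\<lambda>_ _. int N) (inv3 h ** (g - h))"
      by (rule Mat_mult[OF _ gh]) simp
    moreover have hG: "h \<in> G" "g \<in> G"
      using h A g by auto
    moreover have "inv3 h ** g - mat 1 = inv3 h ** (g - h)"
      using hG by (simp add: mult_diff_left)
    ultimately have "inv3 h ** g \<in> Cong (\<lambda>_ _. int N)"
      unfolding Cong_def by simp
    then show "\<exists>s\<in>S. inv3 s ** g \<in> H"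
      using H h \<open>h \<in> S\<close> by blast
  qed
qed

section \<open>The maximal compact subgroup and its Iwahori filtration\<close>

definition eK :: "3 \<Rightarrow> 3 \<Rightarrow> int" where "eK = tab 0 0 (- m) m 0 0 m m 0"

text \<open>The kernel of reduction to the reductive quotient. For \<open>m = 0\<close> this is
  reduction of all entries modulo the maximal ideal; for \<open>m = 1\<close> only the diagonal and
  the entries (1,3) and (3,1) survive, the other bounds agreeing with \<open>eK\<close>.\<close>

definition eQ :: "3 \<Rightarrow> 3 \<Rightarrow> int" where "eQ = tab 1 (1 - m) (1 - m) 1 1 (1 - m) (1 + m) 1 1"

definition idx :: "3 \<Rightarrow> int" where "idx i = (if i = 1 then 1 else if i = 2 then 2 else 3)"

definition ht :: "3 \<Rightarrow> 3 \<Rightarrow> int" where "ht i j = (2 * m - 1) * (idx j - idx i)"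

text \<open>The elements x of p^(eP r i j) are those with 3 w(x) + ht i j \<ge> r: this is the
  Moy-Prasad filtration at the barycentre of an alcove.\<close>

definition eP :: "int \<Rightarrow> 3 \<Rightarrow> 3 \<Rightarrow> int" where "eP r i j = - ((ht i j - r) div 3)"

lemma idx_simps [simp]: "idx 1 = 1" "idx 2 = 2" "idx 3 = 3"
  by (simp_all add: idx_def)

lemma ht_add: "ht i k = ht i j + ht j k"
  unfolding ht_def by (simp add: algebra_simps)

lemma ht_rev: "ht (rev3 j) (rev3 i) = ht i j"
  using exhaust_3[of i] exhaust_3[of j] unfolding ht_def by auto

lemma eP_add: "eP (r + r') i k \<le> eP r i j + eP r' j k"
  unfolding eP_def ht_add[of i k j] by presburger

lemma eP_mono: "r \<le> r' \<Longrightarrow> eP r i j \<le> eP r' i j"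
  unfolding eP_def by presburger

lemma eP_3: "eP (r + 3) i j = eP r i j + 1"
  unfolding eP_def by presburger

lemma eP_rev: "eP r (rev3 j) (rev3 i) = eP r i j"
  unfolding eP_def ht_rev ..

lemma eK_tri: "eK i k \<le> eK i j + eK j k"
  using m01 exhaust_3[of i] exhaust_3[of j] exhaust_3[of k] unfolding eK_def by auto

lemma eK_rev: "eK (rev3 j) (rev3 i) = eK i j"
  using exhaust_3[of i] exhaust_3[of j] unfolding eK_def by auto

text \<open>Matrices bounded by \<open>eQ\<close> form a two-sided ideal of the order given by
  \<open>eK\<close>, which is why \<open>Q\<close> is normalized by \<open>K\<close>.\<close>

lemma eQ_ideal: "eQ i k \<le> eK i j + eQ j k" "eQ i k \<le> eQ i j + eK j k"
  using m01 exhaust_3[of i] exhaust_3[of j] exhaust_3[of k] unfolding eK_def eQ_def by auto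

lemma eQ_rev: "eQ (rev3 j) (rev3 i) = eQ i j"
  using exhaust_3[of i] exhaust_3[of j] unfolding eQ_def by auto

lemma eK_le_eQ: "eK i j \<le> eQ i j"
  using m01 exhaust_3[of i] exhaust_3[of j] unfolding eK_def eQ_def by auto

lemma eK_le_eP: "0 \<le> r \<Longrightarrow> eK i j \<le> eP r i j"
proof -
  assume "0 \<le> r"
  then have "eP 0 i j \<le> eP r i j"
    by (rule eP_mono)
  moreover have "eK i j \<le> eP 0 i j"
    using m01 exhaust_3[of i] exhaust_3[of j] unfolding eK_def eP_def ht_def by auto
  ultimately show ?thesis
    by simp
qed

lemma eP_1_le_eQ: "eP 1 i j \<le> eQ i j"
  using m01 exhaust_3[of i] exhaust_3[of j] unfolding eQ_def eP_def ht_def by auto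

lemma eK_bounds: "- 1 \<le> eK i j" "eK i j \<le> 1" "eK i i = 0" "eQ i j \<le> 2"
  using m01 exhaust_3[of i] exhaust_3[of j] unfolding eK_def eQ_def by auto

lemma eP_0_diag: "eP 0 i i = 0"
  unfolding eP_def ht_def by simp

definition K :: "'e mat3 set" where "K = {g \<in> G. Mat eK g}"

lemma Km_sub: "subgr K"
  unfolding subgr_def
proof (intro conjI ballI)
  show "K \<subseteq> G" "mat 1 \<in> K"
    unfolding K_def by (auto intro!: Mat_one simp: eK_bounds)
  show "x ** y \<in> K" if "x \<in> K" "y \<in> K" for x y
    using that Mat_mult[of eK x eK y eK] eK_tri unfolding K_def by simp
  show "inv3 x \<in> K" if "x \<in> K" for x
    using that Mat_inv3[of eK x eK] eK_rev unfolding K_def by simp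
qed

text \<open>Level 0 of \<open>eP\<close> is the Iwahori order; the shift by one starts the
  filtration at a group containing both \<open>U\<close> and \<open>Q\<close>.\<close>

definition P :: "nat \<Rightarrow> 'e mat3 set" where "P r = Cong (eP (int r + 1))"

definition Q :: "'e mat3 set" where "Q = Cong eQ"

text \<open>The Iwahori subgroup U T Q is lower triangular modulo p for m = 0 and upper triangular for
  m = 1.\<close>

definition U :: "'e mat3 set" where
  "U = {g \<in> K. g$1$1 = 1 \<and> g$2$2 = 1 \<and> g$3$3 = 1 \<and> g$1$2 = 0 \<and> g$1$3 = 0 \<and> g$2$3 = 0}"

definition T :: "'e mat3 set" where
  "T = {g \<in> K. g$1$2 = 0 \<and> g$1$3 = 0 \<and> g$2$3 = 0 \<and> g$2$1 = 0 \<and> g$3$1 = 0 \<and> g$3$2 = 0}"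

lemma KG: "g \<in> K \<Longrightarrow> g \<in> G"
  unfolding K_def by simp

lemmas Km = subgrD(3)[OF Km_sub] subgrD(4)[OF Km_sub]

lemma U_subK: "U \<subseteq> K" and T_subK: "T \<subseteq> K"
  unfolding U_def T_def by auto

lemma Um_sub: "subgr U"
  unfolding subgr_def
proof (intro conjI ballI)
  show "U \<subseteq> G" "mat 1 \<in> U"
    using subgrD(2)[OF Km_sub] KG unfolding U_def by auto
  show "x ** y \<in> U" if "x \<in> U" "y \<in> U" for x y
    using that Km unfolding U_def by (simp add: mult3_nth)
  show "inv3 x \<in> U" if "x \<in> U" for x
    using that Km unfolding U_def by simp
qed

lemma Tm_sub: "subgr T"
  unfolding subgr_def
proof (intro conjI ballI)
  show "T \<subseteq> G" "mat 1 \<in> T"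
    using subgrD(2)[OF Km_sub] KG unfolding T_def by auto
  show "x ** y \<in> T" if "x \<in> T" "y \<in> T" for x y
    using that Km unfolding T_def by (simp add: mult3_nth)
  show "inv3 x \<in> T" if "x \<in> T" for x
    using that Km unfolding T_def by simp
qed

lemma Qm_sub: "subgr Q"
  unfolding Q_def
proof (rule Cong_subgr)
  show "eQ i k \<le> eQ i j + eQ j k" for i j k
    using eQ_ideal(1)[of i k j] eK_le_eQ[of i j] by simp
qed (rule eQ_rev)

lemma Q_subK: "Q \<subseteq> K"
proof
  fix g assume g: "g \<in> Q"
  then have "Mat eK g"
    unfolding Q_def by (rule Cong_Mat) (simp_all add: eK_le_eQ eK_bounds)
  then show "g \<in> K"
    using g Cong_G unfolding Q_def K_def by blast
qed

lemma Qm_norm: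
  assumes k: "k \<in> K" and q: "q \<in> Q"
  shows "k ** q ** inv3 k \<in> Q"
proof -
  have kG: "k \<in> G" "q \<in> G"
    using k q KG Q_subK by auto
  have "Mat eQ (k ** (q - mat 1))"
    by (rule Mat_mult[of eK _ eQ]) (use k q eQ_ideal in \<open>auto simp: K_def Q_def Cong_def\<close>)
  then have "Mat eQ (k ** (q - mat 1) ** inv3 k)"
    by (rule Mat_mult[of eQ _ eK]) (use Km(2)[OF k] eQ_ideal in \<open>auto simp: K_def\<close>)
  moreover have "k ** (q - mat 1) ** inv3 k = k ** q ** inv3 k - mat 1"
    using kG by (simp add: mult_diff_left mult_diff_right)
  ultimately show ?thesis
    using kG unfolding Q_def Cong_def by simp
qed

lemma Pm_sub: "subgr (P r)"
  unfolding P_def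
proof (rule Cong_subgr)
  show "eP (int r + 1) i k \<le> eP (int r + 1) i j + eP (int r + 1) j k" for i j k
    using eP_add[of "int r + 1" "int r + 1" i k j] eP_mono[of "int r + 1" "int r + 1 + (int r + 1)" i k]
    by simp
qed (rule eP_rev)

lemma P_subK: "P r \<subseteq> K"
proof
  fix g assume g: "g \<in> P r"
  then have "Mat eK g"
    unfolding P_def by (rule Cong_Mat) (simp_all add: eK_le_eP eK_bounds)
  then show "g \<in> K"
    using g Cong_G unfolding P_def K_def by blast
qed

lemma Q_subP: "Q \<subseteq> P 0"
  unfolding Q_def P_def using Cong_mono eP_1_le_eQ by auto

lemma U_subP: "U \<subseteq> P 0"
proof
  fix u assume u: "u \<in> U"
  then have "Mat (eP 1) (u - mat 1)"
    using m01 unfolding U_def K_def Mat_3 eK_def eP_def ht_def by (auto elim: ge_mono)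
  then show "u \<in> P 0"
    using u U_subK KG unfolding P_def Cong_def by auto
qed

lemma eP_0_Mat: "g \<in> P r \<Longrightarrow> Mat (eP 0) g"
  unfolding P_def by (erule Cong_Mat) (simp_all add: eP_mono eP_0_diag)

lemma T_Mat: "t \<in> T \<Longrightarrow> Mat (eP 0) t"
  unfolding T_def K_def Mat_3 eK_def eP_def ht_def by simp

text \<open>For \<open>g = 1 + X\<close> and \<open>h = 1 + Y\<close> the commutator differs from 1
  by an integral factor times \<open>X ** Y - Y ** X\<close>, of level \<open>2 * (r + 1)\<close>.
  The \<open>n\<close>-th power of \<open>g\<close> is \<open>1 + n X\<close> up to level
  \<open>r + 2\<close>, and for \<open>n = p\<close> the linear term gains three levels.\<close>

lemma filtration: "pro_p_filtration (**) (mat 1) inv3 G K P T p"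
proof
  show "subgr K" "subgr (P r)" "P r \<subseteq> K" "subgr T" "T \<subseteq> K" "prime p" for r
    by (fact Km_sub Pm_sub P_subK Tm_sub T_subK p_prime)+
  show "P (Suc r) \<subseteq> P r" for r
    unfolding P_def using Cong_mono[of _ "eP (int (Suc r) + 1)" "eP (int r + 1)"] eP_mono by auto
  fix r
  have dbl: "eP (int (Suc r) + 1) i j \<le> eP ((int r + 1) + (int r + 1)) i j" for i j
    by (rule eP_mono) simp
  show "\<exists>z\<in>P (Suc r). g ** h = h ** g ** z" if g: "g \<in> P r" and h: "h \<in> P r" for g h
  proof
    have G: "g \<in> G" "h \<in> G"
      using g h P_subK KG by auto
    let ?X = "g - mat 1" and ?Y = "h - mat 1" and ?z = "inv3 (h ** g) ** (g ** h)"
    have XY: "Mat (eP (int r + 1)) ?X" "Mat (eP (int r + 1)) ?Y"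
      using g h unfolding P_def Cong_def by auto
    have "Mat (eP ((int r + 1) + (int r + 1))) (?X ** ?Y - ?Y ** ?X)"
      by (intro Mat_diff Mat_mult[OF XY] Mat_mult[OF XY(2,1)] eP_add)
    then have "Mat (eP (0 + ((int r + 1) + (int r + 1)))) (inv3 (h ** g) ** (?X ** ?Y - ?Y ** ?X))"
      by (rule Mat_mult[OF eP_0_Mat[OF subgrD(4)[OF Pm_sub subgrD(3)[OF Pm_sub h g]]] _ eP_add])
    moreover have "?X ** ?Y - ?Y ** ?X = g ** h - h ** g"
      by (simp add: mult_diff_left mult_diff_right)
    moreover have "inv3 (h ** g) ** (g ** h - h ** g) = ?z - mat 1"
      unfolding mult_diff_left using iv_l[OF G_mul[OF G(2,1)]] by simp
    ultimately have "Mat (eP ((int r + 1) + (int r + 1))) (?z - mat 1)"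
      by simp
    then have "Mat (eP (int (Suc r) + 1)) (?z - mat 1)"
      using Mat_mono dbl by blast
    then show "?z \<in> P (Suc r)"
      using G unfolding P_def Cong_def by simp
    show "g ** h = h ** g ** ?z"
      using iv_r'[OF G_mul[OF G(2,1)], of "g ** h"] by simp
  qed
  show "gpow g p \<in> P (Suc r)" if g: "g \<in> P r" for g
  proof -
    have G: "g \<in> G"
      using g P_subK KG by auto
    let ?X = "g - mat 1"
    have X: "Mat (eP (int r + 1)) ?X"
      using g unfolding P_def Cong_def by auto
    define sX where "sX n = (\<chi> i j. of_nat n * ?X $ i $ j)" for n
    have sX: "Mat (eP (int r + 1)) (sX n)" for n
      unfolding Mat_def sX_def vec_lambda_beta
      by (intro allI, rule ge_mult[OF ge_of_nat]) (use X in \<open>auto simp only: Mat_def\<close>)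
    have pw: "\<exists>Y. Mat (eP (int (Suc r) + 1)) Y \<and> gpow g n = mat 1 + sX n + Y" for n
    proof (induction n)
      case 0
      have "sX 0 = 0"
        unfolding sX_def by (simp add: vec_eq_iff)
      then show ?case
        by (intro exI[of _ 0]) simp
    next
      case (Suc n)
      then obtain Y where Y: "Mat (eP (int (Suc r) + 1)) Y" "gpow g n = mat 1 + sX n + Y"
        by blast
      have "sX (Suc n) = sX n + ?X"
        unfolding sX_def by (simp add: vec_eq_iff algebra_simps)
      moreover have "gpow g (Suc n) = (mat 1 + ?X) ** (mat 1 + sX n + Y)"
        unfolding gpow.simps Y(2) by simp
      ultimately have "gpow g (Suc n) = mat 1 + sX (Suc n) + (?X ** sX n + Y + ?X ** Y)"
        by (simp add: matrix_add_ldistrib mult_diff_left mult_diff_right)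
      moreover have "Mat (eP (int (Suc r) + 1)) (?X ** sX n)"
        by (rule Mat_mono[OF Mat_mult[OF X sX eP_add] dbl])
      moreover have "Mat (eP (int (Suc r) + 1)) (?X ** Y)"
        by (rule Mat_mono[OF Mat_mult[OF X Y(1) eP_add] eP_mono]) simp
      ultimately show ?case
        using Y(1) by (intro exI[of _ "?X ** sX n + Y + ?X ** Y"]) (auto intro!: Mat_add)
    qed
    then obtain Y where Y: "Mat (eP (int (Suc r) + 1)) Y" "gpow g p = mat 1 + sX p + Y"
      by blast
    have "Mat (eP (int r + 1 + 3)) (sX p)"
      unfolding Mat_def sX_def vec_lambda_beta eP_3
      by (intro allI, rule ge_mult[OF vge_p]) (use X in \<open>auto simp only: Mat_def\<close>)
    then have "Mat (eP (int (Suc r) + 1)) (sX p)"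
      by (rule Mat_mono) (rule eP_mono, simp)
    then have "Mat (eP (int (Suc r) + 1)) (gpow g p - mat 1)"
      using Y by (simp add: Mat_add)
    then show ?thesis
      using G unfolding P_def Cong_def by simp
  qed
  \<comment> \<open>A crude bound suffices: \<open>ht\<close> is at least -2, so level
    \<open>r + 1\<close> asks of each entry no more than valuation \<open>r + 2\<close>.\<close>
  have sub: "Cong (\<lambda>_ _. int (r + 2)) \<subseteq> P r" for r
  proof
    fix g assume "g \<in> Cong (\<lambda>_ _. int (r + 2))"
    then show "g \<in> P r"
      unfolding P_def
    proof (rule Cong_mono)
      show "eP (int r + 1) i j \<le> int (r + 2)" for i j
      proof -
        have "- 2 \<le> ht i j"
          using m01 exhaust_3[of i] exhaust_3[of j] unfolding ht_def by auto
        then show ?thesis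
          unfolding eP_def by presburger
      qed
    qed
  qed
  have Km1: "Mat (\<lambda>_ _. - 1) g" if "g \<in> K" for g
    using that Mat_mono[of eK g "\<lambda>_ _. - 1"] eK_bounds unfolding K_def by simp
  show "cofinite_in (P (Suc r)) (P r)"
    by (rule cofinite_Cong[OF _ _ sub]) (use P_subK KG Km1 in auto)
  show "cofinite_in (P 0) T"
    by (rule cofinite_Cong[OF _ _ sub]) (use T_subK KG Km1 in auto)
  show "t ** t' = t' ** t" if "t \<in> T" "t' \<in> T" for t t'
    using that unfolding T_def mat3_eq_iff mult3_nth by simp
  show "inv3 t ** h ** t \<in> P 0" if t: "t \<in> T" and h: "h \<in> P 0" for t h
  proof -
    have G: "t \<in> G" "h \<in> G"
      using t h T_subK P_subK KG by auto
    have "Mat (eP (0 + 1)) (inv3 t ** (h - mat 1))"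
      by (rule Mat_mult[OF T_Mat[OF subgrD(4)[OF Tm_sub t]] _ eP_add])
        (use h in \<open>simp add: P_def Cong_def\<close>)
    then have "Mat (eP (0 + 1 + 0)) (inv3 t ** (h - mat 1) ** t)"
      by (rule Mat_mult[OF _ T_Mat[OF t] eP_add])
    moreover have "inv3 t ** (h - mat 1) ** t = inv3 t ** h ** t - mat 1"
      using G by (simp add: mult_diff_left mult_diff_right)
    ultimately show ?thesis
      using G unfolding P_def Cong_def by simp
  qed
qed


section \<open>The Cartan and Bruhat decompositions\<close>

definition vp :: 'e where "vp = (if m = 0 then 1 else \<pi>)"

lemma vp [simp]: "vp \<noteq> 0" "w vp = m" "c vp = vp"
  using m01 unfolding vp_def by auto

text \<open>A representative of the reflection, scaled by an element of valuation \<open>m\<close>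
  so that it lies in \<open>K\<close> for both values of \<open>m\<close>.\<close>

definition sw :: "'e mat3" where "sw = mk3 0 0 (inverse vp) 0 1 0 vp 0 0"

definition al :: "'e mat3" where "al = mk3 \<pi> 0 0 0 1 0 0 0 (inverse \<pi>)"

lemma inv3_sw: "inv3 sw = sw" and sw_sw: "sw ** sw = mat 1" and sw_G: "sw \<in> G"
proof -
  show 1: "inv3 sw = sw"
    unfolding mat3_eq_iff sw_def by simp
  show 2: "sw ** sw = mat 1"
    unfolding mat3_eq_iff mult3_nth sw_def by simp
  show "sw \<in> G"
    unfolding U21_iff 1 2 ..
qed

lemma sw_K: "sw \<in> K"
  unfolding K_def Mat_3 eK_def using sw_G by (simp add: sw_def ge_nz)

lemma al_G: "al \<in> G"
  unfolding U21_iff mat3_eq_iff mult3_nth by (simp add: al_def)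

lemma sw_conj: "sw ** g ** sw = mk3 (g$3$3) (g$3$2 / vp) (g$3$1 / vp / vp) (g$2$3 * vp) (g$2$2) (g$2$1 / vp)
    (g$1$3 * vp * vp) (g$1$2 * vp) (g$1$1)"
  unfolding mat3_eq_iff mult3_nth by (simp add: sw_def field_simps)

lemma al_conj: "al ** g ** inv3 al = mk3 (g$1$1) (\<pi> * g$1$2) (\<pi> * (\<pi> * g$1$3)) (g$2$1 / \<pi>) (g$2$2) (\<pi> * g$2$3)
    (g$3$1 / \<pi> / \<pi>) (g$3$2 / \<pi>) (g$3$3)"
  unfolding mat3_eq_iff mult3_nth by (simp add: al_def field_simps)

lemma al_conj': "inv3 al ** g ** al = mk3 (g$1$1) (g$1$2 / \<pi>) (g$1$3 / \<pi> / \<pi>) (\<pi> * g$2$1) (g$2$2) (g$2$3 / \<pi>)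
    (\<pi> * (\<pi> * g$3$1)) (\<pi> * g$3$2) (g$3$3)"
  unfolding mat3_eq_iff mult3_nth by (simp add: al_def field_simps)

lemma gpow_al: "gpow al n = mk3 (\<pi> ^ n) 0 0 0 1 0 0 0 (inverse (\<pi> ^ n))"
proof (induction n)
  case (Suc n)
  show ?case
    unfolding gpow.simps Suc mat3_eq_iff mult3_nth by (simp add: al_def)
qed (simp add: mat3_eq_iff)

lemma K_iff: "g \<in> K \<longleftrightarrow> g \<in> G \<and> ge (g$1$1) 0 \<and> ge (g$1$2) 0 \<and> ge (g$1$3) (- m) \<and>
    ge (g$2$1) m \<and> ge (g$2$2) 0 \<and> ge (g$2$3) 0 \<and> ge (g$3$1) m \<and> ge (g$3$2) m \<and> ge (g$3$3) 0"
  unfolding K_def Mat_3 eK_def by simp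

lemma lowr_U:
  assumes "lowr x y \<in> G" "ge x m" "ge y m"
  shows "lowr x y \<in> U"
  using assms unfolding U_def by (simp add: K_iff lowr_def ge_nz)

lemma uppr_K:
  assumes "uppr x y \<in> G" "ge x 0" "ge y (- m)"
  shows "uppr x y \<in> K"
  using assms by (simp add: K_iff uppr_def ge_nz)

lemma sw_uppr_sw:
  assumes "uppr x y \<in> K"
  shows "sw ** uppr x y ** sw \<in> U"
proof -
  have "sw ** uppr x y ** sw \<in> K"
    using assms sw_K Km(1) by blast
  then show ?thesis
    unfolding U_def sw_conj uppr_def by simp
qed

section \<open>Balls around the base vertex\<close>

lemma ball_ge: "g \<in> G \<Longrightarrow> \<exists>n. Mat (\<lambda>i j. eK i j - int n) g"
proof -
  define n where "n = Max (range (\<lambda>(i, j). nat (eK i j - w (g $ i $ j))))"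
  have "nat (eK i j - w (g $ i $ j)) \<le> n" for i j
    unfolding n_def by (rule Max_ge) auto
  then have "eK i j - int n \<le> w (g $ i $ j)" for i j
    by (metis diff_le_eq nat_le_iff add.commute)
  then show ?thesis
    unfolding Mat_def vge_def by blast
qed

text \<open>Measuring distance by the worst denominator relative to \<open>eK\<close> turns
  invariance under \<open>K\<close> on both sides into the triangle inequality for
  \<open>eK\<close>.\<close>

definition bl :: "nat \<Rightarrow> 'e mat3 set" where "bl n = {g \<in> G. Mat (\<lambda>i j. eK i j - int n) g}"

lemma bl_0: "bl 0 = K"
  unfolding bl_def K_def by simp

lemma bl_l:
  assumes "k \<in> K" "g \<in> bl n"
  shows "k ** g \<in> bl n"
proof -
  have "eK i j - int n \<le> eK i l + (eK l j - int n)" for i j l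
    using eK_tri[of i j l] by simp
  then have "Mat (\<lambda>i j. eK i j - int n) (k ** g)"
    by (rule Mat_mult[rotated 2]) (use assms in \<open>auto simp: bl_def K_def\<close>)
  then show ?thesis
    using assms unfolding bl_def K_def by simp
qed

lemma bl_r:
  assumes "k \<in> K" "g \<in> bl n"
  shows "g ** k \<in> bl n"
proof -
  have "eK i j - int n \<le> (eK i l - int n) + eK l j" for i j l
    using eK_tri[of i j l] by simp
  then have "Mat (\<lambda>i j. eK i j - int n) (g ** k)"
    by (rule Mat_mult[rotated 2]) (use assms in \<open>auto simp: bl_def K_def\<close>)
  then show ?thesis
    using assms unfolding bl_def K_def by simp
qed

lemma bl_al:
  assumes g: "g \<in> bl n"
  shows "al ** g \<in> bl (Suc n)" "inv3 al ** g \<in> bl (Suc n)"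
proof -
  have a: "Mat (\<lambda>i j. eK i j - 1) al" "Mat (\<lambda>i j. eK i j - 1) (inv3 al)"
    unfolding Mat_3 eK_def by (simp_all add: al_def ge_nz)
  have "Mat (\<lambda>i j. eK i j - int (Suc n)) (x ** g)" if "Mat (\<lambda>i j. eK i j - 1) x" for x
  proof (rule Mat_mult[OF that])
    show "Mat (\<lambda>i j. eK i j - int n) g"
      using g unfolding bl_def by simp
    show "eK i k - int (Suc n) \<le> eK i j - 1 + (eK j k - int n)" for i j k
      using eK_tri[of i k j] by simp
  qed
  then show "al ** g \<in> bl (Suc n)" "inv3 al ** g \<in> bl (Suc n)"
    using a g al_G unfolding bl_def by simp_all
qed

section \<open>The Bruhat decomposition of the maximal compact subgroup\<close>

lemma T_I:
  assumes "t \<in> G" "t$2$1 = 0" "t$3$1 = 0" "t$1$2 = 0" "t$1$3 = 0" "ge (t$1$1) 0" "ge (t$3$3) 0"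
  shows "t \<in> T"
proof -
  note d = diagonal_shape[OF assms(1-5)]
  have "ge (t$2$2) 0"
  proof (rule ge_norm)
    show "ge (c (t$2$2) * t$2$2) 0"
      using d by (simp add: ge_nz)
  qed simp
  then show ?thesis
    using assms d unfolding T_def K_iff by simp
qed

text \<open>Orthogonality relations of the first row: its isotropy bounds the norm of
  \<open>k$1$2\<close> by means of \<open>k$1$3\<close>, and its pairing with the third row then
  makes \<open>k$1$1 * c (k$3$3)\<close> congruent to 1.\<close>

lemma unit_1_1:
  assumes k: "k \<in> K" and h: "ge (k$1$3) (1 - m)"
  shows "k$1$1 \<noteq> 0 \<and> w (k$1$1) = 0 \<and> ge (k$1$2) (1 - m)"
proof -
  have G: "k \<in> G"
    using KG k .
  have v: "ge (k$1$1) 0" "ge (k$3$3) 0" "ge (k$3$2) m" "ge (k$3$1) m"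
    using k unfolding K_iff by auto
  have "c (k$1$2) * k$1$2 = - (k$1$1 * c (k$1$3) + k$1$3 * c (k$1$1))"
    using rows[OF G, of 1 3] by (simp add: algebra_simps eq_neg_iff_add_eq_0)
  moreover have "ge (k$1$1 * c (k$1$3) + k$1$3 * c (k$1$1)) (1 - m)"
    by (intro ge_add ge_mult[of _ 0 _ "1 - m"] ge_mult[of _ "1 - m" _ 0]) (use v h in auto)
  ultimately have "ge (c (k$1$2) * k$1$2) (1 - m)"
    by (simp only: ge_minus)
  then have 12: "ge (k$1$2) (1 - m)"
    by (rule ge_norm) (use m01 in auto)
  have "k$1$1 * c (k$3$3) = 1 - (k$1$2 * c (k$3$2) + k$1$3 * c (k$3$1))"
    using rows[OF G, of 1 1] by (simp add: algebra_simps)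
  moreover have s: "ge (k$1$2 * c (k$3$2) + k$1$3 * c (k$3$1)) 1"
    by (intro ge_add ge_mult[of _ "1 - m" _ m]) (use v 12 h in auto)
  moreover have "\<not> ge (1 - x) 1" if "ge x 1" for x
    using ge_add[of "1 - x" 1 x] that by (auto simp: ge_nz)
  ultimately have n: "\<not> ge (k$1$1 * c (k$3$3)) 1"
    by metis
  then have nz: "k$1$1 \<noteq> 0" "k$3$3 \<noteq> 0"
    by auto
  have "\<not> ge (k$1$1) 1"
    using n ge_mult[of "k$1$1" 1 "c (k$3$3)" 0 1] v(2) by auto
  then show ?thesis
    using nz v(1) 12 by (auto simp: ge_nz)
qed

lemma T_of_factor:
  assumes "g \<in> K" "l \<in> K" "r \<in> K" "t \<in> G" "g = l ** t ** r"
    "t$1$2 = 0" "t$1$3 = 0" "t$2$3 = 0" "t$2$1 = 0" "t$3$1 = 0" "t$3$2 = 0"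
  shows "t \<in> T"
proof -
  have "inv3 l ** g ** inv3 r = t"
    using assms(4,5) KG[OF assms(2)] KG[OF assms(3)] by simp
  moreover have "inv3 l ** g ** inv3 r \<in> K"
    using Km(1)[OF Km(1)[OF Km(2)[OF assms(2)] assms(1)] Km(2)[OF assms(3)]] .
  ultimately show ?thesis
    using assms unfolding T_def by auto
qed

lemma K_LDU:
  assumes g: "g \<in> K" and u: "g$1$1 \<noteq> 0" "w (g$1$1) = 0"
  shows "\<exists>t\<in>T. lowr (g$2$1 / g$1$1) (g$3$1 / g$1$1) \<in> U \<and> uppr (g$1$2 / g$1$1) (g$1$3 / g$1$1) \<in> K \<and>
    g = lowr (g$2$1 / g$1$1) (g$3$1 / g$1$1) ** t ** uppr (g$1$2 / g$1$1) (g$1$3 / g$1$1)"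
proof -
  obtain t where t: "t \<in> G" "lowr (g$2$1 / g$1$1) (g$3$1 / g$1$1) \<in> G" "uppr (g$1$2 / g$1$1) (g$1$3 / g$1$1) \<in> G"
    "g = lowr (g$2$1 / g$1$1) (g$3$1 / g$1$1) ** t ** uppr (g$1$2 / g$1$1) (g$1$3 / g$1$1)"
    "t$2$1 = 0" "t$3$1 = 0" "t$1$2 = 0" "t$1$3 = 0" "t$2$3 = 0" "t$3$2 = 0"
    using LDU[OF KG[OF g] u(1)] by blast
  have "lowr (g$2$1 / g$1$1) (g$3$1 / g$1$1) \<in> U"
    by (rule lowr_U[OF t(2)]) (use g u in \<open>simp_all add: K_iff ge_divide_iff\<close>)
  moreover have "uppr (g$1$2 / g$1$1) (g$1$3 / g$1$1) \<in> K"
    by (rule uppr_K[OF t(3)]) (use g u in \<open>simp_all add: K_iff ge_divide_iff\<close>)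
  ultimately show ?thesis
    using t T_of_factor[OF g _ _ t(1,4)] U_subK by blast
qed

text \<open>In rank one a single entry decides the cell. If \<open>k$1$3\<close> is smaller than
  \<open>K\<close> requires, the pivot is a unit and the upper factor falls into \<open>Q\<close>.
  Otherwise \<open>k$1$3\<close> has valuation exactly \<open>- m\<close>, and \<open>sw\<close>
  moves it into the pivot position.\<close>

lemma K_bruhat:
  assumes k: "k \<in> K"
  shows "(\<exists>u\<in>U. \<exists>t\<in>T. \<exists>q\<in>Q. k = u ** t ** q) \<or> (\<exists>u\<in>U. \<exists>t\<in>T. \<exists>u'\<in>U. k = u ** t ** sw ** u')"
proof (cases "ge (k$1$3) (1 - m)")
  case True
  then have u: "k$1$1 \<noteq> 0" "w (k$1$1) = 0" "ge (k$1$2) (1 - m)"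
    using unit_1_1[OF k] by auto
  let ?q = "uppr (k$1$2 / k$1$1) (k$1$3 / k$1$1)"
  obtain t where t: "t \<in> T" "lowr (k$2$1 / k$1$1) (k$3$1 / k$1$1) \<in> U" "?q \<in> K"
    "k = lowr (k$2$1 / k$1$1) (k$3$1 / k$1$1) ** t ** ?q"
    using K_LDU[OF k u(1,2)] by blast
  have "?q \<in> Q"
    unfolding Q_def Cong_def Mat_3 eQ_def
    using KG[OF t(3)] u True by (simp add: uppr_def ge_divide_iff)
  then show ?thesis
    using t by blast
next
  case False
  then have nz: "k$1$3 \<noteq> 0"
    by auto
  have v: "w (k$1$3) = - m"
    using False k nz m01 unfolding K_iff by (auto simp: ge_nz)
  define h where "h = k ** sw"
  have h: "h \<in> K" "k = h ** sw"
    unfolding h_def using Km(1)[OF k sw_K] sw_sw by simp_all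
  have h11: "h$1$1 = k$1$3 * vp"
    unfolding h_def mult3_nth by (simp add: sw_def)
  have u: "h$1$1 \<noteq> 0" "w (h$1$1) = 0"
    unfolding h11 using nz v by simp_all
  let ?r = "uppr (h$1$2 / h$1$1) (h$1$3 / h$1$1)"
  obtain t where t: "t \<in> T" "lowr (h$2$1 / h$1$1) (h$3$1 / h$1$1) \<in> U" "?r \<in> K"
    "h = lowr (h$2$1 / h$1$1) (h$3$1 / h$1$1) ** t ** ?r"
    using K_LDU[OF h(1) u] by blast
  have "k = lowr (h$2$1 / h$1$1) (h$3$1 / h$1$1) ** t ** sw ** (sw ** ?r ** sw)"
  proof -
    have "sw ** (sw ** (?r ** sw)) = ?r ** sw"
      using iv_l'[OF sw_G, of "?r ** sw"] inv3_sw by simp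
    then show ?thesis
      using h(2) t(4) by (metis assoc)
  qed
  then show ?thesis
    using t(1,2) sw_uppr_sw[OF t(3)] by blast
qed

text \<open>When the entry (1,1) attains the largest denominator allowed on the sphere, division by
  it leaves the triangular factors in \<open>K\<close>, and only the torus part carries the
  distance.\<close>

lemma cartan_corner:
  assumes g: "g \<in> bl (Suc n)" and c11: "\<not> ge (g$1$1) (- int n)"
  shows "\<exists>k\<in>K. \<exists>k'\<in>K. g = k ** gpow al (Suc n) ** k'"
proof -
  have G: "g \<in> G"
    using g unfolding bl_def by simp
  have v: "ge (g$1$1) (- int (Suc n))" "ge (g$1$2) (- int (Suc n))" "ge (g$1$3) (- m - int (Suc n))"
    "ge (g$2$1) (m - int (Suc n))" "ge (g$3$1) (m - int (Suc n))"
    using g unfolding bl_def Mat_3 eK_def by simp_all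
  have g0: "g$1$1 \<noteq> 0"
    using c11 by auto
  have wg: "w (g$1$1) = - int (Suc n)"
    using v(1) c11 g0 by (simp add: ge_nz)
  obtain t where t: "t \<in> G" "lowr (g$2$1 / g$1$1) (g$3$1 / g$1$1) \<in> G" "uppr (g$1$2 / g$1$1) (g$1$3 / g$1$1) \<in> G"
    "g = lowr (g$2$1 / g$1$1) (g$3$1 / g$1$1) ** t ** uppr (g$1$2 / g$1$1) (g$1$3 / g$1$1)"
    "t$2$1 = 0" "t$3$1 = 0" "t$1$2 = 0" "t$1$3 = 0" "t$2$3 = 0" "t$3$2 = 0" "t$1$1 = g$1$1"
    "c (t$3$3) * t$1$1 = 1"
    using LDU[OF G g0] by blast
  let ?l = "lowr (g$2$1 / g$1$1) (g$3$1 / g$1$1)" and ?r = "uppr (g$1$2 / g$1$1) (g$1$3 / g$1$1)"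
  have "?l \<in> U"
    by (rule lowr_U[OF t(2)]) (use g0 wg v in \<open>auto simp: ge_divide_iff elim!: ge_mono\<close>)
  then have l: "?l \<in> K"
    using U_subK by blast
  have r: "?r \<in> K"
    by (rule uppr_K[OF t(3)]) (use g0 wg v in \<open>auto simp: ge_divide_iff elim!: ge_mono\<close>)
  define a where "a = gpow al (Suc n)"
  have aG: "a \<in> G"
    unfolding a_def using al_G by (rule gpow_G)
  \<comment> \<open>The pivot has negative valuation, so the torus part is \<open>inv3 a\<close> up
    to \<open>T\<close>; conjugation by \<open>sw\<close> brings it back to
    \<open>a\<close>.\<close>
  have a_inv: "inv3 a = sw ** a ** sw"
    unfolding a_def gpow_al sw_conj mat3_eq_iff by simp
  have t33: "t$3$3 \<noteq> 0" "w (t$3$3) = int (Suc n)"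
  proof -
    show "t$3$3 \<noteq> 0"
      using t(12) by auto
    then have "w (c (t$3$3) * t$1$1) = w (t$3$3) + w (g$1$1)"
      using g0 t(11) by simp
    then show "w (t$3$3) = int (Suc n)"
      using t(12) wg by simp
  qed
  have ta: "t ** a \<in> T"
  proof (rule T_I)
    show "t ** a \<in> G"
      using t aG by simp
    show "(t ** a)$2$1 = 0" "(t ** a)$3$1 = 0" "(t ** a)$1$2 = 0" "(t ** a)$1$3 = 0"
      unfolding mult3_nth a_def gpow_al using t by simp_all
    show "ge ((t ** a)$1$1) 0" "ge ((t ** a)$3$3) 0"
      unfolding mult3_nth a_def gpow_al using t(5-11) g0 wg t33
      by (simp_all add: ge_nz del: power_Suc flip: power_inverse)
  qed
  have "g = ?l ** (t ** a) ** inv3 a ** ?r"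
    using t(4) aG by simp
  also have "\<dots> = (?l ** (t ** a) ** sw) ** a ** (sw ** ?r)"
    unfolding a_inv by simp
  finally have "g = (?l ** (t ** a) ** sw) ** a ** (sw ** ?r)" .
  moreover have "?l ** (t ** a) ** sw \<in> K" "sw ** ?r \<in> K"
    using l r ta T_subK sw_K Km(1) by blast+
  ultimately show ?thesis
    unfolding a_def by blast
qed

text \<open>Unitarity expresses the norms of the entries in the middle row and column through the
  corners. If all corners fit into the smaller ball, so do the other entries; hence on a sphere some
  corner is extremal.\<close>

lemma sphere_corner:
  assumes g: "g \<in> bl (Suc n)" and n: "g \<notin> bl n"
  shows "\<not> (ge (g$1$1) (- int n) \<and> ge (g$1$3) (- m - int n) \<and> ge (g$3$1) (m - int n) \<and> ge (g$3$3) (- int n))"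
proof
  assume h: "ge (g$1$1) (- int n) \<and> ge (g$1$3) (- m - int n) \<and> ge (g$3$1) (m - int n) \<and> ge (g$3$3) (- int n)"
  have G: "g \<in> G"
    using g unfolding bl_def by simp
  have gez: "ge y k" if "c y * y = - (x * c z + z * c x)" "ge x a" "ge z b" "2 * k - 1 \<le> a + b"
    for x y z a b k
  proof (rule ge_norm[OF _ that(4)])
    have "ge (x * c z) (a + b)"
      by (rule ge_mult[of _ a _ b]) (use that in auto)
    moreover have "ge (z * c x) (a + b)"
      by (rule ge_mult[of _ b _ a]) (use that in auto)
    ultimately show "ge (c y * y) (a + b)"
      unfolding that(1) ge_minus by (rule ge_add)
  qed
  have 21: "ge (g$2$1) (m - int n)"
    by (rule gez[of _ "g$3$1" "g$1$1" "m - int n" "- int n"])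
      (use columns[OF G, of 3 1] h m01 in \<open>auto simp: algebra_simps eq_neg_iff_add_eq_0\<close>)
  have 23: "ge (g$2$3) (- int n)"
    by (rule gez[of _ "g$3$3" "g$1$3" "- int n" "- m - int n"])
      (use columns[OF G, of 1 3] h m01 in \<open>auto simp: algebra_simps eq_neg_iff_add_eq_0\<close>)
  have 12: "ge (g$1$2) (- int n)"
    by (rule gez[of _ "g$1$1" "g$1$3" "- int n" "- m - int n"])
      (use rows[OF G, of 1 3] h m01 in \<open>auto simp: algebra_simps eq_neg_iff_add_eq_0\<close>)
  have 32: "ge (g$3$2) (m - int n)"
    by (rule gez[of _ "g$3$1" "g$3$3" "m - int n" "- int n"])
      (use rows[OF G, of 3 1] h m01 in \<open>auto simp: algebra_simps eq_neg_iff_add_eq_0\<close>)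
  have "c (g$2$2) * g$2$2 = 1 - (c (g$3$2) * g$1$2 + c (g$1$2) * g$3$2)"
    using columns[OF G, of 2 2] by (simp add: algebra_simps)
  moreover have "ge (c (g$3$2) * g$1$2 + c (g$1$2) * g$3$2) (m - 2 * int n)"
    by (intro ge_add ge_mult[of _ "m - int n" _ "- int n"] ge_mult[of _ "- int n" _ "m - int n"]) (use 32 12 in auto)
  then have "ge (1 - (c (g$3$2) * g$1$2 + c (g$1$2) * g$3$2)) (- 2 * int n)"
    by (intro ge_diff) (use m01 in \<open>auto simp: ge_nz elim: ge_mono\<close>)
  ultimately have 22: "ge (g$2$2) (- int n)"
    using ge_norm[of "g$2$2" "- 2 * int n" "- int n"] by simp
  show False
    using n h G 12 21 22 23 32 unfolding bl_def Mat_3 eK_def by simp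
qed

text \<open>For the least ball containing \<open>g\<close> some corner is extremal, and
  multiplication by \<open>sw\<close> on either side moves it to position (1,1).\<close>

lemma cartan_decomposition:
  assumes "g \<in> G"
  shows "\<exists>n. \<exists>k\<in>K. \<exists>k'\<in>K. g = k ** gpow al n ** k'"
proof -
  define n where "n = (LEAST n. g \<in> bl n)"
  have "\<exists>n. g \<in> bl n"
    using ball_ge[OF assms] assms unfolding bl_def by blast
  then have n: "g \<in> bl n"
    unfolding n_def by (rule LeastI_ex)
  show ?thesis
  proof (cases n)
    case 0
    then show ?thesis
      using n bl_0 subgrD(2)[OF Km_sub] by (intro exI[of _ 0] bexI[of _ g] bexI[of _ "mat 1"]) auto
  next
    case (Suc l)
    have gl: "g \<in> bl (Suc l)" "g \<notin> bl l"
      using n not_less_Least[of l "\<lambda>n. g \<in> bl n"] unfolding n_def[symmetric] Suc by auto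
    have *: "\<exists>k\<in>K. \<exists>k'\<in>K. g = k ** gpow al (Suc l) ** k'"
      if h: "x \<in> K" "y \<in> K" "\<not> ge ((x ** g ** y)$1$1) (- int l)" for x y
    proof -
      obtain k k' where k: "k \<in> K" "k' \<in> K" "x ** g ** y = k ** gpow al (Suc l) ** k'"
        using cartan_corner[OF bl_r[OF h(2) bl_l[OF h(1) gl(1)]] h(3)] by blast
      have "g = inv3 x ** (x ** g ** y) ** inv3 y"
        using KG h by simp
      also have "\<dots> = (inv3 x ** k) ** gpow al (Suc l) ** (k' ** inv3 y)"
        unfolding k(3) by (simp del: gpow.simps)
      finally show ?thesis
        using Km h k by blast
    qed
    have one: "mat 1 \<in> K"
      by (rule subgrD(2)[OF Km_sub])
    have e: "(mat 1 ** g ** mat 1)$1$1 = g$1$1" "(mat 1 ** g ** sw)$1$1 = g$1$3 * vp"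
      "(sw ** g ** mat 1)$1$1 = g$3$1 / vp" "(sw ** g ** sw)$1$1 = g$3$3"
      unfolding mult3_nth by (simp_all add: sw_def field_simps)
    have "\<not> ge (g$1$3 * vp) (- int l)" if "\<not> ge (g$1$3) (- m - int l)"
      using that ge_mono[of "g$1$3" "- int l - m" "- m - int l"] ge_mult_iff[of vp "g$1$3" "- int l"]
      by (auto simp: mult.commute)
    moreover have "\<not> ge (g$3$1 / vp) (- int l)" if "\<not> ge (g$3$1) (m - int l)"
      using that by (simp add: ge_divide_iff)
    ultimately show ?thesis
      using sphere_corner[OF gl] *[OF one one] *[OF one sw_K] *[OF sw_K one] *[OF sw_K sw_K] unfolding e by blast
  qed
qed


section \<open>Verification of the axioms of a Hecke pair\<close>

lemma lowr_anti: "c y = - y \<Longrightarrow> ge y m \<Longrightarrow> lowr 0 y \<in> U"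
  by (rule lowr_U[OF lowr_G]) auto

lemma gpow_lowr: "gpow (lowr 0 y) n = lowr 0 (of_nat n * y)"
proof (induction n)
  case 0
  then show ?case
    by (simp add: mat3_eq_iff lowr_def)
next
  case (Suc n)
  show ?case
    unfolding gpow.simps Suc mat3_eq_iff mult3_nth by (simp add: lowr_def algebra_simps)
qed

lemma Q_U_iff: "u \<in> U \<Longrightarrow> u \<in> Q \<longleftrightarrow> ge (u$2$1) 1 \<and> ge (u$3$1) (1 + m) \<and> ge (u$3$2) 1"
  unfolding Q_def Cong_def Mat_3 eQ_def U_def using KG by auto

lemma U_nth: "u \<in> U \<Longrightarrow> u$1$1 = 1 \<and> u$2$2 = 1 \<and> u$3$3 = 1 \<and> u$1$2 = 0 \<and> u$1$3 = 0 \<and> u$2$3 = 0 \<and>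
    ge (u$2$1) m \<and> ge (u$3$1) m \<and> ge (u$3$2) m \<and> u \<in> G"
  unfolding U_def K_iff by simp

lemma U_I:
  assumes "u \<in> G" "u$1$1 = 1" "u$2$2 = 1" "u$3$3 = 1" "u$1$2 = 0" "u$1$3 = 0" "u$2$3 = 0"
    "ge (u$2$1) m" "ge (u$3$1) m" "ge (u$3$2) m"
  shows "u \<in> U"
  using assms unfolding U_def K_iff by (simp add: ge_nz)

lemma cofinite_K: "A \<subseteq> K \<Longrightarrow> Cong (\<lambda>_ _. int N) \<subseteq> H \<Longrightarrow> cofinite_in H A"
proof (rule cofinite_Cong)
  assume A: "A \<subseteq> K"
  show "A \<subseteq> G"
    using A KG by auto
  show "Mat (\<lambda>_ _. - 1) g" if "g \<in> A" for g
    using that A Mat_mono[of eK g "\<lambda>_ _. - 1"] eK_bounds unfolding K_def by auto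
qed

text \<open>The elimination is applied to the inverse of \<open>g\<close>, since it puts the lower
  factor on the left while the lower factor is wanted on the right. Integrality after conjugation by
  \<open>al\<close> makes the lower entries small, so that the pivot is a unit and the conjugated
  lower factor stays in \<open>U\<close>.\<close>

lemma neighbour_stabilizer_decomposition:
  assumes g: "g \<in> K" "al ** g ** inv3 al \<in> K"
  shows "\<exists>u\<in>U. \<exists>t\<in>T. \<exists>u'\<in>U. g = sw ** u ** sw ** t ** (inv3 al ** u' ** al)"
proof -
  have G: "g \<in> G"
    using KG g by blast
  define h where "h = inv3 g"
  have h: "h \<in> K" "al ** h ** inv3 al \<in> K" "h \<in> G"
  proof -
    show "h \<in> K" "h \<in> G"
      unfolding h_def using Km(2)[OF g(1)] KG by auto
    have "inv3 (al ** g ** inv3 al) = al ** h ** inv3 al"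
      unfolding h_def using al_G G by simp
    then show "al ** h ** inv3 al \<in> K"
      using Km(2)[OF g(2)] by simp
  qed
  have v: "ge (h$2$1) (m + 1)" "ge (h$3$1) (m + 2)" "ge (h$3$2) (m + 1)"
    using h(2) unfolding K_iff al_conj by (simp_all add: ge_divide_iff add.assoc)
  have v': "ge (h$1$1) 0" "ge (h$1$2) 0" "ge (h$1$3) (- m)" "ge (h$3$3) 0"
    using h(1) unfolding K_iff by auto
  have "h$1$1 * c (h$3$3) = 1 - (h$1$2 * c (h$3$2) + h$1$3 * c (h$3$1))"
    using rows[OF h(3), of 1 1] by (simp add: algebra_simps)
  moreover have "ge (h$1$2 * c (h$3$2) + h$1$3 * c (h$3$1)) 1"
    by (intro ge_add ge_mult[of "h$1$2" 0 _ "m + 1"] ge_mult[of "h$1$3" "- m" _ "m + 2"])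
      (use v v' m01 in auto)
  moreover have "\<not> ge (1 - x) 1" if "ge x 1" for x
    using ge_add[of "1 - x" 1 x] that by (auto simp: ge_nz)
  ultimately have n: "\<not> ge (h$1$1 * c (h$3$3)) 1"
    by metis
  have "\<not> ge (h$1$1) 1"
    using n ge_mult[of "h$1$1" 1 "c (h$3$3)" 0 1] v' by auto
  moreover from this have "h$1$1 \<noteq> 0"
    by auto
  ultimately have u: "h$1$1 \<noteq> 0" "w (h$1$1) = 0"
    using v'(1) by (simp_all add: ge_nz)
  let ?l = "lowr (h$2$1 / h$1$1) (h$3$1 / h$1$1)" and ?r = "uppr (h$1$2 / h$1$1) (h$1$3 / h$1$1)"
  obtain t where t: "t \<in> T" "?l \<in> U" "?r \<in> K" "h = ?l ** t ** ?r"
    using K_LDU[OF h(1) u] by blast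
  have l: "?l \<in> G" "?r \<in> G" "t \<in> G"
    using t U_subK T_subK KG by auto
  define u1 where "u1 = sw ** inv3 ?r ** sw"
  define u2 where "u2 = al ** inv3 ?l ** inv3 al"
  have "u1 = inv3 (sw ** ?r ** sw)"
    unfolding u1_def using l sw_G inv3_sw by simp
  then have u1: "u1 \<in> U"
    using subgrD(4)[OF Um_sub sw_uppr_sw[OF t(3)]] by simp
  have u2: "u2 \<in> U"
  proof (rule U_I)
    show "u2 \<in> G"
      unfolding u2_def using l al_G by simp
  qed (use v u in \<open>simp_all add: u2_def al_conj lowr_def ge_divide_iff add.assoc del: assoc\<close>)
  have "g = inv3 h"
    unfolding h_def by simp
  also have "\<dots> = inv3 (?l ** t ** ?r)"
    using t(4) by simp
  also have "\<dots> = inv3 ?r ** inv3 t ** inv3 ?l"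
    using l by simp
  also have "inv3 ?r = sw ** u1 ** sw"
    unfolding u1_def using sw_sw iv_l'[OF sw_G] inv3_sw by simp
  also have "inv3 ?l = inv3 al ** u2 ** al"
    unfolding u2_def using al_G by simp
  finally show ?thesis
    using u1 u2 subgrD(4)[OF Tm_sub t(1)] by blast
qed

lemma datum: "hecke_pair (**) (mat 1) inv3 G K U T Q sw al p bl"
proof
  show "subgr K" "subgr U" "U \<subseteq> K" "subgr T" "T \<subseteq> K" "subgr Q" "Q \<subseteq> K" "sw \<in> K" "sw ** sw = mat 1"
    "al \<in> G" "prime p" "bl 0 = K"
    by (fact Km_sub Um_sub U_subK Tm_sub T_subK Qm_sub Q_subK sw_K sw_sw al_G p_prime bl_0)+
  show "k ** q ** inv3 k \<in> Q" if "k \<in> K" "q \<in> Q" for k q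
    by (rule Qm_norm[OF that])
  show "sw ** al ** sw = inv3 al"
    unfolding sw_conj mat3_eq_iff by (simp add: al_def)
  show "sw ** t ** sw \<in> T" if "t \<in> T" for t
  proof -
    have "sw ** t ** sw \<in> K"
      using that T_subK sw_K Km(1) by blast
    then show ?thesis
      using that unfolding T_def sw_conj by simp
  qed
  show "t ** u ** inv3 t \<in> U" if t: "t \<in> T" and u: "u \<in> U" for t u
  proof -
    have "t ** u ** inv3 t \<in> K"
      using Km(1)[OF Km(1) Km(2)] t u T_subK U_subK by (meson subsetD)
    moreover have tz: "t$1$2 = 0" "t$1$3 = 0" "t$2$3 = 0" "t$2$1 = 0" "t$3$1 = 0" "t$3$2 = 0" "t \<in> G"
      using t KG unfolding T_def by auto
    moreover have "c (t$3$3) * t$1$1 = 1" "c (t$2$2) * t$2$2 = 1"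
      using diagonal_shape[OF tz(7,4,5,1,2)] by auto
    moreover have "t$3$3 * c (t$1$1) = 1"
      using rows[OF tz(7), of 3 3] tz by simp
    ultimately show ?thesis
      using U_nth[OF u] unfolding U_def by (simp add: mult3_nth mult.commute)
  qed
  show "al ** t = t ** al" if "t \<in> T" for t
    using that unfolding T_def mat3_eq_iff mult3_nth by (simp add: al_def)
  show "(\<exists>u\<in>U. \<exists>t\<in>T. \<exists>q\<in>Q. k = u ** t ** q) \<or> (\<exists>u\<in>U. \<exists>t\<in>T. \<exists>u'\<in>U. k = u ** t ** sw ** u')"
    if "k \<in> K" for k
    by (rule K_bruhat[OF that])
  show "u \<in> Q" if u: "u \<in> U" and h: "u' \<in> U" "t \<in> T" "q \<in> Q" "sw ** u ** sw = u' ** t ** q" for u u' t q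
  proof -
    \<comment> \<open>The right side lies in the Iwahori order. Conjugation by \<open>sw\<close>
      moves the entries of \<open>u\<close> above the diagonal, where membership in that order
      becomes the condition of \<open>Q_U_iff\<close>.\<close>
    have "Mat (eP (0 + 0 + 0)) (u' ** t ** q)"
      by (rule Mat_mult[OF Mat_mult[OF eP_0_Mat T_Mat eP_add] eP_0_Mat eP_add])
        (use h U_subP Q_subP in auto)
    then have "Mat (eP 0) (sw ** u ** sw)"
      using h(4) by simp
    then show ?thesis
      unfolding Q_U_iff[OF u] sw_conj Mat_3 eP_def ht_def using m01
      by (auto simp: ge_divide_iff elim: ge_mono)
  qed
  have Q2: "Cong (\<lambda>_ _. int 2) \<subseteq> Q"
    unfolding Q_def using Cong_mono eK_bounds by fastforce
  show "cofinite_in Q U"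
    by (rule cofinite_K[OF U_subK Q2])
  show "\<exists>z\<in>U. z \<notin> Q \<and> gpow z p \<in> Q"
  proof (intro bexI conjI)
    \<comment> \<open>An element negated by \<open>c\<close> of valuation exactly \<open>m\<close>:
      allowed in \<open>U\<close>, too large for \<open>Q\<close>, but in \<open>Q\<close> after
      multiplication by \<open>p\<close>.\<close>
    let ?y = "vp * \<epsilon>"
    show U: "lowr 0 ?y \<in> U"
      by (rule lowr_anti) (auto simp: ge_nz)
    show "lowr 0 ?y \<notin> Q"
      unfolding Q_U_iff[OF U] by (simp add: lowr_def ge_nz)
    have "ge (of_nat p * ?y) (1 + m)"
      by (rule ge_mult[OF vge_p, of _ m]) (auto simp: ge_nz)
    moreover have "lowr 0 (of_nat p * ?y) \<in> U"
      using gpow_subgr[OF Um_sub U, of p] unfolding gpow_lowr .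
    ultimately have "lowr 0 (of_nat p * ?y) \<in> Q"
      using Q_U_iff by (simp add: lowr_def)
    then show "gpow (lowr 0 ?y) p \<in> Q"
      unfolding gpow_lowr .
  qed
  show "inv3 al ** u ** al \<in> U \<inter> Q" if u: "u \<in> U" for u
  proof -
    have a: "inv3 al ** u ** al \<in> U"
    proof (rule U_I)
      show "inv3 al ** u ** al \<in> G"
        using U_nth[OF u] al_G by simp
    qed (use U_nth[OF u] in \<open>auto simp: al_conj' ge_mult_iff simp del: assoc elim: ge_mono\<close>)
    moreover have "inv3 al ** u ** al \<in> Q"
      unfolding Q_U_iff[OF a] unfolding al_conj'
      using U_nth[OF u] m01 by (auto simp: ge_mult_iff elim: ge_mono)
    ultimately show ?thesis
      by blast
  qed
  show "\<exists>u\<in>U. \<exists>t\<in>T. \<exists>u'\<in>U. g = sw ** u ** sw ** t ** (inv3 al ** u' ** al)"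
    if "g \<in> K" "al ** g ** inv3 al \<in> K" for g
    by (rule neighbour_stabilizer_decomposition[OF that])
  show "cofinite_in {g \<in> K. al ** g ** inv3 al \<in> K} K"
  proof (rule cofinite_K[OF order_refl])
    show "Cong (\<lambda>_ _. int 3) \<subseteq> {g \<in> K. al ** g ** inv3 al \<in> K}"
    proof
      fix g assume g: "g \<in> Cong (\<lambda>_ _. int 3)"
      have G: "g \<in> G"
        using g Cong_G by blast
      have e: "ge (g$1$2) 3" "ge (g$1$3) 3" "ge (g$2$1) 3" "ge (g$2$3) 3" "ge (g$3$1) 3" "ge (g$3$2) 3"
        using g unfolding Cong_def Mat_3 by simp_all
      have d: "ge (g$1$1) 0" "ge (g$2$2) 0" "ge (g$3$3) 0"
        using Cong_Mat[OF g, of "\<lambda>_ _. 0"] unfolding Mat_3 by simp_all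
      have "al ** g ** inv3 al \<in> G"
        using G al_G by simp
      then show "g \<in> {g \<in> K. al ** g ** inv3 al \<in> K}"
        unfolding K_iff al_conj using e d m01 G
        by (auto simp: ge_divide_iff ge_mult_iff elim: ge_mono)
    qed
  qed
  show "bl n \<subseteq> G" for n
    unfolding bl_def by auto
  show "bl n \<subseteq> bl (Suc n)" for n
    unfolding bl_def by (auto elim: Mat_mono)
  show "\<exists>n. g \<in> bl n" if "g \<in> G" for g
    using ball_ge[OF that] that unfolding bl_def by blast
  show "k ** g \<in> bl n" "g ** k \<in> bl n" if "k \<in> K" "g \<in> bl n" for k g n
    using bl_l[OF that] bl_r[OF that] .
  show "al ** g \<in> bl (Suc n)" "inv3 al ** g \<in> bl (Suc n)" if "g \<in> bl n" for g n
    using bl_al[OF that] .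
  show "gpow al (Suc n) \<notin> bl n" for n
    unfolding gpow_al bl_def Mat_3 eK_def by (simp add: ge_nz del: power_Suc flip: power_inverse)
  show "al ** k ** sw ** inv3 al \<in> K" if k: "k \<in> K" and b: "al ** k ** gpow al (Suc n) \<in> bl n" for k n
  proof -
    have G: "k \<in> G"
      using KG k .
    \<comment> \<open>Two entries of the last column bound \<open>k$3$3\<close> and
      \<open>k$2$3\<close>; isotropy of the third row of \<open>k\<close> then bounds
      \<open>k$3$2\<close>, and these are the bounds that matter after right multiplication by
      \<open>sw\<close>.\<close>
    have "ge ((al ** k ** gpow al (Suc n))$3$3) (- int n)" "ge ((al ** k ** gpow al (Suc n))$2$3) (- int n)"
      using b unfolding bl_def Mat_3 eK_def by simp_all
    then have "ge (k$3$3 / (\<pi> * \<pi> ^ Suc n)) (- int n)" "ge (k$2$3 / \<pi> ^ Suc n) (- int n)"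
      unfolding mult3_nth gpow_al by (simp_all add: al_def field_simps)
    then have 33: "ge (k$3$3) 2" and 23: "ge (k$2$3) 1"
      by (simp_all add: ge_divide_iff del: power_Suc)
    have v: "ge (k$1$1) 0" "ge (k$2$1) m" "ge (k$2$2) 0" "ge (k$1$2) 0" "ge (k$1$3) (- m)" "ge (k$3$1) m"
      using k unfolding K_iff by auto
    have "c (k$3$2) * k$3$2 = - (k$3$1 * c (k$3$3) + k$3$3 * c (k$3$1))"
      using rows[OF G, of 3 1] by (simp add: algebra_simps eq_neg_iff_add_eq_0)
    moreover have "ge (k$3$1 * c (k$3$3) + k$3$3 * c (k$3$1)) (m + 2)"
      by (intro ge_add ge_mult[of "k$3$1" m _ 2] ge_mult[of "k$3$3" 2 _ m]) (use 33 v in auto)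
    ultimately have "ge (c (k$3$2) * k$3$2) (m + 2)"
      by (simp only: ge_minus)
    then have 32: "ge (k$3$2) (m + 1)"
      by (rule ge_norm) (use m01 in auto)
    have 21: "ge (k$2$1) 0"
      using v(2) m01 by (auto elim: ge_mono)
    define h where "h = k ** sw"
    have hn: "h$1$1 = k$1$3 * vp" "h$1$2 = k$1$2" "h$1$3 = k$1$1 / vp" "h$2$1 = k$2$3 * vp" "h$2$2 = k$2$2"
      "h$2$3 = k$2$1 / vp" "h$3$1 = k$3$3 * vp" "h$3$2 = k$3$2" "h$3$3 = k$3$1 / vp"
      unfolding h_def mult3_nth by (simp_all add: sw_def field_simps)
    have "al ** h ** inv3 al \<in> K"
      unfolding K_iff unfolding al_conj
    proof (intro conjI)
      show "mk3 (h$1$1) (\<pi> * h$1$2) (\<pi> * (\<pi> * h$1$3)) (h$2$1 / \<pi>) (h$2$2) (\<pi> * h$2$3)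
          (h$3$1 / \<pi> / \<pi>) (h$3$2 / \<pi>) (h$3$3) \<in> G"
        unfolding al_conj[symmetric] h_def using G al_G sw_G by simp
    qed (use v 33 32 23 m01 in \<open>auto simp: hn ge_divide_iff ge_mult_iff mult.commute[of _ vp] elim: ge_mono\<close>)
    then show ?thesis
      unfolding h_def by simp
  qed
  show "\<exists>n. \<exists>k\<in>K. \<exists>k'\<in>K. g = k ** gpow al n ** k'" if "g \<in> G" for g
    by (rule cartan_decomposition[OF that])
  show "\<exists>q\<in>U \<inter> Q. al ** q ** inv3 al \<notin> K"
  proof (intro bexI IntI)
    \<comment> \<open>Valuation \<open>m + 1\<close> suffices for \<open>Q\<close>, but conjugation
      by \<open>al\<close> divides twice by \<open>\<pi>\<close> and leaves \<open>m - 1\<close>,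
      outside \<open>K\<close>.\<close>
    let ?y = "\<pi> * (vp * \<epsilon>)"
    show U: "lowr 0 ?y \<in> U"
      by (rule lowr_anti) (auto simp: ge_nz)
    show "lowr 0 ?y \<in> Q"
      unfolding Q_U_iff[OF U] by (simp add: lowr_def ge_nz)
    show "al ** lowr 0 ?y ** inv3 al \<notin> K"
      unfolding K_iff unfolding al_conj by (simp add: lowr_def ge_nz)
  qed
qed

end

section \<open>Freeness over the spherical Hecke algebra\<close>

lemma (in linear_space) ex_functional_nonzero:
  assumes "v \<noteq> 0"
  shows "\<exists>l. functional scale l \<and> l v \<noteq> 0"
proof -
  interpret vector_space_pair scale "(*) :: 'a \<Rightarrow> 'a \<Rightarrow> 'a"
    by unfold_locales (simp_all add: algebra_simps)
  have "independent {v}"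
    using assms by simp
  then obtain g where g: "Vector_Spaces.linear scale (*) g" "g v = 1"
    using linear_independent_extend[of "{v}" "\<lambda>_. 1"] by blast
  then show ?thesis
    unfolding functional_def using linear_add[OF g(1)] linear_scale[OF g(1)] by (intro exI[of _ g]) simp
qed

context unitary3
begin

section \<open>Smoothness and the transfer to the unitary group\<close>

lemma congr_iff: "congr w g n \<longleftrightarrow> Mat (\<lambda>_ _. n) (g - mat 1)"
  unfolding congr_def Mat_def by simp

lemma conj_Cong:
  assumes g: "Mat (\<lambda>_ _. a) g" "Mat (\<lambda>_ _. a') (inv3 g)" "g \<in> G" and h: "h \<in> G" "congr w h n"
  shows "congr w (g ** h ** inv3 g) (a + n + a')"
proof -
  have "Mat (\<lambda>_ _. a + n + a') (g ** (h - mat 1) ** inv3 g)"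
    by (rule Mat_mult[OF Mat_mult[where e'' = "\<lambda>_ _. a + n", OF g(1) h(2)[unfolded congr_iff]] g(2)]) simp_all
  moreover have "g ** (h - mat 1) ** inv3 g = g ** h ** inv3 g - mat 1"
    using g by (simp add: mult_diff_left mult_diff_right)
  ultimately show ?thesis
    unfolding congr_iff by simp
qed

lemma K_bound: "k \<in> K \<Longrightarrow> Mat (\<lambda>_ _. - 1) k"
  unfolding K_def using Mat_mono[of eK k "\<lambda>_ _. - 1"] eK_bounds by simp

text \<open>The vectors all of whose translates are fixed at level \<open>n + 2\<close> form a
  subrepresentation. It contains a vector fixed at level \<open>n\<close>, since conjugation by
  \<open>k\<close> loses at most one level for \<open>k\<close> and one for its inverse.\<close>

lemma uniformly_smooth:
  fixes sc :: "'k::field \<Rightarrow> 'w::ab_group_add \<Rightarrow> 'w"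
  assumes r: "smooth_irred_rep w K sc \<sigma>"
  shows "\<exists>n. \<forall>g\<in>K. congr w g n \<longrightarrow> (\<forall>v. \<sigma> g v = v)"
proof -
  have md: "module sc" and add: "\<And>k u v. k \<in> K \<Longrightarrow> \<sigma> k (u + v) = \<sigma> k u + \<sigma> k v"
    and scl: "\<And>k a v. k \<in> K \<Longrightarrow> \<sigma> k (sc a v) = sc a (\<sigma> k v)"
    and one: "\<And>v. \<sigma> (mat 1) v = v"
    and mul: "\<And>k k' v. k \<in> K \<Longrightarrow> k' \<in> K \<Longrightarrow> \<sigma> (k ** k') v = \<sigma> k (\<sigma> k' v)"
    and smooth: "\<And>v. \<exists>n. \<forall>k\<in>K. congr w k n \<longrightarrow> \<sigma> k v = v" and nz: "\<exists>v::'w. v \<noteq> 0"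
    and irr: "\<And>S. module.subspace sc S \<Longrightarrow> \<forall>k\<in>K. \<sigma> k ` S \<subseteq> S \<Longrightarrow> S = {0} \<or> S = UNIV"
    using r unfolding smooth_irred_rep_def by auto
  interpret module sc
    by (rule md)
  obtain v0 where v0: "v0 \<noteq> (0::'w)"
    using nz by blast
  obtain n where n: "\<And>k. k \<in> K \<Longrightarrow> congr w k n \<Longrightarrow> \<sigma> k v0 = v0"
    using smooth by blast
  have z: "\<sigma> k 0 = 0" if "k \<in> K" for k
    using add[OF that, of 0 0] by simp
  define S where "S = {v. \<forall>k\<in>K. \<forall>h\<in>K. congr w h (n + 2) \<longrightarrow> \<sigma> h (\<sigma> k v) = \<sigma> k v}"
  have "subspace S"
  proof (rule subspaceI)
    show "0 \<in> S"
      unfolding S_def using z by simp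
    show "u + v \<in> S" if "u \<in> S" "v \<in> S" for u v
      using that unfolding S_def by (simp add: add)
    show "sc a v \<in> S" if "v \<in> S" for a v
      using that unfolding S_def by (simp add: scl)
  qed
  moreover have "\<sigma> k v \<in> S" if k: "k \<in> K" and v: "v \<in> S" for k v
    unfolding S_def
  proof (intro CollectI ballI impI)
    fix k' h assume h: "k' \<in> K" "h \<in> K" "congr w h (n + 2)"
    have "\<sigma> k' (\<sigma> k v) = \<sigma> (k' ** k) v"
      using mul[OF h(1) k] by simp
    then show "\<sigma> h (\<sigma> k' (\<sigma> k v)) = \<sigma> k' (\<sigma> k v)"
      using v Km(1)[OF h(1) k] h(2,3) unfolding S_def by simp
  qed
  moreover have "v0 \<in> S"
    unfolding S_def
  proof (intro CollectI ballI impI)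
    fix k h assume k: "k \<in> K" and h: "h \<in> K" "congr w h (n + 2)"
    have G: "k \<in> G" "h \<in> G"
      using k h KG by auto
    have "congr w (inv3 k ** h ** inv3 (inv3 k)) (- 1 + (n + 2) + - 1)"
      by (rule conj_Cong) (use k h G K_bound Km(2)[OF k] in auto)
    then have "\<sigma> (inv3 k ** h ** k) v0 = v0"
      using n[of "inv3 k ** h ** k"] Km k h by simp
    moreover have "h ** k = k ** (inv3 k ** h ** k)"
      using G by simp
    then have "\<sigma> h (\<sigma> k v0) = \<sigma> k (\<sigma> (inv3 k ** h ** k) v0)"
      using mul[OF h(1) k, of v0] mul[OF k Km(1)[OF Km(1)[OF Km(2)[OF k] h(1)] k], of v0] by metis
    ultimately show "\<sigma> h (\<sigma> k v0) = \<sigma> k v0"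
      by simp
  qed
  ultimately have "S = UNIV"
    using irr[of S] v0 by blast
  then have "\<sigma> h v = v" if "h \<in> K" "congr w h (n + 2)" for h v
    using that subgrD(2)[OF Km_sub] one[of v] unfolding S_def by (metis (mono_tags, lifting) UNIV_I mem_Collect_eq)
  then show ?thesis
    by blast
qed

text \<open>The two existence axioms come from \<open>fixed_eigenvector\<close>, applied to
  \<open>\<sigma>\<close> and to its contragredient on functionals; \<open>P 0\<close> contains
  \<open>U\<close> and \<open>Q\<close>, so its fixed vectors have the invariance that is asked
  for.\<close>

lemma hecke_rep:
  fixes sc :: "'k::field \<Rightarrow> 'w::ab_group_add \<Rightarrow> 'w"
  assumes r: "smooth_irred_rep w K sc \<sigma>"
    and closed: "\<And>P :: 'k poly. 0 < degree P \<Longrightarrow> \<exists>z. poly P z = 0" and char: "CHAR('k) = p"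
  shows "hecke_rep (**) (mat 1) inv3 G K U T Q sw al p bl sc \<sigma>"
proof -
  have md: "module sc" and add: "\<And>k u v. k \<in> K \<Longrightarrow> \<sigma> k (u + v) = \<sigma> k u + \<sigma> k v"
    and scl: "\<And>k a v. k \<in> K \<Longrightarrow> \<sigma> k (sc a v) = sc a (\<sigma> k v)"
    and one: "\<And>v. \<sigma> (mat 1) v = v"
    and mul: "\<And>k k' v. k \<in> K \<Longrightarrow> k' \<in> K \<Longrightarrow> \<sigma> (k ** k') v = \<sigma> k (\<sigma> k' v)"
    and nz: "\<exists>v::'w. v \<noteq> 0"
    and irr: "\<And>S. module.subspace sc S \<Longrightarrow> \<forall>k\<in>K. \<sigma> k ` S \<subseteq> S \<Longrightarrow> S = {0} \<or> S = UNIV"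
    using r unfolding smooth_irred_rep_def by auto
  have lin: "linear_space sc"
    using md unfolding linear_space_def vector_space_def module_def .
  interpret linear_space sc
    by (rule lin)
  interpret filt: pro_p_filtration "(**)" "mat 1" inv3 G K P T p
    by (rule filtration)
  obtain n where n: "\<And>g v. g \<in> K \<Longrightarrow> congr w g n \<Longrightarrow> \<sigma> g v = v"
    using uniformly_smooth[OF r] by blast
  \<comment> \<open>One power of the maximal ideal costs three levels and \<open>ht\<close> is at
    most 2, so this level forces congruence to 1 at level \<open>n\<close>.\<close>
  define N where "N = nat (3 * n + 2)"
  have PN: "\<sigma> g v = v" if g: "g \<in> P N" for g v
  proof (rule n)
    show "g \<in> K"
      using g P_subK by blast
    have "n \<le> eP (int N + 1) i j" for i j
    proof -
      have "ht i j \<le> 2"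
        using m01 exhaust_3[of i] exhaust_3[of j] unfolding ht_def by auto
      then show ?thesis
        unfolding eP_def N_def by (simp add: nat_le_iff) presburger
    qed
    moreover have "Mat (eP (int N + 1)) (g - mat 1)"
      using g unfolding P_def Cong_def by simp
    ultimately show "congr w g n"
      unfolding congr_iff by (rule Mat_mono[rotated])
  qed
  have UQ: "g \<in> P 0" if "g \<in> U \<or> g \<in> Q" for g
    using that U_subP Q_subP by blast
  have vec: "\<exists>v\<in>UNIV. v \<noteq> 0 \<and> (\<forall>g\<in>P 0. \<sigma> g v = v) \<and> (\<forall>t\<in>T. \<exists>z. \<sigma> t v = sc z v)"
    by (rule filt.fixed_eigenvector[OF lin closed char add scl mul]) (use nz one PN in auto)
  let ?\<rho> = "\<lambda>g l. \<lambda>v. l (\<sigma> (inv3 g) v)" and ?fs = "\<lambda>a l. \<lambda>v::'w. a * l v :: 'k"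
  have flin: "linear_space ?fs"
    unfolding linear_space_def
    by unfold_locales (simp_all add: fun_eq_iff algebra_simps)
  have fsub: "module.subspace ?fs (Collect (functional sc))"
  proof -
    interpret fs: linear_space ?fs
      by (rule flin)
    show ?thesis
      by (rule fs.subspaceI) (auto simp: functional_def algebra_simps)
  qed
  have "\<exists>l\<in>Collect (functional sc). l \<noteq> 0 \<and> (\<forall>g\<in>P 0. ?\<rho> g l = l) \<and> (\<forall>t\<in>T. \<exists>z. ?\<rho> t l = ?fs z l)"
  proof (rule filt.fixed_eigenvector[OF flin closed char])
    show "\<exists>l\<in>Collect (functional sc). l \<noteq> 0"
      using nz ex_functional_nonzero by fastforce
    show "?\<rho> (g ** h) l = ?\<rho> g (?\<rho> h l)" if "g \<in> K" "h \<in> K" for g h l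
      using that KG mul[OF Km(2)[OF that(2)] Km(2)[OF that(1)]] by simp
    show "?\<rho> g l \<in> Collect (functional sc)" if "g \<in> K" "l \<in> Collect (functional sc)" for g l
      using that add[OF Km(2)] scl[OF Km(2)] unfolding functional_def by simp
    show "?\<rho> g l = l" if "g \<in> P N" for g l
      using PN[OF subgrD(4)[OF Pm_sub that]] by simp
    show "?\<rho> (mat 1) l = l" for l
      using one by simp
  qed (use fsub in \<open>auto simp: fun_eq_iff algebra_simps\<close>)
  then obtain l where l: "functional sc l" "l \<noteq> 0" "\<And>g. g \<in> P 0 \<Longrightarrow> ?\<rho> g l = l"
    "\<And>t. t \<in> T \<Longrightarrow> \<exists>z. ?\<rho> t l = ?fs z l"
    by (elim bexE conjE) simp
  have lU: "l (\<sigma> u v) = l v" if u: "u \<in> U" for u v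
    using fun_cong[OF l(3)[OF UQ[OF disjI1[OF subgrD(4)[OF Um_sub u]]]], of v] u U_subK KG by auto
  have lT: "\<exists>a. \<forall>v. l (\<sigma> t v) = a * l v" if t: "t \<in> T" for t
    using l(4)[OF subgrD(4)[OF Tm_sub t]] t T_subK KG by (auto simp: fun_eq_iff subset_iff)
  show ?thesis
  proof (intro hecke_rep.intro datum lin, unfold_locales)
    show "\<sigma> k (u + v) = \<sigma> k u + \<sigma> k v" "\<sigma> k (sc a v) = sc a (\<sigma> k v)"
      if "k \<in> K" for k u v a
      using add scl that by auto
    show "\<sigma> (mat 1) v = v" for v
      by (rule one)
    show "\<sigma> (k ** k') v = \<sigma> k (\<sigma> k' v)" if "k \<in> K" "k' \<in> K" for k k' v
      by (rule mul[OF that])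
    show "S = UNIV" if "subspace S" "\<And>k w. k \<in> K \<Longrightarrow> w \<in> S \<Longrightarrow> \<sigma> k w \<in> S" "v \<in> S" "v \<noteq> 0" for S v
      using irr[OF that(1)] that(2-4) by blast
    show "of_nat p = (0::'k)"
      using of_nat_CHAR[where ?'a = 'k] char by simp
    show "\<exists>l. functional sc l \<and> (\<exists>w. l w \<noteq> 0) \<and> (\<forall>u\<in>U. \<forall>w. l (\<sigma> u w) = l w)
        \<and> (\<forall>t\<in>T. \<exists>a. \<forall>w. l (\<sigma> t w) = a * l w)"
      using l(1,2) lU lT by (intro exI[of _ l]) (auto simp: fun_eq_iff)
    show "\<exists>v. v \<noteq> 0 \<and> (\<forall>u\<in>U. \<sigma> u v = v) \<and> (\<forall>q\<in>Q. \<sigma> q v = v)"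
    proof -
      obtain v where "v \<noteq> 0" "\<forall>g\<in>P 0. \<sigma> g v = v"
        using vec by (elim bexE conjE)
      then show ?thesis
        using UQ by (intro exI[of _ v]) auto
    qed
  qed
qed

text \<open>Writing \<open>g ** h\<close> as a conjugate of \<open>h\<close> times \<open>g\<close>
  moves a small right translation to the left, where equivariance and smoothness of
  \<open>\<sigma>\<close> at the vector \<open>f g\<close> apply.\<close>

lemma right_smooth:
  fixes f :: "'e mat3 \<Rightarrow> 'w::ab_group_add" and sc :: "'k::field \<Rightarrow> 'w \<Rightarrow> 'w"
  assumes r: "smooth_irred_rep w K sc \<sigma>" and g: "g \<in> G"
    and f: "\<And>k g. k \<in> K \<Longrightarrow> g \<in> G \<Longrightarrow> f (k ** g) = \<sigma> k (f g)"
  shows "\<exists>n. \<forall>h\<in>G. congr w h n \<longrightarrow> f (g ** h) = f g"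
proof -
  have "\<And>v. \<exists>n. \<forall>k\<in>K. congr w k n \<longrightarrow> \<sigma> k v = v"
    using r unfolding smooth_irred_rep_def by simp
  then obtain n where n: "\<forall>k\<in>K. congr w k n \<longrightarrow> \<sigma> k (f g) = f g"
    by blast
  have "\<exists>a. Mat (\<lambda>_ _. a) g" if G: "g \<in> G" for g
  proof -
    obtain d where "Mat (\<lambda>i j. eK i j - int d) g"
      using ball_ge[OF G] by blast
    moreover have "- 1 - int d \<le> eK i j - int d" for i j
      using eK_bounds(1)[of i j] by simp
    ultimately show ?thesis
      using Mat_mono[of _ g "\<lambda>_ _. - 1 - int d"] by (intro exI[of _ "- 1 - int d"]) blast
  qed
  then obtain a a' where a: "Mat (\<lambda>_ _. a) g" "Mat (\<lambda>_ _. a') (inv3 g)"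
    using g G_iv by metis
  show ?thesis
  proof (intro exI ballI impI)
    \<comment> \<open>Level 1 puts the conjugate into \<open>K\<close>, level \<open>n\<close> makes
      it fix \<open>f g\<close>, and \<open>a\<close> and \<open>a'\<close> compensate for the
      denominators of \<open>g\<close> and its inverse.\<close>
    fix h assume h: "h \<in> G" "congr w h (max n 1 - a - a')"
    let ?k = "g ** h ** inv3 g"
    have kc: "congr w ?k (max n 1)"
      using conj_Cong[OF a g h] by simp
    have kG: "?k \<in> G"
      using g h by simp
    have "?k \<in> Cong (\<lambda>_ _. max n 1)"
      using kc kG unfolding Cong_def congr_iff by simp
    then have "Mat eK ?k"
      by (rule Cong_Mat) (use eK_bounds in \<open>auto simp: le_max_iff_disj\<close>)
    then have kK: "?k \<in> K"
      using kG unfolding K_def by simp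
    have "congr w ?k n"
      using kc Mat_mono[of "\<lambda>_ _. max n 1" _ "\<lambda>_ _. n"] unfolding congr_iff by simp
    then have "\<sigma> ?k (f g) = f g"
      using n kK by blast
    moreover have "g ** h = ?k ** g"
      using g by simp
    ultimately show "f (g ** h) = f g"
      using f[OF kK g] by metis
  qed
qed

theorem free_module:
  fixes sc :: "'k::field \<Rightarrow> 'w::ab_group_add \<Rightarrow> 'w"
  assumes r: "smooth_irred_rep w K sc \<sigma>"
    and closed: "\<And>P :: 'k poly. 0 < degree P \<Longrightarrow> \<exists>z. poly P z = 0" and char: "CHAR('k) = p"
  shows "\<exists>B. infinite B \<and> free_basis (hecke G sc (cind w G K \<sigma>)) (cind w G K \<sigma>) B"
proof -
  interpret R: hecke_rep "(**)" "mat 1" inv3 G K U T Q sw al p bl sc \<sigma>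
    by (rule hecke_rep[OF assms])
  have V: "cind w G K \<sigma> = R.V"
  proof (intro equalityI subsetI)
    fix f assume f: "f \<in> R.V"
    have "\<exists>n. \<forall>h\<in>G. congr w h n \<longrightarrow> f (g ** h) = f g" if "g \<in> G" for g
      by (rule right_smooth[OF r that R.V_K[OF f]])
    then show "f \<in> cind w G K \<sigma>"
      using f unfolding cind_def R.V_def by blast
  qed (simp add: cind_def R.V_def)
  have "hecke G sc R.V = R.Hecke"
    unfolding hecke_def R.Hecke_def R.scf_def R.rt_def rtrans_def by simp
  then show ?thesis
    using R.free_over_Hecke unfolding V by simp
qed

end

theorem theorem4p1:
  fixes w :: "'e::field \<Rightarrow> int" and c :: "'e \<Rightarrow> 'e" and p :: nat
    and K :: "'e mat3 set"
    and sc :: "'k::field \<Rightarrow> 'w::ab_group_add \<Rightarrow> 'w"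
    and \<sigma> :: "'e mat3 \<Rightarrow> 'w \<Rightarrow> 'w"
  assumes "unramified_quadratic w c p" and "odd p"
    and "is_Fp_bar TYPE('k) p"
    and "K = K0 w c \<or> K = K1 w c"
    and "smooth_irred_rep w K sc \<sigma>"
  shows "\<exists>B. infinite B \<and>
           free_basis (hecke (U21 c) sc (cind w (U21 c) K \<sigma>)) (cind w (U21 c) K \<sigma>) B"
proof -
  have closed: "\<And>P :: 'k poly. 0 < degree P \<Longrightarrow> \<exists>z. poly P z = 0" and char: "CHAR('k) = p"
    using assms(3) unfolding is_Fp_bar_def by auto
  obtain \<pi> where \<pi>: "c \<pi> = \<pi>" "\<pi> \<noteq> 0" "w \<pi> = 1"
    using assms(1) unfolding unramified_quadratic_def by blast
  obtain \<epsilon> where \<epsilon>: "\<epsilon> \<noteq> 0" "w \<epsilon> = 0" "c \<epsilon> = - \<epsilon>"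
    using ex_antisymmetric_unit[OF assms(1) \<pi>] by blast
  have u: "unitary3 w c p \<pi> \<epsilon> m" if "m = 0 \<or> m = 1" for m
    using assms(1) \<pi> \<epsilon> that by unfold_locales auto
  have "K0 w c = unitary3.K w c 0"
  proof -
    interpret unitary3 w c p \<pi> \<epsilon> 0
      by (rule u) simp
    show ?thesis
      unfolding K0_def set_eq_iff K_iff by (auto simp: forall_3)
  qed
  moreover have "K1 w c = unitary3.K w c 1"
  proof -
    interpret unitary3 w c p \<pi> \<epsilon> 1
      by (rule u) simp
    show ?thesis
      unfolding K1_def set_eq_iff K_iff by auto
  qed
  ultimately obtain m where m: "m = 0 \<or> m = 1" "K = unitary3.K w c m"
    using assms(4) by blast
  show ?thesis
    using unitary3.free_module[OF u[OF m(1)] _ closed char] assms(5) unfolding m(2) by blast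
qed

end
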